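(* (Legendre transformation for contact dynamics.) Let $\mathcal{Q}$ be a smooth manifold and let $L:T\mathcal{Q}\times\mathbb{R}\to\mathbb{R}$, $L=L(q,\dot q,z)$, be an arbitrary smooth function (no regularity is assumed). Then $$\mathcal{N}_L:=(\alpha^c)^{-1}\big(\mathrm{im}(dL,L)\big)=\Big\{\Big(q^i,\tfrac{\partial L}{\partial\dot q^i},z,\dot q^i,\tfrac{\partial L}{\partial z}\tfrac{\partial L}{\partial\dot q^i}+\tfrac{\partial L}{\partial q^i},L,-\tfrac{\partial L}{\partial z}\Big)\Big\}$$ is a Legendrian submanifold of the contact manifold $(T(T^*\mathcal{Q}\times\mathbb{R})\times\mathbb{R},\eta_{\mathcal{Q}}^{\mathcal{T}})$. Moreover, let $E(q^i,\dot q^i,p_i,z)=p_i\dot q^i-L(q,\dot q,z)$ on $T\mathcal{Q}\times_{\mathcal{Q}}T^*\mathcal{Q}\times\mathbb{R}$, and let $\mathcal{N}_{-E}$ be the Legendrian submanifold of $T^*(T^*\mathcal{Q}\times\mathbb{R})\times\mathbb{R}$ generated by the Morse family $-E$ over $T^*\mathcal{Q}\times\mathbb{R}$, that is $$\mathcal{N}_{-E}=\Big\{\Big(q^i,p_i,z,-\tfrac{\partial E}{\partial q^i},-\tfrac{\partial E}{\partial p_i},-\tfrac{\partial E}{\partial z},-E\Big):\ \tfrac{\partial E}{\partial\dot q^i}=0\Big\}.$$ Then $$(\beta^c)^{-1}(\mathcal{N}_{-E})=\mathcal{N}_L .$$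
   Context: Let $(q^i)$ be local coordinates on $\mathcal{Q}$. Coordinates on $T(T^*\mathcal{Q}\times\mathbb{R})\times\mathbb{R}$ are $(q^i,p_i,z,\dot q^i,\dot p_i,\dot z,u)$, induced from coordinates $(q^i,p_i,z)$ on $T^*\mathcal{Q}\times\mathbb{R}$, with $u$ on the last factor. Coordinates on $T^*(T\mathcal{Q}\times\mathbb{R})\times\mathbb{R}$ are $(q^i,\dot q^i,z)$, then the conjugate momenta of $q^i,\dot q^i,z$, then the last real factor; coordinates on $T^*(T^*\mathcal{Q}\times\mathbb{R})\times\mathbb{R}$ are $(q^i,p_i,z)$, then the conjugate momenta of $q^i,p_i,z$, then the last real factor. For a function $F$ on a manifold $\mathcal{N}$, $(dF,F):\mathcal{N}\to T^*\mathcal{N}\times\mathbb{R}$ denotes $x\mapsto(dF(x),F(x))$. The extended cotangent bundle $T^*\mathcal{N}\times\mathbb{R}$ carries the canonical contact form $dw-\theta_{\mathcal{N}}$ with $w$ the real coordinate and $\theta_{\mathcal{N}}$ the Liouville form. The contact form on $T(T^*\mathcal{Q}\times\mathbb{R})\times\mathbb{R}$ is $\eta_{\mathcal{Q}}^{\mathcal{T}}=d\dot z+u\,dz-(\dot p_i+up_i)dq^i-p_id\dot q^i$ (equal to $u\,\eta_{\mathcal{Q}}^V+\eta_{\mathcal{Q}}^C$, with $V$ and $C$ the vertical and complete lifts of $\eta_{\mathcal{Q}}=dz-p_idq^i$). The (globally defined) contact diffeomorphisms are $$\alpha^c:T(T^*\mathcal{Q}\times\mathbb{R})\times\mathbb{R}\to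 T^*(T\mathcal{Q}\times\mathbb{R})\times\mathbb{R},\quad (q^i,p_i,z,\dot q^i,\dot p_i,\dot z,u)\mapsto(q^i,\dot q^i,z,up_i+\dot p_i,p_i,-u,\dot z),$$ $$\beta^c:T(T^*\mathcal{Q}\times\mathbb{R})\times\mathbb{R}\to T^*(T^*\mathcal{Q}\times\mathbb{R})\times\mathbb{R},\quad (q^i,p_i,z,\dot q^i,\dot p_i,\dot z,u)\mapsto(q^i,p_i,z,up_i+\dot p_i,-\dot q^i,-u,\dot z-p_i\dot q^i).$$ A Legendrian submanifold of a contact manifold of dimension $2m+1$ is an $m$-dimensional submanifold on which the contact form pulls back to zero. *)

theory Defs
  imports "HOL-Analysis.Analysis"
begin

section \<open>Smooth maps between Euclidean spaces\<close>

(* C^k on an open set S: all iterated directional derivatives of order at most k exist and are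
   continuous. *)
primrec Ck_on :: "nat \<Rightarrow> 'a set \<Rightarrow> ('a::euclidean_space \<Rightarrow> 'b::real_normed_vector) \<Rightarrow> bool" where
  "Ck_on 0 S f = continuous_on S f"
| "Ck_on (Suc k) S f =
     ((\<forall>x\<in>S. f differentiable at x) \<and> (\<forall>v. Ck_on k S (\<lambda>x. frechet_derivative f (at x) v)))"

definition smooth_on :: "'a::euclidean_space set \<Rightarrow> ('a \<Rightarrow> 'b::real_normed_vector) \<Rightarrow> bool" where
  "smooth_on S f \<longleftrightarrow> (\<forall>k. Ck_on k S f)"

(* The coordinate vector of the differential of f. On a product space, the gradient in one of the
   factors is the vector of the partial derivatives in the corresponding block of coordinates. *)
definition grad :: "('a::euclidean_space \<Rightarrow> real) \<Rightarrow> 'a \<Rightarrow> 'a" where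
  "grad f x = (\<Sum>b\<in>Basis. frechet_derivative f (at x) b *\<^sub>R b)"


section \<open>Smooth manifolds\<close>

(* A chart is its domain together with its coordinate map (only the values on the domain matter).
   A manifold is given by an atlas, which need not be maximal: its points are those covered by the
   charts, and its topology is the one for which the charts are homeomorphisms onto open sets.
   The model space 'e carries the coordinate tuple: a single variable q :: 'e stands for (q^i), and
   contractions such as p_i v^i become inner products. *)
type_synonym ('a, 'e) chart = "'a set \<times> ('a \<Rightarrow> 'e)"

abbreviation chart_dom :: "('a, 'e) chart \<Rightarrow> 'a set" where
  "chart_dom c \<equiv> fst c"

abbreviation coords :: "('a, 'e) chart \<Rightarrow> 'a \<Rightarrow> 'e" where
  "coords c \<equiv> snd c"

definition chart_img :: "('a, 'e) chart \<Rightarrow> 'e set" where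
  "chart_img c = coords c ` chart_dom c"

definition chart_inv :: "('a, 'e) chart \<Rightarrow> 'e \<Rightarrow> 'a" where
  "chart_inv c = inv_into (chart_dom c) (coords c)"

definition transition :: "('a, 'e) chart \<Rightarrow> ('a, 'e) chart \<Rightarrow> 'e \<Rightarrow> 'e" where
  "transition c c' = coords c' \<circ> chart_inv c"

definition points :: "('a, 'e) chart set \<Rightarrow> 'a set" where
  "points A = (\<Union>c\<in>A. chart_dom c)"

definition charts_at :: "('a, 'e) chart set \<Rightarrow> 'a \<Rightarrow> ('a, 'e) chart set" where
  "charts_at A x = {c \<in> A. x \<in> chart_dom c}"

definition smooth_atlas :: "('a, 'e::euclidean_space) chart set \<Rightarrow> bool" where
  "smooth_atlas A \<longleftrightarrow>
     (\<forall>c\<in>A. inj_on (coords c) (chart_dom c)) \<and>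
     (\<forall>c\<in>A. open (chart_img c)) \<and>
     (\<forall>c\<in>A. \<forall>c'\<in>A. open (coords c ` (chart_dom c \<inter> chart_dom c')) \<and>
        smooth_on (coords c ` (chart_dom c \<inter> chart_dom c')) (transition c c'))"

definition atlas_topology :: "('a, 'e::euclidean_space) chart set \<Rightarrow> 'a topology" where
  "atlas_topology A =
     topology (\<lambda>W. W \<subseteq> points A \<and> (\<forall>c\<in>A. \<exists>V. open V \<and> W \<inter> chart_dom c = coords c -` V \<inter> chart_dom c))"

lemma openin_atlas_topology:
  "openin (atlas_topology A) W \<longleftrightarrow>
     W \<subseteq> points A \<and> (\<forall>c\<in>A. \<exists>V. open V \<and> W \<inter> chart_dom c = coords c -` V \<inter> chart_dom c)"
proof -
  let ?P = "\<lambda>W. W \<subseteq> points A \<and>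
    (\<forall>c\<in>A. \<exists>V. open V \<and> W \<inter> chart_dom c = coords c -` V \<inter> chart_dom c)"
  have "istopology ?P"
    unfolding istopology_def
  proof (intro conjI allI impI)
    fix S T assume S: "?P S" and T: "?P T"
    show "S \<inter> T \<subseteq> points A" using S by blast
    show "\<forall>c\<in>A. \<exists>V. open V \<and> S \<inter> T \<inter> chart_dom c = coords c -` V \<inter> chart_dom c"
    proof
      fix c assume "c \<in> A"
      then obtain V V' where "open V" "S \<inter> chart_dom c = coords c -` V \<inter> chart_dom c"
        "open V'" "T \<inter> chart_dom c = coords c -` V' \<inter> chart_dom c"
        using S T by blast
      then have "open (V \<inter> V') \<and> S \<inter> T \<inter> chart_dom c = coords c -` (V \<inter> V') \<inter> chart_dom c"
        by blast
      then show "\<exists>V. open V \<and> S \<inter> T \<inter> chart_dom c = coords c -` V \<inter> chart_dom c" ..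
    qed
  next
    fix K assume K: "\<forall>S\<in>K. ?P S"
    show "\<Union>K \<subseteq> points A" using K by blast
    show "\<forall>c\<in>A. \<exists>V. open V \<and> \<Union>K \<inter> chart_dom c = coords c -` V \<inter> chart_dom c"
    proof
      fix c assume "c \<in> A"
      then have "\<forall>S\<in>K. \<exists>V. open V \<and> S \<inter> chart_dom c = coords c -` V \<inter> chart_dom c"
        using K by blast
      then obtain V where V: "\<forall>S\<in>K. open (V S) \<and> S \<inter> chart_dom c = coords c -` V S \<inter> chart_dom c"
        by metis
      have "open (\<Union>S\<in>K. V S)" using V by blast
      moreover have "\<Union>K \<inter> chart_dom c = coords c -` (\<Union>S\<in>K. V S) \<inter> chart_dom c"
        using V by blast
      ultimately show "\<exists>V. open V \<and> \<Union>K \<inter> chart_dom c = coords c -` V \<inter> chart_dom c"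
        by blast
    qed
  qed
  then show ?thesis
    by (simp add: atlas_topology_def)
qed

definition smooth_manifold :: "('a, 'e::euclidean_space) chart set \<Rightarrow> bool" where
  "smooth_manifold A \<longleftrightarrow>
     smooth_atlas A \<and> Hausdorff_space (atlas_topology A) \<and> second_countable (atlas_topology A)"

definition smooth_function :: "('a, 'e::euclidean_space) chart set \<Rightarrow> ('a \<Rightarrow> real) \<Rightarrow> bool" where
  "smooth_function A f \<longleftrightarrow> (\<forall>c\<in>A. smooth_on (chart_img c) (f \<circ> chart_inv c))"


section \<open>Tangent and cotangent bundles, products with the real line\<close>

(* A tangent vector at x is the family of its coordinate vectors in all charts of the atlas around x,
   subject to the usual transformation law; likewise for covectors, whose coordinate vectors pair
   with those of tangent vectors through the inner product of the model space. *)
definition tangent_space ::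
  "('a, 'e::euclidean_space) chart set \<Rightarrow> 'a \<Rightarrow> (('a, 'e) chart \<Rightarrow> 'e) set" where
  "tangent_space A x = {v \<in> extensional (charts_at A x).
     \<forall>c\<in>charts_at A x. \<forall>c'\<in>charts_at A x.
       v c' = frechet_derivative (transition c c') (at (coords c x)) (v c)}"

definition cotangent_space ::
  "('a, 'e::euclidean_space) chart set \<Rightarrow> 'a \<Rightarrow> (('a, 'e) chart \<Rightarrow> 'e) set" where
  "cotangent_space A x = {\<xi> \<in> extensional (charts_at A x).
     \<forall>c\<in>charts_at A x. \<forall>c'\<in>charts_at A x. \<forall>w.
       \<xi> c \<bullet> w = \<xi> c' \<bullet> frechet_derivative (transition c c') (at (coords c x)) w}"

definition pairing ::
  "('a, 'e::euclidean_space) chart set \<Rightarrow> 'a \<Rightarrow> (('a, 'e) chart \<Rightarrow> 'e) \<Rightarrow> (('a, 'e) chart \<Rightarrow> 'e) \<Rightarrow> real"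
  where "pairing A x \<xi> v = (THE r. \<forall>c\<in>charts_at A x. r = \<xi> c \<bullet> v c)"

type_synonym ('a, 'e) based = "'a \<times> (('a, 'e) chart \<Rightarrow> 'e)"

definition tangent_chart ::
  "('a, 'e::euclidean_space) chart set \<Rightarrow> ('a, 'e) chart \<Rightarrow> (('a, 'e) based, 'e \<times> 'e) chart" where
  "tangent_chart A c =
     ({(x, v). x \<in> chart_dom c \<and> v \<in> tangent_space A x}, \<lambda>(x, v). (coords c x, v c))"

definition cotangent_chart ::
  "('a, 'e::euclidean_space) chart set \<Rightarrow> ('a, 'e) chart \<Rightarrow> (('a, 'e) based, 'e \<times> 'e) chart" where
  "cotangent_chart A c =
     ({(x, \<xi>). x \<in> chart_dom c \<and> \<xi> \<in> cotangent_space A x}, \<lambda>(x, \<xi>). (coords c x, \<xi> c))"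

definition line_chart :: "('a, 'e) chart \<Rightarrow> ('a \<times> real, 'e \<times> real) chart" where
  "line_chart c = (chart_dom c \<times> UNIV, \<lambda>(x, t). (coords c x, t))"

definition tangent_bundle ::
  "('a, 'e::euclidean_space) chart set \<Rightarrow> (('a, 'e) based, 'e \<times> 'e) chart set" where
  "tangent_bundle A = tangent_chart A ` A"

definition cotangent_bundle ::
  "('a, 'e::euclidean_space) chart set \<Rightarrow> (('a, 'e) based, 'e \<times> 'e) chart set" where
  "cotangent_bundle A = cotangent_chart A ` A"

definition times_line :: "('a, 'e) chart set \<Rightarrow> ('a \<times> real, 'e \<times> real) chart set" where
  "times_line A = line_chart ` A"

abbreviation ext_tangent_bundle ::
  "('a, 'e::euclidean_space) chart set \<Rightarrow> (('a, 'e) based \<times> real, ('e \<times> 'e) \<times> real) chart set" where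
  "ext_tangent_bundle A \<equiv> times_line (tangent_bundle A)"

abbreviation ext_cotangent_bundle ::
  "('a, 'e::euclidean_space) chart set \<Rightarrow> (('a, 'e) based \<times> real, ('e \<times> 'e) \<times> real) chart set" where
  "ext_cotangent_bundle A \<equiv> times_line (cotangent_bundle A)"

abbreviation ext_tangent_chart ::
  "('a, 'e::euclidean_space) chart set \<Rightarrow> ('a, 'e) chart \<Rightarrow>
     (('a, 'e) based \<times> real, ('e \<times> 'e) \<times> real) chart" where
  "ext_tangent_chart A c \<equiv> line_chart (tangent_chart A c)"

abbreviation ext_cotangent_chart ::
  "('a, 'e::euclidean_space) chart set \<Rightarrow> ('a, 'e) chart \<Rightarrow>
     (('a, 'e) based \<times> real, ('e \<times> 'e) \<times> real) chart" where
  "ext_cotangent_chart A c \<equiv> line_chart (cotangent_chart A c)"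

definition differential ::
  "('a, 'e::euclidean_space) chart set \<Rightarrow> ('a \<Rightarrow> real) \<Rightarrow> 'a \<Rightarrow> (('a, 'e) chart \<Rightarrow> 'e)" where
  "differential A f x = (\<lambda>c\<in>charts_at A x. grad (f \<circ> chart_inv c) (coords c x))"

(* im (dF, F) *)
definition jet_image ::
  "('a, 'e::euclidean_space) chart set \<Rightarrow> ('a \<Rightarrow> real) \<Rightarrow> (('a, 'e) based \<times> real) set" where
  "jet_image A f = (\<lambda>x. ((x, differential A f x), f x)) ` points A"


section \<open>Contact manifolds and Legendrian submanifolds\<close>

definition smooth_one_form ::
  "('a, 'e::euclidean_space) chart set \<Rightarrow> ('a \<Rightarrow> ('a, 'e) chart \<Rightarrow> 'e) \<Rightarrow> bool" where
  "smooth_one_form A \<eta> \<longleftrightarrow>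
     (\<forall>x\<in>points A. \<eta> x \<in> cotangent_space A x) \<and>
     (\<forall>c\<in>A. smooth_on (chart_img c) (\<lambda>y. \<eta> (chart_inv c y) c))"

(* d\<omega> for a one-form \<omega> on an open subset of the model space *)
definition ext_deriv :: "('e::euclidean_space \<Rightarrow> 'e) \<Rightarrow> 'e \<Rightarrow> 'e \<Rightarrow> 'e \<Rightarrow> real" where
  "ext_deriv \<omega> y v w =
     frechet_derivative \<omega> (at y) v \<bullet> w - frechet_derivative \<omega> (at y) w \<bullet> v"

(* \<eta> is nowhere zero and d\<eta> is nondegenerate on ker \<eta> *)
definition contact_manifold ::
  "('a, 'e::euclidean_space) chart set \<Rightarrow> ('a \<Rightarrow> ('a, 'e) chart \<Rightarrow> 'e) \<Rightarrow> bool" where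
  "contact_manifold A \<eta> \<longleftrightarrow>
     smooth_manifold A \<and> odd (DIM('e)) \<and> smooth_one_form A \<eta> \<and>
     (\<forall>c\<in>A. \<forall>y\<in>chart_img c. let \<omega> = (\<lambda>y. \<eta> (chart_inv c y) c) in
        \<omega> y \<noteq> 0 \<and>
        (\<forall>v. \<omega> y \<bullet> v = 0 \<and> (\<forall>w. \<omega> y \<bullet> w = 0 \<longrightarrow> ext_deriv \<omega> y v w = 0) \<longrightarrow> v = 0))"

definition compatible_chart :: "('a, 'e::euclidean_space) chart set \<Rightarrow> ('a, 'e) chart \<Rightarrow> bool" where
  "compatible_chart A c \<longleftrightarrow> chart_dom c \<subseteq> points A \<and> smooth_atlas (insert c A)"

definition slice_chart ::
  "('a, 'e::euclidean_space) chart set \<Rightarrow> nat \<Rightarrow> 'a set \<Rightarrow> ('a, 'e) chart \<Rightarrow> 'e set \<Rightarrow> bool" where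
  "slice_chart A m S c W \<longleftrightarrow>
     compatible_chart A c \<and> subspace W \<and> dim W = m \<and>
     coords c ` (chart_dom c \<inter> S) = chart_img c \<inter> W"

definition submanifold :: "('a, 'e::euclidean_space) chart set \<Rightarrow> nat \<Rightarrow> 'a set \<Rightarrow> bool" where
  "submanifold A m S \<longleftrightarrow>
     S \<subseteq> points A \<and> (\<forall>x\<in>S. \<exists>c W. slice_chart A m S c W \<and> x \<in> chart_dom c)"

(* The image of T_x S under the differential of the inclusion, in slice coordinates. *)
definition submanifold_tangent_space ::
  "('a, 'e::euclidean_space) chart set \<Rightarrow> nat \<Rightarrow> 'a set \<Rightarrow> 'a \<Rightarrow> (('a, 'e) chart \<Rightarrow> 'e) set" where
  "submanifold_tangent_space A m S x = {v \<in> tangent_space A x.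
     \<exists>c W w. slice_chart A m S c W \<and> x \<in> chart_dom c \<and> w \<in> W \<and>
       (\<forall>c'\<in>charts_at A x. v c' = frechet_derivative (transition c c') (at (coords c x)) w)}"

definition legendrian_submanifold ::
  "('a, 'e::euclidean_space) chart set \<Rightarrow> ('a \<Rightarrow> ('a, 'e) chart \<Rightarrow> 'e) \<Rightarrow> 'a set \<Rightarrow> bool" where
  "legendrian_submanifold A \<eta> S \<longleftrightarrow>
     contact_manifold A \<eta> \<and>
     (\<exists>m. DIM('e) = 2 * m + 1 \<and> submanifold A m S \<and>
        (\<forall>x\<in>S. \<forall>v\<in>submanifold_tangent_space A m S x. pairing A x (\<eta> x) v = 0))"

(* The canonical contact form dw - \<theta> on the extended cotangent bundle, in the induced coordinates
   ((y, \<xi>), w), where \<theta> = \<xi> dy. *)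
definition canonical_contact_form ::
  "('a, 'e::euclidean_space) chart set \<Rightarrow> ('a, 'e) based \<times> real \<Rightarrow>
     (('a, 'e) based \<times> real, ('e \<times> 'e) \<times> real) chart \<Rightarrow> ('e \<times> 'e) \<times> real" where
  "canonical_contact_form B x =
     (\<lambda>k\<in>charts_at (ext_cotangent_bundle B) x. case coords k x of ((y, \<xi>), w) \<Rightarrow> ((- \<xi>, 0), 1))"


section \<open>The contact Tulczyjew triple\<close>

(* The atlas A is that of the configuration manifold Q. *)

(* T(T*Q x R) x R, with coordinates ((((q, p), z), ((q', p'), z')), u); the dots are primes here *)
type_synonym ('a, 'e) tulczyjew =
  "((('a, 'e) based \<times> real, ('e \<times> 'e) \<times> real) based) \<times> real"

type_synonym 'e tulczyjew_model = "((('e \<times> 'e) \<times> real) \<times> (('e \<times> 'e) \<times> real)) \<times> real"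

abbreviation tulczyjew_bundle ::
  "('a, 'e::euclidean_space) chart set \<Rightarrow> (('a, 'e) tulczyjew, 'e tulczyjew_model) chart set" where
  "tulczyjew_bundle A \<equiv> ext_tangent_bundle (ext_cotangent_bundle A)"

abbreviation tulczyjew_chart ::
  "('a, 'e::euclidean_space) chart set \<Rightarrow> ('a, 'e) chart \<Rightarrow>
     (('a, 'e) tulczyjew, 'e tulczyjew_model) chart" where
  "tulczyjew_chart A c \<equiv> ext_tangent_chart (ext_cotangent_bundle A) (ext_cotangent_chart A c)"

(* T*(TQ x R) x R with coordinates ((((q, q'), z), ((Pq, Pq'), Pz)), w) *)
abbreviation left_bundle ::
  "('a, 'e::euclidean_space) chart set \<Rightarrow> (('a, 'e) tulczyjew, 'e tulczyjew_model) chart set" where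
  "left_bundle A \<equiv> ext_cotangent_bundle (ext_tangent_bundle A)"

abbreviation left_chart ::
  "('a, 'e::euclidean_space) chart set \<Rightarrow> ('a, 'e) chart \<Rightarrow>
     (('a, 'e) tulczyjew, 'e tulczyjew_model) chart" where
  "left_chart A c \<equiv> ext_cotangent_chart (ext_tangent_bundle A) (ext_tangent_chart A c)"

(* T*(T*Q x R) x R with coordinates ((((q, p), z), ((Pq, Pp), Pz)), w) *)
abbreviation right_bundle ::
  "('a, 'e::euclidean_space) chart set \<Rightarrow> (('a, 'e) tulczyjew, 'e tulczyjew_model) chart set" where
  "right_bundle A \<equiv> ext_cotangent_bundle (ext_cotangent_bundle A)"

abbreviation right_chart ::
  "('a, 'e::euclidean_space) chart set \<Rightarrow> ('a, 'e) chart \<Rightarrow>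
     (('a, 'e) tulczyjew, 'e tulczyjew_model) chart" where
  "right_chart A c \<equiv> ext_cotangent_chart (ext_cotangent_bundle A) (ext_cotangent_chart A c)"

(* dz' + u dz - (p' + u p) dq - p dq' *)
definition tulczyjew_contact_form ::
  "('a, 'e::euclidean_space) chart set \<Rightarrow> ('a, 'e) tulczyjew \<Rightarrow>
     (('a, 'e) tulczyjew, 'e tulczyjew_model) chart \<Rightarrow> 'e tulczyjew_model" where
  "tulczyjew_contact_form A x =
     (\<lambda>k\<in>charts_at (tulczyjew_bundle A) x.
        case coords k x of ((((q, p), z), ((q', p'), z')), u) \<Rightarrow>
          ((((- (p' + u *\<^sub>R p), 0), u), ((- p, 0), 1)), 0))"

definition alpha_coords :: "'e::euclidean_space tulczyjew_model \<Rightarrow> 'e tulczyjew_model" where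
  "alpha_coords = (\<lambda>((((q, p), z), ((q', p'), z')), u).
     ((((q, q'), z), ((u *\<^sub>R p + p', p), - u)), z'))"

definition beta_coords :: "'e::euclidean_space tulczyjew_model \<Rightarrow> 'e tulczyjew_model" where
  "beta_coords = (\<lambda>((((q, p), z), ((q', p'), z')), u).
     ((((q, p), z), ((u *\<^sub>R p + p', - q'), - u)), z' - p \<bullet> q'))"

(* The global maps: the unique point with the prescribed coordinates in all induced charts. *)
definition alpha_c ::
  "('a, 'e::euclidean_space) chart set \<Rightarrow> ('a, 'e) tulczyjew \<Rightarrow> ('a, 'e) tulczyjew" where
  "alpha_c A x = (THE y. \<forall>c\<in>A. x \<in> chart_dom (tulczyjew_chart A c) \<longrightarrow>
     y \<in> chart_dom (left_chart A c) \<and>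
     coords (left_chart A c) y = alpha_coords (coords (tulczyjew_chart A c) x))"

definition beta_c ::
  "('a, 'e::euclidean_space) chart set \<Rightarrow> ('a, 'e) tulczyjew \<Rightarrow> ('a, 'e) tulczyjew" where
  "beta_c A x = (THE y. \<forall>c\<in>A. x \<in> chart_dom (tulczyjew_chart A c) \<longrightarrow>
     y \<in> chart_dom (right_chart A c) \<and>
     coords (right_chart A c) y = beta_coords (coords (tulczyjew_chart A c) x))"

definition N_L ::
  "('a, 'e::euclidean_space) chart set \<Rightarrow> (('a, 'e) based \<times> real \<Rightarrow> real) \<Rightarrow>
     ('a, 'e) tulczyjew set" where
  "N_L A L = {x \<in> points (tulczyjew_bundle A). alpha_c A x \<in> jet_image (ext_tangent_bundle A) L}"


section \<open>Energies and Morse families\<close>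

(* The Whitney sum of TQ and T*Q over Q, times R, with coordinates (q, q', p, z) *)
type_synonym ('a, 'e) whitney = "('a, 'e) based \<times> ('a, 'e) based \<times> real"

definition whitney_chart ::
  "('a, 'e::euclidean_space) chart set \<Rightarrow> ('a, 'e) chart \<Rightarrow>
     (('a, 'e) whitney, 'e \<times> 'e \<times> 'e \<times> real) chart" where
  "whitney_chart A c =
     ({((x, v), (y, \<xi>), z). y = x \<and> x \<in> chart_dom c \<and> v \<in> tangent_space A x \<and> \<xi> \<in> cotangent_space A x},
      \<lambda>((x, v), (y, \<xi>), z). (coords c x, v c, \<xi> c, z))"

definition whitney_sum ::
  "('a, 'e::euclidean_space) chart set \<Rightarrow> (('a, 'e) whitney, 'e \<times> 'e \<times> 'e \<times> real) chart set" where
  "whitney_sum A = whitney_chart A ` A"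

definition energy ::
  "('a, 'e::euclidean_space) chart set \<Rightarrow> (('a, 'e) based \<times> real \<Rightarrow> real) \<Rightarrow>
     ('a, 'e) whitney \<Rightarrow> real" where
  "energy A L = (\<lambda>((x, v), (y, \<xi>), z). pairing A x \<xi> v - L ((x, v), z))"

(* F on the Whitney sum, regarded as a family of functions with fibre coordinate q' over T*Q x R:
   zero is a regular value of the fibre derivative. *)
definition morse_family ::
  "('a, 'e::euclidean_space) chart set \<Rightarrow> (('a, 'e) whitney \<Rightarrow> real) \<Rightarrow> bool" where
  "morse_family A F \<longleftrightarrow>
     smooth_function (whitney_sum A) F \<and>
     (\<forall>k\<in>whitney_sum A. let f = F \<circ> chart_inv k;
          fibre_deriv = (\<lambda>(q, q', p, z). grad (\<lambda>v. f (q, v, p, z)) q') in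
        \<forall>y\<in>chart_img k. fibre_deriv y = 0 \<longrightarrow> surj (frechet_derivative fibre_deriv (at y)))"

(* The subset of T*(T*Q x R) x R generated by F, with coordinates
   (q, p, z, dF/dq, dF/dp, dF/dz, F) where dF/dq' = 0. *)
definition generated_by ::
  "('a, 'e::euclidean_space) chart set \<Rightarrow> (('a, 'e) whitney \<Rightarrow> real) \<Rightarrow> ('a, 'e) tulczyjew set" where
  "generated_by A F = {x. \<exists>c\<in>A. \<exists>q q' p z. let f = F \<circ> chart_inv (whitney_chart A c) in
     (q, q', p, z) \<in> chart_img (whitney_chart A c) \<and>
     grad (\<lambda>v. f (q, v, p, z)) q' = 0 \<and>
     x \<in> chart_dom (right_chart A c) \<and>
     coords (right_chart A c) x =
       ((((q, p), z),
         ((grad (\<lambda>a. f (a, q', p, z)) q, grad (\<lambda>a. f (q, q', a, z)) p),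
          grad (\<lambda>a. f (q, q', p, a)) z)),
        f (q, q', p, z))}"

definition N_minus_E ::
  "('a, 'e::euclidean_space) chart set \<Rightarrow> (('a, 'e) based \<times> real \<Rightarrow> real) \<Rightarrow>
     ('a, 'e) tulczyjew set" where
  "N_minus_E A L = generated_by A (\<lambda>b. - energy A L b)"

end

(* Over each chart of Q the set N_L is the graph of a smooth map over the velocity coordinates
   (q, q', z), because alpha^c turns the image of (dL, L) into a condition on a single chart.
   Subtracting this map gives a slice chart, and a curve inside N_L satisfies z' = L(q, q', z), so
   the contact form restricts to dL - dL = 0.  That alpha^c, beta^c and the contact form do not depend
   on the chart comes down to the symmetry of the second derivative of the coordinate changes of Q,
   since both the fibre coordinates p' and the momenta conjugate to q transform with D^2.
   The condition dE/dq' = 0 reads p = dL/dq', so N_{-E} is the image of N_L under beta^c; this also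
   shows that N_{-E}, which is defined by the existence of some chart, looks the same in every chart. *)
theory Submission
  imports Defs
begin

section \<open>Calculus of smooth maps\<close>

text \<open>Momenta transform by the inverse transpose of the Jacobian, and the bundles of the
  triple need derivatives of that law. No matrix inverse is differentiated: the law is kept in the
  implicit form \<open>p \<bullet> w = P \<bullet> FD \<phi> q w\<close> and differentiated as an
  identity between functions on an overlap; equalities of covectors are then tested against
  arbitrary vectors. The Legendrian property is not transported along \<open>alpha_c\<close> or
  \<open>beta_c\<close>. One criterion for graphs over a linear projection of the charts,
  \<open>legendrian_graph\<close>, is applied twice: to N_L with the form on T(T*Q x R) x R, and to
  N_{-E} with the canonical form. If Q has dimension n, the parameters (q, q', z) number 2n + 1 and
  the model has dimension 4n + 3 = 2(2n + 1) + 1. A contact manifold is in particular Hausdorff and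
  second countable, so these properties have to climb through iterated bundles too. Second
  countability does so in the form of a countable subatlas, which lifts to any total space. Tangent
  vectors of a submanifold are defined through arbitrary slice charts, not the ones constructed
  here, which is why curves are needed at all.\<close>

abbreviation FD :: "('a::real_normed_vector \<Rightarrow> 'b::real_normed_vector) \<Rightarrow> 'a \<Rightarrow> 'a \<Rightarrow> 'b" where
  "FD f x \<equiv> frechet_derivative f (at x)"

lemma FD_works: "f differentiable at x \<Longrightarrow> (f has_derivative FD f x) (at x)"
  by (simp add: frechet_derivative_works)

lemma FD_eq: "(f has_derivative f') (at x) \<Longrightarrow> FD f x = f'"
  by (metis frechet_derivative_at)

lemma FD_linear: "f differentiable at x \<Longrightarrow> linear (FD f x)"
  by (rule linear_frechet_derivative)

lemma differentiable_cong_open: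
  assumes "open S" "x \<in> S" "\<And>y. y \<in> S \<Longrightarrow> f y = g y" "f differentiable at x"
  shows "g differentiable at x"
  using assms by (meson differentiable_def has_derivative_transform_within_open)

lemma FD_cong_open:
  assumes "open S" "x \<in> S" "\<And>y. y \<in> S \<Longrightarrow> f y = g y" "f differentiable at x"
  shows "FD f x = FD g x"
  using assms frechet_derivative_transform_within_open by blast

text \<open>Openness of \<open>S\<close> is essential: the derivative at a point sees a
  neighbourhood, so agreement on \<open>S\<close> passes to the derivatives only if \<open>S\<close>
  contains one.\<close>

lemma Ck_on_cong:
  assumes "open S" "\<And>y. y \<in> S \<Longrightarrow> f y = g y" "Ck_on k S f"
  shows "Ck_on k S g"
  using assms(2,3)
proof (induction k arbitrary: f g)
  case 0
  then show ?case by (simp cong: continuous_on_cong)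
next
  case (Suc k)
  have "g differentiable at x" if "x \<in> S" for x
    using Suc.prems differentiable_cong_open[OF assms(1) that, of f g] that by auto
  moreover have "Ck_on k S (\<lambda>x. FD g x v)" for v
  proof (rule Suc.IH[of "\<lambda>x. FD f x v"])
    show "FD f y v = FD g y v" if "y \<in> S" for y
      using FD_cong_open[OF assms(1) that, of f g] Suc.prems that by auto
    show "Ck_on k S (\<lambda>x. FD f x v)" using Suc.prems by auto
  qed
  ultimately show ?case by auto
qed

lemma Ck_on_subset: "Ck_on k S f \<Longrightarrow> T \<subseteq> S \<Longrightarrow> Ck_on k T f"
  by (induction k arbitrary: f) (auto intro: continuous_on_subset)

lemma Ck_on_continuous: "Ck_on k S f \<Longrightarrow> continuous_on S f"
  by (cases k) (auto intro!: continuous_at_imp_continuous_on differentiable_imp_continuous_within)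

lemma Ck_on_SucD: "Ck_on (Suc k) S f \<Longrightarrow> Ck_on k S f"
proof (induction k arbitrary: f)
  case 0
  then show ?case using Ck_on_continuous[OF 0] by simp
next
  case (Suc k)
  then show ?case by auto
qed

lemma Ck_on_const: "Ck_on k S (\<lambda>x. c)"
  by (induction k arbitrary: c) auto

lemma Ck_on_bounded_linear:
  assumes "bounded_linear h"
  shows "Ck_on k S h"
proof (cases k)
  case 0
  then show ?thesis using assms by (simp add: linear_continuous_on)
next
  case (Suc k')
  have "FD h x = h" for x
    using FD_eq assms bounded_linear_imp_has_derivative by blast
  then show ?thesis using Suc assms Ck_on_const
    by (auto intro: bounded_linear_imp_differentiable)
qed

text \<open>Pattern of the closure lemmas below: the differentiation rule gives the derivative on
  \<open>S\<close> as an expression of the same kind, the induction hypothesis makes that expression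
  C^k, and \<open>Ck_on_cong\<close> carries this over to \<open>frechet_derivative\<close>.\<close>

lemma Ck_on_compose_bounded_linear:
  assumes "bounded_linear h" "open S" "Ck_on k S f"
  shows "Ck_on k S (\<lambda>x. h (f x))"
  using assms(3)
proof (induction k arbitrary: f)
  case 0
  then show ?case using assms bounded_linear.continuous_on by auto
next
  case (Suc k)
  have hd: "((\<lambda>x. h (f x)) has_derivative (\<lambda>v. h (FD f x v))) (at x)" if "x \<in> S" for x
    using Suc.prems that assms(1) bounded_linear.has_derivative FD_works by force
  have "Ck_on k S (\<lambda>x. FD (\<lambda>x. h (f x)) x v)" for v
    by (rule Ck_on_cong[OF assms(2) _ Suc.IH[of "\<lambda>x. FD f x v"]])
       (use Suc.prems FD_eq[OF hd] in auto)
  then show ?case using differentiableI[OF hd] by auto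
qed

lemma Ck_on_add:
  assumes "open S" "Ck_on k S f" "Ck_on k S g"
  shows "Ck_on k S (\<lambda>x. f x + g x)"
  using assms(2,3)
proof (induction k arbitrary: f g)
  case 0
  then show ?case by (auto intro: continuous_intros)
next
  case (Suc k)
  have hd: "((\<lambda>x. f x + g x) has_derivative (\<lambda>v. FD f x v + FD g x v)) (at x)" if "x \<in> S" for x
    using Suc.prems that by (auto intro!: has_derivative_add FD_works)
  have "Ck_on k S (\<lambda>x. FD (\<lambda>x. f x + g x) x v)" for v
    by (rule Ck_on_cong[OF assms(1) _ Suc.IH[of "\<lambda>x. FD f x v" "\<lambda>x. FD g x v"]])
       (use Suc.prems FD_eq[OF hd] in auto)
  then show ?case using differentiableI[OF hd] by auto
qed

lemma Ck_on_sum: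
  assumes "open S" "\<And>i. i \<in> I \<Longrightarrow> Ck_on k S (f i)"
  shows "Ck_on k S (\<lambda>x. \<Sum>i\<in>I. f i x)"
  using assms(2)
  by (induction I rule: infinite_finite_induct) (auto intro: Ck_on_add[OF assms(1)] Ck_on_const)

text \<open>In each of the two terms of the product rule one factor stays undifferentiated, so it
  has to be demoted from C^(k+1) to C^k before the induction hypothesis applies.\<close>

lemma Ck_on_bounded_bilinear:
  assumes "bounded_bilinear h" "open S" "Ck_on k S f" "Ck_on k S g"
  shows "Ck_on k S (\<lambda>x. h (f x) (g x))"
  using assms(3,4)
proof (induction k arbitrary: f g)
  case 0
  then show ?case using bounded_bilinear.continuous_on[OF assms(1)] by auto
next
  case (Suc k)
  have hd: "((\<lambda>x. h (f x) (g x)) has_derivative (\<lambda>v. h (f x) (FD g x v) + h (FD f x v) (g x))) (at x)"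
    if "x \<in> S" for x
    using Suc.prems that by (auto intro!: bounded_bilinear.FDERIV[OF assms(1)] FD_works)
  have "Ck_on k S (\<lambda>x. FD (\<lambda>x. h (f x) (g x)) x v)" for v
    by (rule Ck_on_cong[OF assms(2) _ Ck_on_add[OF assms(2) Suc.IH[of f "\<lambda>x. FD g x v"]
            Suc.IH[of "\<lambda>x. FD f x v" g]]])
       (use Suc.prems FD_eq[OF hd] in \<open>auto intro: Ck_on_SucD\<close>)
  then show ?case using differentiableI[OF hd] by auto
qed

text \<open>In the chain rule the vector fed to \<open>FD g (f x)\<close> moves with
  \<open>x\<close>, so the derivative is not itself a composition. Expanding that vector in the
  basis gives scalar coefficients times the maps \<open>x \<mapsto> FD g (f x) b\<close> with
  \<open>b\<close> fixed, and these are compositions covered by the induction hypothesis.\<close>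

lemma Ck_on_compose:
  fixes f :: "'a::euclidean_space \<Rightarrow> 'b::euclidean_space" and g :: "'b \<Rightarrow> 'c::real_normed_vector"
  assumes "open S" "open T" "f ` S \<subseteq> T" "Ck_on k S f" "Ck_on k T g"
  shows "Ck_on k S (\<lambda>x. g (f x))"
  using assms(4,5)
proof (induction k arbitrary: g)
  case 0
  then show ?case using assms(3) by (auto intro: continuous_on_compose2)
next
  case (Suc k)
  have lin: "linear (FD g (f x))" if "x \<in> S" for x
    using Suc.prems that assms(3) by (intro FD_linear) auto
  have hd: "((\<lambda>x. g (f x)) has_derivative (\<lambda>v. FD g (f x) (FD f x v))) (at x)" if "x \<in> S" for x
    by (rule has_derivative_compose[of f "FD f x"])
       (use Suc.prems that assms(3) in \<open>auto intro!: FD_works\<close>)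
  have e: "(\<Sum>b\<in>Basis. (FD f x v \<bullet> b) *\<^sub>R FD g (f x) b) = FD (\<lambda>x. g (f x)) x v" if "x \<in> S" for x v
  proof -
    have "FD g (f x) (FD f x v) = FD g (f x) (\<Sum>b\<in>Basis. (FD f x v \<bullet> b) *\<^sub>R b)"
      by (simp add: euclidean_representation)
    also have "\<dots> = (\<Sum>b\<in>Basis. (FD f x v \<bullet> b) *\<^sub>R FD g (f x) b)"
      using lin[OF that] by (simp add: linear_sum linear_cmul)
    finally show ?thesis using FD_eq[OF hd[OF that]] by simp
  qed
  have "Ck_on k S (\<lambda>x. FD (\<lambda>x. g (f x)) x v)" for v
  proof (rule Ck_on_cong[OF assms(1) e])
    show "Ck_on k S (\<lambda>x. \<Sum>b\<in>Basis. (FD f x v \<bullet> b) *\<^sub>R FD g (f x) b)"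
      using Suc.prems
      by (intro Ck_on_sum[OF assms(1)] Ck_on_bounded_bilinear[OF bounded_bilinear_scaleR assms(1)]
          Ck_on_compose_bounded_linear[OF bounded_linear_inner_left assms(1)] Suc.IH)
         (auto intro: Ck_on_SucD)
  qed
  then show ?case using differentiableI[OF hd] by auto
qed

lemma smooth_on_cong: "open S \<Longrightarrow> (\<And>y. y \<in> S \<Longrightarrow> f y = g y) \<Longrightarrow> smooth_on S f \<Longrightarrow> smooth_on S g"
  unfolding smooth_on_def using Ck_on_cong by blast

lemma smooth_on_subset: "smooth_on S f \<Longrightarrow> T \<subseteq> S \<Longrightarrow> smooth_on T f"
  unfolding smooth_on_def using Ck_on_subset by blast

lemma smooth_on_continuous: "smooth_on S f \<Longrightarrow> continuous_on S f"
  unfolding smooth_on_def using Ck_on_continuous by blast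

lemma smooth_on_differentiable: "smooth_on S f \<Longrightarrow> x \<in> S \<Longrightarrow> f differentiable at x"
  unfolding smooth_on_def by (metis Ck_on.simps(2))

lemma smooth_on_has_derivative: "smooth_on S f \<Longrightarrow> x \<in> S \<Longrightarrow> (f has_derivative FD f x) (at x)"
  using FD_works smooth_on_differentiable by blast

lemma smooth_on_FD: "smooth_on S f \<Longrightarrow> smooth_on S (\<lambda>x. FD f x v)"
  unfolding smooth_on_def by (metis Ck_on.simps(2))

lemma smooth_on_const: "smooth_on S (\<lambda>x. c)"
  unfolding smooth_on_def using Ck_on_const by blast

lemma smooth_on_bounded_linear: "bounded_linear h \<Longrightarrow> smooth_on S h"
  unfolding smooth_on_def using Ck_on_bounded_linear by blast

lemma smooth_on_linear:
  fixes h :: "'a::euclidean_space \<Rightarrow> 'b::real_normed_vector"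
  shows "linear h \<Longrightarrow> smooth_on S h"
  by (simp add: linear_conv_bounded_linear smooth_on_bounded_linear)

lemma smooth_on_ident: "smooth_on S (\<lambda>x. x)"
  by (simp add: smooth_on_bounded_linear bounded_linear_ident)

lemma smooth_on_compose_linear:
  fixes h :: "'b::euclidean_space \<Rightarrow> 'c::real_normed_vector"
  shows "linear h \<Longrightarrow> open S \<Longrightarrow> smooth_on S f \<Longrightarrow> smooth_on S (\<lambda>x. h (f x))"
  by (simp add: smooth_on_def Ck_on_compose_bounded_linear linear_conv_bounded_linear)

lemma smooth_on_add:
  "open S \<Longrightarrow> smooth_on S f \<Longrightarrow> smooth_on S g \<Longrightarrow> smooth_on S (\<lambda>x. f x + g x)"
  unfolding smooth_on_def by (simp add: Ck_on_add)

lemma smooth_on_sum: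
  "open S \<Longrightarrow> (\<And>i. i \<in> I \<Longrightarrow> smooth_on S (f i)) \<Longrightarrow> smooth_on S (\<lambda>x. \<Sum>i\<in>I. f i x)"
  unfolding smooth_on_def by (simp add: Ck_on_sum)

lemma smooth_on_scaleR:
  "open S \<Longrightarrow> smooth_on S f \<Longrightarrow> smooth_on S g \<Longrightarrow> smooth_on S (\<lambda>x. f x *\<^sub>R g x)"
  unfolding smooth_on_def by (simp add: Ck_on_bounded_bilinear[OF bounded_bilinear_scaleR])

lemma smooth_on_inner:
  fixes f g :: "'a::euclidean_space \<Rightarrow> 'b::real_inner"
  shows "open S \<Longrightarrow> smooth_on S f \<Longrightarrow> smooth_on S g \<Longrightarrow> smooth_on S (\<lambda>x. f x \<bullet> g x)"
  unfolding smooth_on_def by (simp add: Ck_on_bounded_bilinear[OF bounded_bilinear_inner])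

lemma smooth_on_minus: "open S \<Longrightarrow> smooth_on S f \<Longrightarrow> smooth_on S (\<lambda>x. - f x)"
  unfolding smooth_on_def
  using Ck_on_compose_bounded_linear[OF bounded_linear_minus[OF bounded_linear_ident]] by auto

lemma smooth_on_diff:
  "open S \<Longrightarrow> smooth_on S f \<Longrightarrow> smooth_on S g \<Longrightarrow> smooth_on S (\<lambda>x. f x - g x)"
  using smooth_on_add[of S f "\<lambda>x. - g x"] smooth_on_minus[of S g] by simp

lemma smooth_on_Pair:
  fixes f :: "'a::euclidean_space \<Rightarrow> 'b::real_normed_vector" and g :: "'a \<Rightarrow> 'c::real_normed_vector"
  shows
  "open S \<Longrightarrow> smooth_on S f \<Longrightarrow> smooth_on S g \<Longrightarrow> smooth_on S (\<lambda>x. (f x, g x))"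
proof -
  assume *: "open S" "smooth_on S f" "smooth_on S g"
  have bl: "bounded_linear (\<lambda>x::'b. (x, 0::'c))" "bounded_linear (\<lambda>x::'c. (0::'b, x))"
    by (auto intro!: bounded_linear_intros)
  have "smooth_on S (\<lambda>x. (f x, 0::'c))" "smooth_on S (\<lambda>x. (0::'b, g x))"
    unfolding smooth_on_def
    by (intro allI Ck_on_compose_bounded_linear[OF bl(1) *(1)] Ck_on_compose_bounded_linear[OF bl(2) *(1)];
        use * in \<open>simp add: smooth_on_def\<close>)+
  from smooth_on_add[OF *(1) this] show ?thesis by simp
qed

lemma smooth_on_compose:
  fixes f :: "'a::euclidean_space \<Rightarrow> 'b::euclidean_space" and g :: "'b \<Rightarrow> 'c::real_normed_vector"
  shows "open S \<Longrightarrow> open T \<Longrightarrow> f ` S \<subseteq> T \<Longrightarrow> smooth_on S f \<Longrightarrow> smooth_on T g \<Longrightarrow> smooth_on S (\<lambda>x. g (f x))"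
  unfolding smooth_on_def using Ck_on_compose[of S T f _ g] by blast

lemma smooth_on_fst:
  fixes f :: "'a::euclidean_space \<Rightarrow> 'b::euclidean_space \<times> 'c::euclidean_space"
  shows "open S \<Longrightarrow> smooth_on S f \<Longrightarrow> smooth_on S (\<lambda>x. fst (f x))"
  using smooth_on_compose_linear[OF linear_fst] .

lemma smooth_on_snd:
  fixes f :: "'a::euclidean_space \<Rightarrow> 'b::euclidean_space \<times> 'c::euclidean_space"
  shows "open S \<Longrightarrow> smooth_on S f \<Longrightarrow> smooth_on S (\<lambda>x. snd (f x))"
  using smooth_on_compose_linear[OF linear_snd] .

lemmas smooth_on_intros = smooth_on_const smooth_on_ident smooth_on_add smooth_on_scaleR
  smooth_on_inner smooth_on_minus smooth_on_diff smooth_on_Pair smooth_on_fst smooth_on_snd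

lemma FD_compose:
  assumes "f differentiable at x" "g differentiable at (f x)"
  shows "FD (\<lambda>x. g (f x)) x v = FD g (f x) (FD f x v)"
  using frechet_derivative_compose[OF assms] by (simp add: o_def fun_eq_iff)

lemma linear_in_basis:
  fixes h :: "'a::euclidean_space \<Rightarrow> 'b::real_vector"
  assumes "linear h"
  shows "h v = (\<Sum>b\<in>Basis. (v \<bullet> b) *\<^sub>R h b)"
proof -
  have "h v = h (\<Sum>b\<in>Basis. (v \<bullet> b) *\<^sub>R b)"
    by (simp add: euclidean_representation)
  then show ?thesis using assms by (simp add: linear_sum linear_cmul)
qed

text \<open>Linearity in the fibre reduces joint smoothness to smoothness for each fixed basis
  vector. This is how bundle transition maps, and the tangent map of a smooth map, are seen to be
  smooth.\<close>

lemma smooth_on_family_apply: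
  fixes M :: "'a::euclidean_space \<Rightarrow> 'b::euclidean_space \<Rightarrow> 'c::real_normed_vector"
    and f :: "'d::euclidean_space \<Rightarrow> 'a"
  assumes "open S" "open T" "f ` S \<subseteq> T" "smooth_on S f" "smooth_on S g"
    and "\<And>w. smooth_on T (\<lambda>q. M q w)" "\<And>q. q \<in> T \<Longrightarrow> linear (M q)"
  shows "smooth_on S (\<lambda>x. M (f x) (g x))"
proof (rule smooth_on_cong[OF assms(1)])
  show "(\<Sum>b\<in>Basis. (g x \<bullet> b) *\<^sub>R M (f x) b) = M (f x) (g x)" if "x \<in> S" for x
    using linear_in_basis[of "M (f x)" "g x"] assms(3,7) that by auto
  show "smooth_on S (\<lambda>x. \<Sum>b\<in>Basis. (g x \<bullet> b) *\<^sub>R M (f x) b)"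
    by (intro smooth_on_sum smooth_on_intros assms(1,5) smooth_on_compose[OF assms(1-4,6)])
qed

lemma smooth_on_euclidean:
  fixes f :: "'a::euclidean_space \<Rightarrow> 'b::euclidean_space"
  assumes "open S" "\<And>b. b \<in> Basis \<Longrightarrow> smooth_on S (\<lambda>x. f x \<bullet> b)"
  shows "smooth_on S f"
proof (rule smooth_on_cong[OF assms(1)])
  show "(\<Sum>b\<in>Basis. (f x \<bullet> b) *\<^sub>R b) = f x" for x by (simp add: euclidean_representation)
  show "smooth_on S (\<lambda>x. \<Sum>b\<in>Basis. (f x \<bullet> b) *\<^sub>R b)"
    by (intro smooth_on_sum smooth_on_intros assms)
qed

text \<open>The components of the adjoint are the functions \<open>w \<bullet> M q b\<close>, which
  are smooth by assumption. This gives the transition maps of covectors without inverting a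
  Jacobian.\<close>

lemma smooth_on_adjoint:
  fixes M :: "'a::euclidean_space \<Rightarrow> 'b::euclidean_space \<Rightarrow> 'c::euclidean_space"
  assumes "open S" "\<And>w. smooth_on S (\<lambda>q. M q w)" "\<And>q. q \<in> S \<Longrightarrow> linear (M q)"
  shows "smooth_on S (\<lambda>q. adjoint (M q) w)"
proof (rule smooth_on_euclidean[OF assms(1)])
  fix b :: 'b
  show "smooth_on S (\<lambda>q. adjoint (M q) w \<bullet> b)"
    by (rule smooth_on_cong[OF assms(1), of "\<lambda>q. w \<bullet> M q b"])
       (use assms in \<open>auto simp: adjoint_clauses(2) intro!: smooth_on_intros\<close>)
qed

text \<open>Both mixed second derivatives are limits of the same second difference quotient, by two
  applications of the mean value theorem.\<close>

lemma second_difference_mvt: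
  fixes f :: "'a::euclidean_space \<Rightarrow> real"
  assumes "0 < t"
    and d1: "\<And>r s. 0 \<le> r \<Longrightarrow> r \<le> t \<Longrightarrow> 0 \<le> s \<Longrightarrow> s \<le> t \<Longrightarrow> f differentiable at (x + r *\<^sub>R v + s *\<^sub>R w)"
    and d2: "\<And>r s. 0 \<le> r \<Longrightarrow> r \<le> t \<Longrightarrow> 0 \<le> s \<Longrightarrow> s \<le> t \<Longrightarrow> (\<lambda>y. FD f y v) differentiable at (x + r *\<^sub>R v + s *\<^sub>R w)"
  obtains r s where "0 \<le> r" "r \<le> t" "0 \<le> s" "s \<le> t"
    "f (x + t *\<^sub>R v + t *\<^sub>R w) - f (x + t *\<^sub>R v) - f (x + t *\<^sub>R w) + f x
      = t * t * FD (\<lambda>y. FD f y v) (x + r *\<^sub>R v + s *\<^sub>R w) w"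
proof -
  \<comment> \<open>The second difference is the increment over \<open>[0, t]\<close> of the first
    difference in direction \<open>w\<close>. The mean value theorem is applied to this increment
    along \<open>v\<close>, and then along \<open>w\<close> to the derivative in direction
    \<open>v\<close>.\<close>
  let ?g = "\<lambda>r. f (x + r *\<^sub>R v + t *\<^sub>R w) - f (x + r *\<^sub>R v)"
  have "(?g has_derivative (\<lambda>h. h *\<^sub>R (FD f (x + r *\<^sub>R v + t *\<^sub>R w) v - FD f (x + r *\<^sub>R v) v))) (at r within {0..t})"
    if "0 \<le> r" "r \<le> t" for r
  proof -
    have a: "f differentiable at (x + r *\<^sub>R v + t *\<^sub>R w)" "f differentiable at (x + r *\<^sub>R v)"
      using d1[of r t] d1[of r 0] that \<open>0 < t\<close> by auto
    have l: "FD f (x + r *\<^sub>R v + t *\<^sub>R w) (h *\<^sub>R v) = h *\<^sub>R FD f (x + r *\<^sub>R v + t *\<^sub>R w) v"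
      "FD f (x + r *\<^sub>R v) (h *\<^sub>R v) = h *\<^sub>R FD f (x + r *\<^sub>R v) v" for h
      using FD_linear[OF a(1)] FD_linear[OF a(2)] linear_cmul by blast+
    have i: "((\<lambda>r. x + r *\<^sub>R v + t *\<^sub>R w) has_derivative (\<lambda>h. h *\<^sub>R v)) (at r within {0..t})"
      "((\<lambda>r. x + r *\<^sub>R v) has_derivative (\<lambda>h. h *\<^sub>R v)) (at r within {0..t})"
      by (auto intro!: derivative_eq_intros)
    have "(?g has_derivative (\<lambda>h. FD f (x + r *\<^sub>R v + t *\<^sub>R w) (h *\<^sub>R v) - FD f (x + r *\<^sub>R v) (h *\<^sub>R v))) (at r within {0..t})"
      by (intro has_derivative_diff has_derivative_compose[OF i(1)] has_derivative_compose[OF i(2)] FD_works a)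
    then show ?thesis unfolding l by (simp add: right_diff_distrib)
  qed
  from mvt_very_simple[OF _ this] obtain r where r: "0 \<le> r" "r \<le> t"
    "?g t - ?g 0 = t * (FD f (x + r *\<^sub>R v + t *\<^sub>R w) v - FD f (x + r *\<^sub>R v) v)"
    using \<open>0 < t\<close> by auto
  let ?h = "\<lambda>s. FD f (x + r *\<^sub>R v + s *\<^sub>R w) v"
  let ?F = "\<lambda>s. FD (\<lambda>y. FD f y v) (x + r *\<^sub>R v + s *\<^sub>R w)"
  have "(?h has_derivative (\<lambda>h. h *\<^sub>R ?F s w)) (at s within {0..t})" if "0 \<le> s" "s \<le> t" for s
  proof -
    have a: "(\<lambda>y. FD f y v) differentiable at (x + r *\<^sub>R v + s *\<^sub>R w)"
      using d2 r that by auto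
    have "?F s (h *\<^sub>R w) = h *\<^sub>R ?F s w" for h
      using FD_linear[OF a] linear_cmul by blast
    moreover have i: "((\<lambda>s. x + r *\<^sub>R v + s *\<^sub>R w) has_derivative (\<lambda>h. h *\<^sub>R w)) (at s within {0..t})"
      by (auto intro!: derivative_eq_intros)
    ultimately show ?thesis using has_derivative_compose[OF i FD_works[OF a]] by simp
  qed
  from mvt_very_simple[OF _ this] obtain s where s: "0 \<le> s" "s \<le> t"
    "?h t - ?h 0 = t * ?F s w"
    using \<open>0 < t\<close> by auto
  show ?thesis
    by (rule that[OF r(1,2) s(1,2)]) (use r(3) s(3) in \<open>simp add: algebra_simps\<close>)
qed

lemma symmetric_second_derivative_real:
  fixes f :: "'a::euclidean_space \<Rightarrow> real"
  assumes "open S" "Ck_on 2 S f" "x \<in> S"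
  shows "FD (\<lambda>y. FD f y v) x w = FD (\<lambda>y. FD f y w) x v" (is "?A x = ?B x")
proof (rule ccontr)
  have Ck: "Ck_on (Suc (Suc 0)) S f" using assms(2) unfolding numeral_2_eq_2 .
  assume ne: "?A x \<noteq> ?B x"
  \<comment> \<open>Half the supposed gap: if each of two equal values is closer than
    \<open>e\<close> to its end, the ends are closer than \<open>2 * e\<close>.\<close>
  define e where "e = dist (?A x) (?B x) / 2"
  have "e > 0" using ne by (simp add: e_def)
  have cont: "continuous_on S ?A" "continuous_on S ?B" using Ck by auto
  then have "isCont ?A x" "isCont ?B x"
    using assms(1,3) continuous_on_eq_continuous_at by blast+
  then obtain d1 d2 where d12: "0 < d1" "0 < d2" "\<And>y. dist y x < d1 \<Longrightarrow> dist (?A y) (?A x) < e"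
    "\<And>y. dist y x < d2 \<Longrightarrow> dist (?B y) (?B x) < e"
    using \<open>e > 0\<close> unfolding continuous_at_eps_delta by blast
  obtain d3 where d3: "0 < d3" "ball x d3 \<subseteq> S"
    using assms(1,3) openE by blast
  define d where "d = min d1 (min d2 d3)"
  \<comment> \<open>Small enough for the whole parallelogram spanned by \<open>t *\<^sub>R v\<close>
    and \<open>t *\<^sub>R w\<close> to stay within distance \<open>d\<close> of \<open>x\<close>;
    the summand 1 keeps the denominator positive when both vectors vanish.\<close>
  define t where "t = d / (2 * (norm v + norm w + 1))"
  have nn: "norm v + norm w + 1 > 0"
    by (simp add: add_nonneg_pos)
  have d: "d > 0" "d \<le> d1" "d \<le> d2" "d \<le> d3" using d12 d3 by (auto simp: d_def)
  then have t: "t > 0" using nn by (simp add: t_def)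
  have near: "dist (x + r *\<^sub>R v + s *\<^sub>R w) x < d" if "0 \<le> r" "r \<le> t" "0 \<le> s" "s \<le> t" for r s
  proof -
    have "dist (x + r *\<^sub>R v + s *\<^sub>R w) x \<le> r * norm v + s * norm w"
      using norm_triangle_ineq[of "r *\<^sub>R v" "s *\<^sub>R w"] that by (simp add: dist_norm)
    also have "\<dots> \<le> t * norm v + t * norm w"
      using that by (intro add_mono mult_right_mono) auto
    also have "\<dots> \<le> t * (norm v + norm w + 1)" using t by (simp add: algebra_simps)
    also have "\<dots> = d / 2" using nn unfolding t_def by (simp add: divide_simps)
    finally show ?thesis using d by simp
  qed
  have inS: "x + r *\<^sub>R v + s *\<^sub>R w \<in> S" if "0 \<le> r" "r \<le> t" "0 \<le> s" "s \<le> t" for r s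
    using near[OF that] d d3 by (auto simp: dist_commute)
  have inS': "x + r *\<^sub>R w + s *\<^sub>R v \<in> S" if "0 \<le> r" "r \<le> t" "0 \<le> s" "s \<le> t" for r s
    using inS[of s r] that by (simp add: algebra_simps)
  have diff: "f differentiable at y" "(\<lambda>y. FD f y u) differentiable at y" if "y \<in> S" for y u
    using Ck that by auto
  obtain r s where 1: "0 \<le> r" "r \<le> t" "0 \<le> s" "s \<le> t"
    "f (x + t *\<^sub>R v + t *\<^sub>R w) - f (x + t *\<^sub>R v) - f (x + t *\<^sub>R w) + f x = t * t * ?A (x + r *\<^sub>R v + s *\<^sub>R w)"
    by (rule second_difference_mvt[OF t, of f x v w]) (use diff inS in auto)
  obtain r' s' where 2: "0 \<le> r'" "r' \<le> t" "0 \<le> s'" "s' \<le> t"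
    "f (x + t *\<^sub>R w + t *\<^sub>R v) - f (x + t *\<^sub>R w) - f (x + t *\<^sub>R v) + f x = t * t * ?B (x + r' *\<^sub>R w + s' *\<^sub>R v)"
    by (rule second_difference_mvt[OF t, of f x w v]) (use diff inS' in auto)
  \<comment> \<open>The second difference is symmetric in \<open>v\<close> and \<open>w\<close>, so
    the two mean value expressions coincide although their intermediate points differ.\<close>
  have "t * t * ?A (x + r *\<^sub>R v + s *\<^sub>R w) = t * t * ?B (x + r' *\<^sub>R w + s' *\<^sub>R v)"
    using 1(5) 2(5) by (simp add: algebra_simps)
  then have "?A (x + r *\<^sub>R v + s *\<^sub>R w) = ?B (x + s' *\<^sub>R v + r' *\<^sub>R w)"
    using t by (simp add: algebra_simps)
  moreover have "dist (?A (x + r *\<^sub>R v + s *\<^sub>R w)) (?A x) < e"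
    using d12(3) near[OF 1(1-4)] d by auto
  moreover have "dist (?B (x + s' *\<^sub>R v + r' *\<^sub>R w)) (?B x) < e"
    using d12(4) near[OF 2(3,4) 2(1,2)] d by auto
  ultimately have "dist (?A x) (?B x) < 2 * e"
    using dist_triangle_half_r[of "?A (x + r *\<^sub>R v + s *\<^sub>R w)" "?A x" "2 * e" "?B x"] by simp
  then show False by (simp add: e_def)
qed

text \<open>Reduction to real-valued functions: pairing with a fixed basis vector commutes with both
  differentiations.\<close>

lemma symmetric_second_derivative:
  fixes f :: "'a::euclidean_space \<Rightarrow> 'b::euclidean_space"
  assumes "open S" "smooth_on S f" "x \<in> S"
  shows "FD (\<lambda>y. FD f y v) x w = FD (\<lambda>y. FD f y w) x v"
proof (rule euclidean_eqI)
  fix b :: 'b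
  have D: "FD (\<lambda>y. g y \<bullet> b) y u = FD g y u \<bullet> b" if "smooth_on S g" "y \<in> S" for g :: "'a \<Rightarrow> 'b" and y u
    using FD_eq[OF has_derivative_inner_left[OF smooth_on_has_derivative[OF that], of b]] by simp
  have E: "FD (\<lambda>y. FD (\<lambda>y. f y \<bullet> b) y u) x u' = FD (\<lambda>y. FD f y u) x u' \<bullet> b" for u u'
  proof -
    have "FD (\<lambda>y. FD f y u \<bullet> b) x = FD (\<lambda>y. FD (\<lambda>y. f y \<bullet> b) y u) x"
      by (rule FD_cong_open[OF assms(1,3)])
         (use D[OF assms(2)] assms in \<open>auto intro!: smooth_on_differentiable[of S] smooth_on_intros smooth_on_FD\<close>)
    then have "FD (\<lambda>y. FD (\<lambda>y. f y \<bullet> b) y u) x u' = FD (\<lambda>y. FD f y u \<bullet> b) x u'" by simp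
    also have "\<dots> = FD (\<lambda>y. FD f y u) x u' \<bullet> b"
      by (rule D[OF smooth_on_FD[OF assms(2)] assms(3)])
    finally show ?thesis .
  qed
  have "Ck_on 2 S (\<lambda>y. f y \<bullet> b)"
    using smooth_on_inner[OF assms(1,2) smooth_on_const, of b] by (simp add: smooth_on_def)
  from symmetric_second_derivative_real[OF assms(1) this assms(3), of v w]
  show "FD (\<lambda>y. FD f y v) x w \<bullet> b = FD (\<lambda>y. FD f y w) x v \<bullet> b"
    by (simp add: E)
qed

section \<open>Gradients and partial derivatives\<close>

lemma inner_grad:
  assumes "f differentiable at x"
  shows "grad f x \<bullet> v = FD f x v"
proof -
  have "FD f x v = (\<Sum>b\<in>Basis. (v \<bullet> b) *\<^sub>R FD f x b)"
    by (rule linear_in_basis[OF FD_linear[OF assms]])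
  then show ?thesis by (simp add: grad_def inner_sum_left inner_sum_right inner_commute mult.commute)
qed

lemma inner_eqI: "(\<And>w. x \<bullet> w = y \<bullet> w) \<Longrightarrow> x = (y::'a::real_inner)"
  using vector_eq_rdot by blast

lemma grad_eqI:
  assumes "(f has_derivative (\<lambda>v. g \<bullet> v)) (at x)"
  shows "grad f x = g"
proof (rule inner_eqI)
  fix w show "grad f x \<bullet> w = g \<bullet> w"
    using inner_grad[OF differentiableI[OF assms], of w] FD_eq[OF assms] by simp
qed

lemma smooth_on_grad: "open S \<Longrightarrow> smooth_on S f \<Longrightarrow> smooth_on S (grad f)"
  unfolding grad_def by (intro smooth_on_sum smooth_on_intros smooth_on_FD)

lemma has_derivative_partials:
  assumes "f differentiable at (x, y)"
  shows "((\<lambda>a. f (a, y)) has_derivative (\<lambda>v. FD f (x, y) (v, 0))) (at x)"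
    "((\<lambda>b. f (x, b)) has_derivative (\<lambda>v. FD f (x, y) (0, v))) (at y)"
proof -
  have i: "((\<lambda>a. (a, y)) has_derivative (\<lambda>v. (v, 0))) (at x)"
    "((\<lambda>b. (x, b)) has_derivative (\<lambda>v. (0, v))) (at y)"
    by (auto intro!: derivative_eq_intros)
  show "((\<lambda>a. f (a, y)) has_derivative (\<lambda>v. FD f (x, y) (v, 0))) (at x)"
    "((\<lambda>b. f (x, b)) has_derivative (\<lambda>v. FD f (x, y) (0, v))) (at y)"
    using has_derivative_compose[OF i(1) FD_works[OF assms]] has_derivative_compose[OF i(2) FD_works[OF assms]] .
qed

lemma differentiable_partials:
  assumes "f differentiable at (x, y)"
  shows "(\<lambda>a. f (a, y)) differentiable at x" "(\<lambda>b. f (x, b)) differentiable at y"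
  using differentiableI[OF has_derivative_partials(1)[OF assms]]
    differentiableI[OF has_derivative_partials(2)[OF assms]] .

lemma grad_Pair:
  fixes f :: "'a::euclidean_space \<times> 'b::euclidean_space \<Rightarrow> real"
  assumes "f differentiable at (x, y)"
  shows "grad f (x, y) = (grad (\<lambda>a. f (a, y)) x, grad (\<lambda>b. f (x, b)) y)"
proof -
  have *: "((\<lambda>a. f (a, y)) has_derivative (\<lambda>v. fst (grad f (x, y)) \<bullet> v)) (at x)"
    "((\<lambda>b. f (x, b)) has_derivative (\<lambda>v. snd (grad f (x, y)) \<bullet> v)) (at y)"
    using has_derivative_partials[OF assms] by (auto simp: inner_grad[OF assms, symmetric] inner_prod_def)
  show ?thesis using grad_eqI[OF *(1)] grad_eqI[OF *(2)] by (simp add: prod_eq_iff)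
qed


section \<open>Charts and the atlas topology\<close>

abbreviation overlap :: "('a, 'e) chart \<Rightarrow> ('a, 'e) chart \<Rightarrow> 'e set" where
  "overlap c c' \<equiv> coords c ` (chart_dom c \<inter> chart_dom c')"

lemma atlas_inj: "smooth_atlas A \<Longrightarrow> c \<in> A \<Longrightarrow> inj_on (coords c) (chart_dom c)"
  and atlas_open_img: "smooth_atlas A \<Longrightarrow> c \<in> A \<Longrightarrow> open (chart_img c)"
  and atlas_open_overlap: "smooth_atlas A \<Longrightarrow> c \<in> A \<Longrightarrow> c' \<in> A \<Longrightarrow> open (overlap c c')"
  and atlas_smooth_transition:
    "smooth_atlas A \<Longrightarrow> c \<in> A \<Longrightarrow> c' \<in> A \<Longrightarrow> smooth_on (overlap c c') (transition c c')"
  unfolding smooth_atlas_def by blast+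

lemma coords_in_img: "x \<in> chart_dom c \<Longrightarrow> coords c x \<in> chart_img c"
  by (simp add: chart_img_def)

lemma coords_in_overlap: "x \<in> chart_dom c \<Longrightarrow> x \<in> chart_dom c' \<Longrightarrow> coords c x \<in> overlap c c'"
  by blast

lemma overlap_subset_img: "overlap c c' \<subseteq> chart_img c"
  by (auto simp: chart_img_def)

lemma overlap_self: "overlap c c = chart_img c"
  by (auto simp: chart_img_def)

lemma chart_inv_coords:
  "inj_on (coords c) (chart_dom c) \<Longrightarrow> x \<in> chart_dom c \<Longrightarrow> chart_inv c (coords c x) = x"
  by (simp add: chart_inv_def)

lemma chart_inv_in_dom: "y \<in> chart_img c \<Longrightarrow> chart_inv c y \<in> chart_dom c"
  by (simp add: chart_inv_def chart_img_def inv_into_into)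

lemma coords_chart_inv: "y \<in> chart_img c \<Longrightarrow> coords c (chart_inv c y) = y"
  by (simp add: chart_inv_def chart_img_def f_inv_into_f)

lemma chart_inv_eqI:
  "inj_on (coords c) (chart_dom c) \<Longrightarrow> x \<in> chart_dom c \<Longrightarrow> coords c x = y \<Longrightarrow> chart_inv c y = x"
  using chart_inv_coords[of c x] by simp

lemma transition_coords:
  "inj_on (coords c) (chart_dom c) \<Longrightarrow> x \<in> chart_dom c \<Longrightarrow> transition c c' (coords c x) = coords c' x"
  by (simp add: transition_def chart_inv_coords)

lemma charts_at_iff: "c \<in> charts_at A x \<longleftrightarrow> c \<in> A \<and> x \<in> chart_dom c"
  by (simp add: charts_at_def)

lemma points_iff: "x \<in> points A \<longleftrightarrow> (\<exists>c\<in>A. x \<in> chart_dom c)"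
  by (simp add: points_def)

lemma overlap_chart_inv:
  assumes "smooth_atlas A" "c \<in> A" "y \<in> overlap c c'"
  shows "chart_inv c y \<in> chart_dom c" "chart_inv c y \<in> chart_dom c'" "coords c (chart_inv c y) = y"
proof -
  obtain x where "x \<in> chart_dom c" "x \<in> chart_dom c'" "y = coords c x" using assms(3) by blast
  then show "chart_inv c y \<in> chart_dom c" "chart_inv c y \<in> chart_dom c'" "coords c (chart_inv c y) = y"
    using chart_inv_coords[OF atlas_inj[OF assms(1,2)]] by auto
qed

lemma transition_differentiable:
  assumes "smooth_atlas A" "c \<in> A" "c' \<in> A" "x \<in> chart_dom c" "x \<in> chart_dom c'"
  shows "transition c c' differentiable at (coords c x)"
  by (rule smooth_on_differentiable[OF atlas_smooth_transition[OF assms(1-3)] coords_in_overlap[OF assms(4,5)]])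

lemma linear_FD_transition:
  assumes "smooth_atlas A" "c \<in> A" "c' \<in> A" "x \<in> chart_dom c" "x \<in> chart_dom c'"
  shows "linear (FD (transition c c') (coords c x))"
  by (rule FD_linear[OF transition_differentiable[OF assms]])

text \<open>Chain rule for the identity between coordinate changes, which holds on the triple
  overlap; that set is open, so the identity can be differentiated there. It is the cocycle
  condition of the tangent bundle.\<close>

lemma FD_transition_chain:
  assumes A: "smooth_atlas A" "c \<in> A" "c' \<in> A" "c'' \<in> A"
    and x: "x \<in> chart_dom c" "x \<in> chart_dom c'" "x \<in> chart_dom c''"
  shows "FD (transition c' c'') (coords c' x) (FD (transition c c') (coords c x) w)
    = FD (transition c c'') (coords c x) w"
proof -
  note inj = atlas_inj[OF A(1)]
  have tr: "transition c c' (coords c x) = coords c' x"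
    using transition_coords[OF inj[OF A(2)] x(1)] .
  have d: "transition c c' differentiable at (coords c x)"
    "transition c' c'' differentiable at (transition c c' (coords c x))"
    using transition_differentiable[OF A(1)] A x tr by auto
  have "FD (\<lambda>y. transition c' c'' (transition c c' y)) (coords c x) = FD (transition c c'') (coords c x)"
  proof (rule FD_cong_open[of "overlap c c' \<inter> overlap c c''"])
    show "open (overlap c c' \<inter> overlap c c'')"
      using atlas_open_overlap[OF A(1)] A by blast
    show "transition c' c'' (transition c c' y) = transition c c'' y"
      if "y \<in> overlap c c' \<inter> overlap c c''" for y
    proof -
      have "chart_inv c y \<in> chart_dom c" "chart_inv c y \<in> chart_dom c'" "chart_inv c y \<in> chart_dom c''" "coords c (chart_inv c y) = y"
        using overlap_chart_inv[OF A(1,2)] that by blast+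
      then show ?thesis
        using transition_coords[OF inj[OF A(2)], of "chart_inv c y"] transition_coords[OF inj[OF A(3)], of "chart_inv c y"]
        by simp
    qed
    show "(\<lambda>y. transition c' c'' (transition c c' y)) differentiable at (coords c x)"
      using differentiable_chain_at[OF d] by (simp add: o_def)
  qed (use x in auto)
  then show ?thesis using FD_compose[OF d, of w] tr by simp
qed

lemma FD_transition_self:
  assumes "smooth_atlas A" "c \<in> A" "x \<in> chart_dom c"
  shows "FD (transition c c) (coords c x) w = w"
proof -
  have "FD (\<lambda>y. y) (coords c x) = FD (transition c c) (coords c x)"
  proof (rule FD_cong_open[OF atlas_open_img[OF assms(1,2)] coords_in_img[OF assms(3)]])
    show "y = transition c c y" if "y \<in> chart_img c" for y
      using coords_chart_inv[OF that] by (simp add: transition_def)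
  qed simp
  then show ?thesis by (metis frechet_derivative_ident)
qed

text \<open>This is the transformation law that makes the coordinate gradients of a function a
  covector.\<close>

lemma smooth_function_transition:
  fixes f :: "'a \<Rightarrow> real"
  assumes A: "smooth_atlas A" "c \<in> A" "c' \<in> A" and f: "smooth_function A f"
    and x: "x \<in> chart_dom c" "x \<in> chart_dom c'"
  shows "FD (f \<circ> chart_inv c') (coords c' x) (FD (transition c c') (coords c x) w) = FD (f \<circ> chart_inv c) (coords c x) w"
proof -
  note inj = atlas_inj[OF A(1)]
  have tr: "transition c c' (coords c x) = coords c' x"
    using transition_coords[OF inj[OF A(2)] x(1)] .
  have d: "transition c c' differentiable at (coords c x)"
    using transition_differentiable[OF A x] .
  have "(f \<circ> chart_inv c') differentiable at (coords c' x)"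
    using f A(3) smooth_on_differentiable[OF _ coords_in_img[OF x(2)]] unfolding smooth_function_def by metis
  then have e: "(f \<circ> chart_inv c') differentiable at (transition c c' (coords c x))" using tr by simp
  have "FD (\<lambda>y. (f \<circ> chart_inv c') (transition c c' y)) (coords c x) = FD (f \<circ> chart_inv c) (coords c x)"
  proof (rule FD_cong_open[OF atlas_open_overlap[OF A] coords_in_overlap[OF x]])
    show "(f \<circ> chart_inv c') (transition c c' y) = (f \<circ> chart_inv c) y" if "y \<in> overlap c c'" for y
      using that transition_coords[OF inj[OF A(2)], where c' = c'] chart_inv_coords[OF inj[OF A(2)]]
        chart_inv_coords[OF inj[OF A(3)]] by auto
    show "(\<lambda>y. (f \<circ> chart_inv c') (transition c c' y)) differentiable at (coords c x)"
      using differentiable_chain_at[OF d e] by (simp add: o_def)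
  qed
  then show ?thesis using FD_compose[OF d e, of w] tr by (simp add: o_def)
qed

section \<open>The atlas topology: open sets, second countability, total spaces over a
  manifold\<close>

lemma openin_chart_preimage:
  assumes A: "smooth_atlas A" "c \<in> A" and "open V"
  shows "openin (atlas_topology A) (chart_dom c \<inter> coords c -` V)"
  unfolding openin_atlas_topology
proof (intro conjI ballI)
  show "chart_dom c \<inter> coords c -` V \<subseteq> points A" using A(2) by (auto simp: points_iff)
  fix c' assume c': "c' \<in> A"
  \<comment> \<open>Outside the overlap the values of the transition map are arbitrary, hence the
    intersection. The preimage is open because the transition map is continuous on an open
    set.\<close>
  let ?V = "overlap c' c \<inter> transition c' c -` V"
  have "open ?V"
    by (rule continuous_open_preimage[OF smooth_on_continuous[OF atlas_smooth_transition[OF A(1) c' A(2)]]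
          atlas_open_overlap[OF A(1) c' A(2)] \<open>open V\<close>])
  moreover have "chart_dom c \<inter> coords c -` V \<inter> chart_dom c' = coords c' -` ?V \<inter> chart_dom c'"
  proof -
    have "x = x'" if "coords c' x = coords c' x'" "x \<in> chart_dom c'" "x' \<in> chart_dom c'" for x x'
      using inj_onD[OF atlas_inj[OF A(1) c'] that] .
    then show ?thesis
      using transition_coords[OF atlas_inj[OF A(1) c'], where c' = c] by auto blast+
  qed
  ultimately show "\<exists>V'. open V' \<and> chart_dom c \<inter> coords c -` V \<inter> chart_dom c' = coords c' -` V' \<inter> chart_dom c'"
    by blast
qed

lemma openin_chart_dom: "smooth_atlas A \<Longrightarrow> c \<in> A \<Longrightarrow> openin (atlas_topology A) (chart_dom c)"
  using openin_chart_preimage[of A c UNIV] by simp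

lemma topspace_atlas_topology [simp]: "topspace (atlas_topology A) = points A"
proof
  show "topspace (atlas_topology A) \<subseteq> points A"
    using openin_topspace[of "atlas_topology A"] unfolding openin_atlas_topology by (rule conjunct1)
  have "openin (atlas_topology A) (points A)"
    unfolding openin_atlas_topology
  proof (intro conjI ballI)
    fix c assume "c \<in> A"
    then have "points A \<inter> chart_dom c = coords c -` UNIV \<inter> chart_dom c" unfolding points_def by blast
    then show "\<exists>V. open V \<and> points A \<inter> chart_dom c = coords c -` V \<inter> chart_dom c" by blast
  qed simp
  then show "points A \<subseteq> topspace (atlas_topology A)"
    by (rule openin_subset)
qed

text \<open>Each chart domain inherits second countability from the model space, so only the number
  of charts needed for a cover matters. A countable subatlas lifts directly to a bundle, whereas a
  countable basis does not.\<close>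

lemma second_countable_atlas_topology_iff:
  assumes A: "smooth_atlas A"
  shows "second_countable (atlas_topology A) \<longleftrightarrow> (\<exists>C\<subseteq>A. countable C \<and> points C = points A)"
proof
  assume "second_countable (atlas_topology A)"
  then obtain B where B: "countable B"
    "\<And>U x. openin (atlas_topology A) U \<Longrightarrow> x \<in> U \<Longrightarrow> \<exists>V\<in>B. x \<in> V \<and> V \<subseteq> U"
    unfolding second_countable_def by metis
  \<comment> \<open>Only the basic sets small enough to fit into some chart domain are kept. They
    still cover, and choosing one chart for each gives the countable subatlas.\<close>
  define B' where "B' = {V \<in> B. \<exists>c\<in>A. V \<subseteq> chart_dom c}"
  have "\<forall>V\<in>B'. \<exists>c. c \<in> A \<and> V \<subseteq> chart_dom c" unfolding B'_def by blast
  from bchoice[OF this] obtain h where h: "\<And>V. V \<in> B' \<Longrightarrow> h V \<in> A \<and> V \<subseteq> chart_dom (h V)" by blast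
  have "x \<in> points (h ` B')" if x: "x \<in> points A" for x
  proof -
    obtain c where c: "c \<in> A" "x \<in> chart_dom c" using x unfolding points_def by blast
    then obtain V where "V \<in> B" "x \<in> V" "V \<subseteq> chart_dom c" using B(2)[OF openin_chart_dom[OF A]] by blast
    then have "V \<in> B'" using c unfolding B'_def by blast
    then show ?thesis using h \<open>x \<in> V\<close> unfolding points_def by blast
  qed
  moreover have "h ` B' \<subseteq> A" using h by blast
  then have "points (h ` B') \<subseteq> points A" unfolding points_def by blast
  moreover have "countable (h ` B')" using B(1) by (simp add: B'_def)
  ultimately show "\<exists>C\<subseteq>A. countable C \<and> points C = points A" using \<open>h ` B' \<subseteq> A\<close> by blast
next
  assume "\<exists>C\<subseteq>A. countable C \<and> points C = points A"
  then obtain C where C: "C \<subseteq> A" "countable C" "points C = points A" by blast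
  obtain B :: "'b set set" where B: "countable B" "\<And>V. V \<in> B \<Longrightarrow> open V"
    "\<And>S. open S \<Longrightarrow> \<exists>U\<subseteq>B. S = \<Union>U"
    using univ_second_countable by metis
  \<comment> \<open>The basis consists of the pullbacks of a countable basis of the model space
    through the countably many charts.\<close>
  let ?B = "(\<lambda>(c, V). chart_dom c \<inter> coords c -` V) ` (C \<times> B)"
  have 1: "\<exists>W\<in>?B. x \<in> W \<and> W \<subseteq> U" if U: "openin (atlas_topology A) U" "x \<in> U" for U x
  proof -
    have "x \<in> points C" using U openin_subset[OF U(1)] C(3) by auto
    then obtain c where c: "c \<in> C" "x \<in> chart_dom c" unfolding points_def by blast
    then obtain V where V: "open V" "U \<inter> chart_dom c = coords c -` V \<inter> chart_dom c"
      using U(1) C(1) unfolding openin_atlas_topology by blast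
    then have "coords c x \<in> V" using U(2) c(2) by blast
    then obtain V' where "V' \<in> B" "coords c x \<in> V'" "V' \<subseteq> V" using B(3)[OF V(1)] by blast
    then have "x \<in> chart_dom c \<inter> coords c -` V'" "chart_dom c \<inter> coords c -` V' \<subseteq> U"
      using V(2) c(2) by blast+
    moreover have "chart_dom c \<inter> coords c -` V' \<in> ?B"
      using c(1) \<open>V' \<in> B\<close> by (intro image_eqI[of _ _ "(c, V')"]) auto
    ultimately show ?thesis by (intro bexI[of _ "chart_dom c \<inter> coords c -` V'"] conjI)
  qed
  have 2: "openin (atlas_topology A) W" if W: "W \<in> ?B" for W
  proof -
    obtain p where p: "p \<in> C \<times> B" "W = (\<lambda>(c, V). chart_dom c \<inter> coords c -` V) p"
      using W by (elim imageE)
    from p(1) have "fst p \<in> C" "snd p \<in> B" by (simp_all add: mem_Times_iff)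
    from openin_chart_preimage[OF A subsetD[OF C(1) this(1)] B(2)[OF this(2)]] show ?thesis using p(2) by (simp add: case_prod_beta)
  qed
  have 3: "countable ?B" using B(1) C(2) by (intro countable_image countable_SIGMA)
  show "second_countable (atlas_topology A)"
    unfolding second_countable_def
    by (intro exI[of _ ?B] conjI ballI allI impI) (fact 3, erule 2, elim conjE, erule 1)
qed

lemma smooth_manifoldD:
  "smooth_manifold A \<Longrightarrow> smooth_atlas A"
  "smooth_manifold A \<Longrightarrow> Hausdorff_space (atlas_topology A)"
  "smooth_manifold A \<Longrightarrow> second_countable (atlas_topology A)"
  by (simp_all add: smooth_manifold_def)

lemma smooth_atlas_imageI:
  assumes "\<And>c. c \<in> I \<Longrightarrow> inj_on (coords (F c)) (chart_dom (F c))"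
    and "\<And>c. c \<in> I \<Longrightarrow> open (chart_img (F c))"
    and "\<And>c c'. c \<in> I \<Longrightarrow> c' \<in> I \<Longrightarrow> open (overlap (F c) (F c'))"
    and "\<And>c c'. c \<in> I \<Longrightarrow> c' \<in> I \<Longrightarrow> smooth_on (overlap (F c) (F c')) (transition (F c) (F c'))"
  shows "smooth_atlas (F ` I)"
  using assms by (simp add: smooth_atlas_def)

text \<open>Serves tangent bundles, cotangent bundles and products with the line alike. The
  projection is \<open>fst\<close>, the chart \<open>F c\<close> lies over \<open>c\<close>, and it
  contains every point of the total space over the domain of \<open>c\<close>.\<close>

lemma smooth_manifold_total_space:
  fixes F :: "('a, 'e::euclidean_space) chart \<Rightarrow> ('a \<times> 'b, 'e \<times> 'f::euclidean_space) chart"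
  assumes A: "smooth_manifold A" and B: "smooth_atlas (F ` A)"
    and dom: "\<And>c z. c \<in> A \<Longrightarrow> z \<in> chart_dom (F c) \<Longrightarrow> fst z \<in> chart_dom c"
      "\<And>c z. c \<in> A \<Longrightarrow> z \<in> points (F ` A) \<Longrightarrow> fst z \<in> chart_dom c \<Longrightarrow> z \<in> chart_dom (F c)"
    and proj: "\<And>c z. c \<in> A \<Longrightarrow> z \<in> chart_dom (F c) \<Longrightarrow> fst (coords (F c) z) = coords c (fst z)"
  shows "smooth_manifold (F ` A)"
proof -
  note A' = smooth_manifoldD[OF A]
  have img: "fst z \<in> points A" if "z \<in> points (F ` A)" for z
    using that dom(1) unfolding points_def by blast
  \<comment> \<open>Continuity of the projection onto the base.\<close>
  have pre: "openin (atlas_topology (F ` A)) {z \<in> points (F ` A). fst z \<in> W}"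
    if W: "openin (atlas_topology A) W" for W
    unfolding openin_atlas_topology
  proof (intro conjI ballI)
    fix k assume "k \<in> F ` A"
    then obtain c where c: "c \<in> A" "k = F c" by blast
    obtain V where V: "open V" "W \<inter> chart_dom c = coords c -` V \<inter> chart_dom c"
      using W c unfolding openin_atlas_topology by blast
    have e: "fst z \<in> W \<longleftrightarrow> coords k z \<in> V \<times> UNIV" if z: "z \<in> chart_dom k" for z
    proof -
      have z': "z \<in> chart_dom (F c)" using z c(2) by simp
      have "fst z \<in> W \<longleftrightarrow> coords c (fst z) \<in> V" using dom(1)[OF c(1) z'] V(2) by blast
      then show ?thesis using proj[OF c(1) z'] c(2) by (simp add: mem_Times_iff)
    qed
    have p: "z \<in> points (F ` A)" if "z \<in> chart_dom k" for z
      using that c unfolding points_def by blast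
    have "z \<in> {z \<in> points (F ` A). fst z \<in> W} \<inter> chart_dom k \<longleftrightarrow> z \<in> coords k -` (V \<times> UNIV) \<inter> chart_dom k" for z
      unfolding Int_iff mem_Collect_eq vimage_eq using e[of z] p[of z] by argo
    then have "{z \<in> points (F ` A). fst z \<in> W} \<inter> chart_dom k = coords k -` (V \<times> UNIV) \<inter> chart_dom k"
      by (rule set_eqI)
    then show "\<exists>V. open V \<and> {z \<in> points (F ` A). fst z \<in> W} \<inter> chart_dom k = coords k -` V \<inter> chart_dom k"
      by (intro exI[of _ "V \<times> UNIV"] conjI open_Times[OF V(1) open_UNIV])
  qed (rule subsetI, simp)
  have "Hausdorff_space (atlas_topology (F ` A))"
    unfolding Hausdorff_space_def topspace_atlas_topology
  proof (intro allI impI, elim conjE)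
    fix x y assume x: "x \<in> points (F ` A)" and y: "y \<in> points (F ` A)" and "x \<noteq> y"
    show "\<exists>U V. openin (atlas_topology (F ` A)) U \<and> openin (atlas_topology (F ` A)) V \<and> x \<in> U \<and> y \<in> V \<and> disjnt U V"
    \<comment> \<open>Points over different base points are separated by sets pulled back from the
      base. Points of the same fibre share a bundle chart and are separated in its model
      space.\<close>
    proof (cases "fst x = fst y")
      case False
      then obtain U V where "openin (atlas_topology A) U" "openin (atlas_topology A) V" "fst x \<in> U" "fst y \<in> V" "disjnt U V"
        using A'(2)[unfolded Hausdorff_space_def topspace_atlas_topology, rule_format, of "fst x" "fst y"]
          img[OF x] img[OF y] by blast
      then show ?thesis using pre x y
        by (intro exI[of _ "{z \<in> points (F ` A). fst z \<in> U}"] exI[of _ "{z \<in> points (F ` A). fst z \<in> V}"])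
          (auto simp: disjnt_iff)
    next
      case True
      obtain c where c: "c \<in> A" "fst x \<in> chart_dom c" using img[OF x] unfolding points_def by blast
      then have d: "x \<in> chart_dom (F c)" "y \<in> chart_dom (F c)" using dom(2) x y True by auto
      then have "coords (F c) x \<noteq> coords (F c) y"
        using \<open>x \<noteq> y\<close> inj_onD[OF atlas_inj[OF B], of "F c" x y] c by auto
      then obtain U V where "open U" "open V" "coords (F c) x \<in> U" "coords (F c) y \<in> V" "U \<inter> V = {}"
        using hausdorff by metis
      then show ?thesis using d openin_chart_preimage[OF B, of "F c"] c
        by (intro exI[of _ "chart_dom (F c) \<inter> coords (F c) -` U"] exI[of _ "chart_dom (F c) \<inter> coords (F c) -` V"])
          (auto simp: disjnt_iff)
    qed
  qed
  moreover have "second_countable (atlas_topology (F ` A))"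
  proof -
    obtain C where C: "C \<subseteq> A" "countable C" "points C = points A"
      using A'(3) second_countable_atlas_topology_iff[OF A'(1)] by blast
    have "points (F ` A) \<subseteq> points (F ` C)"
    proof
      fix z assume z: "z \<in> points (F ` A)"
      then obtain c where "c \<in> C" "fst z \<in> chart_dom c" using img[OF z] C(3) unfolding points_def by blast
      then show "z \<in> points (F ` C)" using dom(2)[of c z] z C(1) unfolding points_def by blast
    qed
    moreover have "points (F ` C) \<subseteq> points (F ` A)" using C(1) unfolding points_def by blast
    ultimately have "points (F ` C) = points (F ` A)" by (rule subset_antisym[rotated])
    then show ?thesis unfolding second_countable_atlas_topology_iff[OF B]
      using C by (intro exI[of _ "F ` C"]) auto
  qed
  ultimately show ?thesis using B by (simp add: smooth_manifold_def)
qed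


section \<open>Vector bundles given by cocycles\<close>

text \<open>Vectors and covectors are both families indexed by charts in which one member determines
  all others by a linear law \<open>G c c' x\<close>. Proving the atlas properties for such a
  cocycle covers both bundles; smoothness is asked only for each fixed vector, since linearity
  supplies the rest.\<close>

locale bundle_cocycle =
  fixes A :: "('a, 'e::euclidean_space) chart set"
    and G :: "('a, 'e) chart \<Rightarrow> ('a, 'e) chart \<Rightarrow> 'a \<Rightarrow> 'e \<Rightarrow> 'e"
  assumes atlas: "smooth_atlas A"
    and lin: "c \<in> A \<Longrightarrow> c' \<in> A \<Longrightarrow> x \<in> chart_dom c \<Longrightarrow> x \<in> chart_dom c' \<Longrightarrow> linear (G c c' x)"
    and self: "c \<in> A \<Longrightarrow> x \<in> chart_dom c \<Longrightarrow> G c c x w = w"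
    and cocycle: "c \<in> A \<Longrightarrow> c' \<in> A \<Longrightarrow> c'' \<in> A \<Longrightarrow> x \<in> chart_dom c \<Longrightarrow> x \<in> chart_dom c' \<Longrightarrow>
      x \<in> chart_dom c'' \<Longrightarrow> G c' c'' x (G c c' x w) = G c c'' x w"
    and smooth: "c \<in> A \<Longrightarrow> c' \<in> A \<Longrightarrow> smooth_on (overlap c c') (\<lambda>q. G c c' (chart_inv c q) w)"
begin

definition fibre :: "'a \<Rightarrow> (('a, 'e) chart \<Rightarrow> 'e) set" where
  "fibre x = {v \<in> extensional (charts_at A x).
     \<forall>c\<in>charts_at A x. \<forall>c'\<in>charts_at A x. v c' = G c c' x (v c)}"

definition trivialisation :: "('a, 'e) chart \<Rightarrow> (('a, 'e) based, 'e \<times> 'e) chart" where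
  "trivialisation c = ({(x, v). x \<in> chart_dom c \<and> v \<in> fibre x}, \<lambda>(x, v). (coords c x, v c))"

lemma fibre_transition:
  "v \<in> fibre x \<Longrightarrow> c \<in> A \<Longrightarrow> c' \<in> A \<Longrightarrow> x \<in> chart_dom c \<Longrightarrow> x \<in> chart_dom c' \<Longrightarrow> v c' = G c c' x (v c)"
  unfolding fibre_def mem_Collect_eq by (elim conjE, drule bspec[of _ _ c], simp only: charts_at_iff,
    erule bspec, simp only: charts_at_iff)

lemma fibre_eqI:
  assumes "v \<in> fibre x" "v' \<in> fibre x" "c \<in> A" "x \<in> chart_dom c" "v c = v' c"
  shows "v = v'"
proof (rule extensionalityI)
  show "v \<in> extensional (charts_at A x)" "v' \<in> extensional (charts_at A x)"
    using assms(1,2) unfolding fibre_def by (blast, blast)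
  show "v c' = v' c'" if "c' \<in> charts_at A x" for c'
    using fibre_transition[OF assms(1,3), of c'] fibre_transition[OF assms(2,3), of c'] assms(4,5) that
    unfolding charts_at_iff by metis
qed

text \<open>A vector may be prescribed freely in one chart: it is transported to all others by
  \<open>G\<close>, and the cocycle identity makes the resulting family consistent. Hence the bundle
  charts are onto the whole fibre.\<close>

lemma fibre_exists:
  assumes "c \<in> A" "x \<in> chart_dom c"
  obtains v where "v \<in> fibre x" "v c = w"
proof (rule that)
  let ?v = "\<lambda>c'\<in>charts_at A x. G c c' x w"
  show "?v \<in> fibre x"
    using assms cocycle by (simp add: fibre_def charts_at_iff)
  show "?v c = w" using assms self by (simp add: charts_at_iff)
qed

lemma trivialisation_simps [simp]:
  "(x, v) \<in> chart_dom (trivialisation c) \<longleftrightarrow> x \<in> chart_dom c \<and> v \<in> fibre x"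
  "coords (trivialisation c) (x, v) = (coords c x, v c)"
  by (simp_all add: trivialisation_def)

lemma overlap_trivialisation:
  assumes c: "c \<in> A"
  shows "overlap (trivialisation c) (trivialisation c') = overlap c c' \<times> UNIV"
proof (rule set_eqI, rule iffI)
  fix y assume "y \<in> overlap c c' \<times> (UNIV :: 'e set)"
  then obtain x w where x: "y = (coords c x, w)" "x \<in> chart_dom c" "x \<in> chart_dom c'" by auto
  obtain v where "v \<in> fibre x" "v c = w" using fibre_exists[OF c x(2)] .
  then show "y \<in> overlap (trivialisation c) (trivialisation c')"
    using x by (intro image_eqI[of _ _ "(x, v)"]) auto
qed auto

lemma trivialisation_img: "c \<in> A \<Longrightarrow> chart_img (trivialisation c) = chart_img c \<times> UNIV"
  using overlap_trivialisation[of c c, unfolded overlap_self] .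

lemma inj_on_trivialisation:
  assumes "c \<in> A"
  shows "inj_on (coords (trivialisation c)) (chart_dom (trivialisation c))"
proof (rule inj_onI)
  fix y z assume y: "y \<in> chart_dom (trivialisation c)" and z: "z \<in> chart_dom (trivialisation c)"
    and e: "coords (trivialisation c) y = coords (trivialisation c) z"
  obtain x v x' v' where yz: "y = (x, v)" "z = (x', v')" by (cases y, cases z)
  then have "x = x'" using y z e inj_onD[OF atlas_inj[OF atlas assms], of x x'] by simp
  then show "y = z" using y z e yz fibre_eqI[of v x v' c] assms by simp
qed

lemma transition_trivialisation:
  assumes "c \<in> A" "c' \<in> A" "(q, w) \<in> overlap (trivialisation c) (trivialisation c')"
  shows "transition (trivialisation c) (trivialisation c') (q, w)
    = (transition c c' q, G c c' (chart_inv c q) w)"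
proof -
  obtain x v where x: "x \<in> chart_dom c" "x \<in> chart_dom c'" "v \<in> fibre x" "q = coords c x" "w = v c"
    using assms(3) by auto
  then have "transition (trivialisation c) (trivialisation c') (q, w) = (coords c' x, v c')"
    using transition_coords[OF inj_on_trivialisation[OF assms(1)], of "(x, v)"] by simp
  then show ?thesis
    using x transition_coords[OF atlas_inj[OF atlas assms(1)]] chart_inv_coords[OF atlas_inj[OF atlas assms(1)]]
      fibre_transition[OF x(3) assms(1,2) x(1,2)] by simp
qed

lemma smooth_atlas_total: "smooth_atlas (trivialisation ` A)"
proof (rule smooth_atlas_imageI)
  fix c assume c: "c \<in> A"
  show "inj_on (coords (trivialisation c)) (chart_dom (trivialisation c))"
    by (rule inj_on_trivialisation[OF c])
  show "open (chart_img (trivialisation c))"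
    using atlas_open_img[OF atlas c] by (simp add: trivialisation_img[OF c] open_Times)
  fix c' assume c': "c' \<in> A"
  note o = atlas_open_overlap[OF atlas c c']
  show op: "open (overlap (trivialisation c) (trivialisation c'))"
    unfolding overlap_trivialisation[OF c] using o by (simp add: open_Times)
  show "smooth_on (overlap (trivialisation c) (trivialisation c')) (transition (trivialisation c) (trivialisation c'))"
  proof (rule smooth_on_cong[OF op])
    show "(transition c c' (fst y), G c c' (chart_inv c (fst y)) (snd y)) = transition (trivialisation c) (trivialisation c') y"
      if "y \<in> overlap (trivialisation c) (trivialisation c')" for y
      using transition_trivialisation[OF c c', of "fst y" "snd y"] that by simp
    have s: "fst ` overlap (trivialisation c) (trivialisation c') \<subseteq> overlap c c'"
      unfolding overlap_trivialisation[OF c] by auto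
    note fs = smooth_on_fst[OF op smooth_on_ident] smooth_on_snd[OF op smooth_on_ident]
    show "smooth_on (overlap (trivialisation c) (trivialisation c'))
      (\<lambda>y. (transition c c' (fst y), G c c' (chart_inv c (fst y)) (snd y)))"
    proof (rule smooth_on_Pair[OF op])
      show "smooth_on (overlap (trivialisation c) (trivialisation c')) (\<lambda>y. transition c c' (fst y))"
        by (rule smooth_on_compose[OF op o s fs(1) atlas_smooth_transition[OF atlas c c']])
      show "smooth_on (overlap (trivialisation c) (trivialisation c')) (\<lambda>y. G c c' (chart_inv c (fst y)) (snd y))"
        by (rule smooth_on_family_apply[OF op o s fs smooth[OF c c']])
           (use lin[OF c c'] overlap_chart_inv[OF atlas c] in blast)
    qed
  qed
qed

lemma smooth_manifold_total:
  assumes "smooth_manifold A"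
  shows "smooth_manifold (trivialisation ` A)"
  by (rule smooth_manifold_total_space[OF assms smooth_atlas_total]) (auto simp: points_iff)

end

section \<open>The tangent and cotangent bundles as bundles of cocycles\<close>

lemma bundle_cocycle_tangent:
  assumes "smooth_atlas A"
  shows "bundle_cocycle A (\<lambda>c c' x. FD (transition c c') (coords c x))"
proof (rule bundle_cocycle.intro)
  show "smooth_atlas A" by fact
  show "smooth_on (overlap c c') (\<lambda>q. FD (transition c c') (coords c (chart_inv c q)) w)"
    if "c \<in> A" "c' \<in> A" for c c' w
    by (rule smooth_on_cong[OF atlas_open_overlap[OF assms that] _ smooth_on_FD[OF atlas_smooth_transition[OF assms that]]])
       (simp add: overlap_chart_inv[OF assms that(1)])
qed (rule linear_FD_transition[OF assms] FD_transition_self[OF assms] FD_transition_chain[OF assms]; assumption)+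

text \<open>Covectors pull back, so their law from \<open>c\<close> to \<open>c'\<close> is the
  adjoint of the derivative of the reverse transition, taken at the image point. It is smooth as the
  adjoint of a composition of smooth data, and its cocycle identity is the chain rule read
  backwards.\<close>

lemma bundle_cocycle_cotangent:
  assumes "smooth_atlas A"
  shows "bundle_cocycle A (\<lambda>c c' x. adjoint (FD (transition c' c) (coords c' x)))"
proof (rule bundle_cocycle.intro)
  show "smooth_atlas A" by fact
  fix c c' x w assume c: "c \<in> A" "c' \<in> A"
  have sub: "transition c c' ` overlap c c' \<subseteq> overlap c' c"
    using transition_coords[OF atlas_inj[OF assms c(1)], where c' = c'] by auto
  have "smooth_on (overlap c c') (\<lambda>q. adjoint (FD (transition c' c) (transition c c' q)) w)"
  proof (rule smooth_on_adjoint[OF atlas_open_overlap[OF assms c]])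
    show "smooth_on (overlap c c') (\<lambda>q. FD (transition c' c) (transition c c' q) w)" for w
      by (rule smooth_on_compose[OF atlas_open_overlap[OF assms c] atlas_open_overlap[OF assms c(2,1)] sub
        atlas_smooth_transition[OF assms c] smooth_on_FD[OF atlas_smooth_transition[OF assms c(2,1)]]])
    show "linear (FD (transition c' c) (transition c c' q))" if "q \<in> overlap c c'" for q
      by (rule FD_linear[OF smooth_on_differentiable[OF atlas_smooth_transition[OF assms c(2,1)] subsetD[OF sub imageI[OF that]]]])
  qed
  then show "smooth_on (overlap c c') (\<lambda>q. adjoint (FD (transition c' c) (coords c' (chart_inv c q))) w)"
    by (simp add: transition_def)
next
  fix c c' x assume "c \<in> A" "c' \<in> A" "x \<in> chart_dom c" "x \<in> chart_dom c'"
  then show "linear (adjoint (FD (transition c' c) (coords c' x)))"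
    by (intro adjoint_linear linear_FD_transition[OF assms])
next
  fix c x w assume c: "c \<in> A" "x \<in> chart_dom c"
  show "adjoint (FD (transition c c) (coords c x)) w = w"
    by (rule inner_eqI) (simp add: adjoint_clauses(2)[OF linear_FD_transition[OF assms c(1) c(1) c(2) c(2)]]
      FD_transition_self[OF assms c])
next
  fix c c' c'' x w
  assume c: "c \<in> A" "c' \<in> A" "c'' \<in> A" "x \<in> chart_dom c" "x \<in> chart_dom c'" "x \<in> chart_dom c''"
  note l = adjoint_clauses(2)[OF linear_FD_transition[OF assms]]
  show "adjoint (FD (transition c'' c') (coords c'' x)) (adjoint (FD (transition c' c) (coords c' x)) w) =
       adjoint (FD (transition c'' c) (coords c'' x)) w"
    by (rule inner_eqI) (simp add: l c FD_transition_chain[OF assms])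
qed

lemma tangent_space_eq_fibre:
  "smooth_atlas A \<Longrightarrow> tangent_space A x = bundle_cocycle.fibre A (\<lambda>c c' x. FD (transition c c') (coords c x)) x"
  by (simp add: bundle_cocycle.fibre_def[OF bundle_cocycle_tangent] tangent_space_def)

text \<open>The defining pairing condition for the pair of charts \<open>c'\<close>,
  \<open>c\<close> is the cocycle condition for \<open>c\<close>, \<open>c'\<close>. Both sides
  quantify over all pairs, so the swap is harmless.\<close>

lemma cotangent_space_eq_fibre:
  assumes "smooth_atlas A"
  shows "cotangent_space A x =
    bundle_cocycle.fibre A (\<lambda>c c' x. adjoint (FD (transition c' c) (coords c' x))) x"
proof -
  have "(\<forall>w. \<xi> c' \<bullet> w = \<xi> c \<bullet> FD (transition c' c) (coords c' x) w) \<longleftrightarrow>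
      \<xi> c' = adjoint (FD (transition c' c) (coords c' x)) (\<xi> c)"
    if "c \<in> charts_at A x" "c' \<in> charts_at A x" for \<xi> c c'
  proof -
    have "linear (FD (transition c' c) (coords c' x))"
      using that linear_FD_transition[OF assms] by (simp add: charts_at_iff)
    from adjoint_clauses(2)[OF this] show ?thesis
      using inner_eqI[of "\<xi> c'" "adjoint (FD (transition c' c) (coords c' x)) (\<xi> c)"] by metis
  qed
  then show ?thesis
    unfolding cotangent_space_def bundle_cocycle.fibre_def[OF bundle_cocycle_cotangent[OF assms]] by blast
qed

lemma tangent_chart_eq:
  "smooth_atlas A \<Longrightarrow> tangent_chart A = bundle_cocycle.trivialisation A (\<lambda>c c' x. FD (transition c c') (coords c x))"
  by (rule ext)
     (simp add: tangent_chart_def bundle_cocycle.trivialisation_def[OF bundle_cocycle_tangent] tangent_space_eq_fibre)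

lemma cotangent_chart_eq:
  "smooth_atlas A \<Longrightarrow> cotangent_chart A =
    bundle_cocycle.trivialisation A (\<lambda>c c' x. adjoint (FD (transition c' c) (coords c' x)))"
  by (rule ext)
     (simp add: cotangent_chart_def bundle_cocycle.trivialisation_def[OF bundle_cocycle_cotangent] cotangent_space_eq_fibre)

lemma smooth_manifold_tangent_bundle: "smooth_manifold A \<Longrightarrow> smooth_manifold (tangent_bundle A)"
  using bundle_cocycle.smooth_manifold_total[OF bundle_cocycle_tangent[OF smooth_manifoldD(1)]]
  by (simp add: tangent_bundle_def tangent_chart_eq smooth_manifoldD(1))

lemma smooth_manifold_cotangent_bundle: "smooth_manifold A \<Longrightarrow> smooth_manifold (cotangent_bundle A)"
  using bundle_cocycle.smooth_manifold_total[OF bundle_cocycle_cotangent[OF smooth_manifoldD(1)]]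
  by (simp add: cotangent_bundle_def cotangent_chart_eq smooth_manifoldD(1))

lemma chart_img_tangent_chart:
  "smooth_atlas A \<Longrightarrow> c \<in> A \<Longrightarrow> chart_img (tangent_chart A c) = chart_img c \<times> UNIV"
  using bundle_cocycle.trivialisation_img[OF bundle_cocycle_tangent] by (simp add: tangent_chart_eq)

lemma chart_img_cotangent_chart:
  "smooth_atlas A \<Longrightarrow> c \<in> A \<Longrightarrow> chart_img (cotangent_chart A c) = chart_img c \<times> UNIV"
  using bundle_cocycle.trivialisation_img[OF bundle_cocycle_cotangent] by (simp add: cotangent_chart_eq)

lemma overlap_tangent_chart:
  "smooth_atlas A \<Longrightarrow> c \<in> A \<Longrightarrow> overlap (tangent_chart A c) (tangent_chart A c') = overlap c c' \<times> UNIV"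
  using bundle_cocycle.overlap_trivialisation[OF bundle_cocycle_tangent] by (simp add: tangent_chart_eq)

lemma overlap_cotangent_chart:
  "smooth_atlas A \<Longrightarrow> c \<in> A \<Longrightarrow> overlap (cotangent_chart A c) (cotangent_chart A c') = overlap c c' \<times> UNIV"
  using bundle_cocycle.overlap_trivialisation[OF bundle_cocycle_cotangent] by (simp add: cotangent_chart_eq)

lemma tangent_chart_simps [simp]:
  "(x, v) \<in> chart_dom (tangent_chart A c) \<longleftrightarrow> x \<in> chart_dom c \<and> v \<in> tangent_space A x"
  "coords (tangent_chart A c) (x, v) = (coords c x, v c)"
  by (simp_all add: tangent_chart_def)

lemma cotangent_chart_simps [simp]:
  "(x, v) \<in> chart_dom (cotangent_chart A c) \<longleftrightarrow> x \<in> chart_dom c \<and> v \<in> cotangent_space A x"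
  "coords (cotangent_chart A c) (x, v) = (coords c x, v c)"
  by (simp_all add: cotangent_chart_def)

section \<open>Products with the real line\<close>

lemma line_chart_simps [simp]:
  "(x, t) \<in> chart_dom (line_chart c) \<longleftrightarrow> x \<in> chart_dom c"
  "coords (line_chart c) (x, t) = (coords c x, t)"
  by (simp_all add: line_chart_def)

lemma overlap_line_chart: "overlap (line_chart c) (line_chart c') = overlap c c' \<times> UNIV"
  by (force simp: line_chart_def)

lemma chart_img_line_chart: "chart_img (line_chart c) = chart_img c \<times> UNIV"
  using overlap_line_chart[of c c, unfolded overlap_self] .

lemma inj_on_line_chart: "inj_on (coords c) (chart_dom c) \<Longrightarrow> inj_on (coords (line_chart c)) (chart_dom (line_chart c))"
  by (auto simp: inj_on_def)

lemma transition_line_chart: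
  assumes "inj_on (coords c) (chart_dom c)" "y \<in> overlap c c'"
  shows "transition (line_chart c) (line_chart c') (y, t) = (transition c c' y, t)"
proof -
  obtain x where x: "x \<in> chart_dom c" "x \<in> chart_dom c'" "y = coords c x" using assms(2) by blast
  then show ?thesis
    using transition_coords[OF inj_on_line_chart[OF assms(1)], of "(x, t)"] transition_coords[OF assms(1)] by simp
qed

lemma smooth_atlas_times_line:
  assumes A: "smooth_atlas A"
  shows "smooth_atlas (times_line A)"
  unfolding times_line_def
proof (rule smooth_atlas_imageI)
  fix c assume c: "c \<in> A"
  show "inj_on (coords (line_chart c)) (chart_dom (line_chart c))"
    by (rule inj_on_line_chart[OF atlas_inj[OF A c]])
  show "open (chart_img (line_chart c))"
    using atlas_open_img[OF A c] by (simp add: chart_img_line_chart open_Times)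
  fix c' assume c': "c' \<in> A"
  show op: "open (overlap (line_chart c) (line_chart c'))"
    using atlas_open_overlap[OF A c c'] by (simp add: overlap_line_chart open_Times)
  show "smooth_on (overlap (line_chart c) (line_chart c')) (transition (line_chart c) (line_chart c'))"
  proof (rule smooth_on_cong[OF op])
    show "(transition c c' (fst y), snd y) = transition (line_chart c) (line_chart c') y"
      if "y \<in> overlap (line_chart c) (line_chart c')" for y
      using transition_line_chart[OF atlas_inj[OF A c], of "fst y" c' "snd y"] that
      unfolding overlap_line_chart by (auto simp: mem_Times_iff)
    show "smooth_on (overlap (line_chart c) (line_chart c')) (\<lambda>y. (transition c c' (fst y), snd y))"
    proof (intro smooth_on_Pair op smooth_on_snd smooth_on_ident)
      show "smooth_on (overlap (line_chart c) (line_chart c')) (\<lambda>y. transition c c' (fst y))"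
        by (rule smooth_on_compose[OF op atlas_open_overlap[OF A c c'] _ smooth_on_fst[OF op smooth_on_ident]
           atlas_smooth_transition[OF A c c']]) (auto simp: overlap_line_chart)
    qed
  qed
qed

lemma smooth_manifold_times_line:
  assumes "smooth_manifold A"
  shows "smooth_manifold (times_line A)"
  using smooth_atlas_times_line[OF smooth_manifoldD(1)[OF assms]]
  unfolding times_line_def
  by (rule smooth_manifold_total_space[OF assms]) (auto simp: line_chart_def)


section \<open>Tangent vectors, covectors and one-jets in charts\<close>

lemma tangent_spaceD:
  assumes "v \<in> tangent_space A x" "c \<in> A" "x \<in> chart_dom c" "c' \<in> A" "x \<in> chart_dom c'"
  shows "v c' = FD (transition c c') (coords c x) (v c)"
proof -
  have "c \<in> charts_at A x" "c' \<in> charts_at A x" using assms by (simp_all add: charts_at_iff)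
  then show ?thesis using assms(1) unfolding tangent_space_def mem_Collect_eq by (elim conjE) (drule (1) bspec, drule (1) bspec)
qed

lemma cotangent_spaceD:
  assumes "\<xi> \<in> cotangent_space A x" "c \<in> A" "x \<in> chart_dom c" "c' \<in> A" "x \<in> chart_dom c'"
  shows "\<xi> c \<bullet> w = \<xi> c' \<bullet> FD (transition c c') (coords c x) w"
proof -
  have "c \<in> charts_at A x" "c' \<in> charts_at A x" using assms by (simp_all add: charts_at_iff)
  then show ?thesis using assms(1) unfolding cotangent_space_def mem_Collect_eq
    by (elim conjE) (drule (1) bspec, drule (1) bspec, erule spec)
qed

lemma cotangent_spaceI:
  assumes "\<xi> \<in> extensional (charts_at A x)"
    and "\<And>c c' w. c \<in> A \<Longrightarrow> x \<in> chart_dom c \<Longrightarrow> c' \<in> A \<Longrightarrow> x \<in> chart_dom c' \<Longrightarrow>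
      \<xi> c \<bullet> w = \<xi> c' \<bullet> FD (transition c c') (coords c x) w"
  shows "\<xi> \<in> cotangent_space A x"
  unfolding cotangent_space_def mem_Collect_eq charts_at_iff
  by (intro conjI ballI allI assms(1), unfold charts_at_iff, elim conjE, rule assms(2))

lemma cotangent_space_eqI:
  "smooth_atlas A \<Longrightarrow> \<xi> \<in> cotangent_space A x \<Longrightarrow> \<xi>' \<in> cotangent_space A x \<Longrightarrow> c \<in> A \<Longrightarrow> x \<in> chart_dom c \<Longrightarrow>
    \<xi> c = \<xi>' c \<Longrightarrow> \<xi> = \<xi>'"
  using bundle_cocycle.fibre_eqI[OF bundle_cocycle_cotangent] by (simp add: cotangent_space_eq_fibre)

lemma pairing_eq:
  assumes "\<xi> \<in> cotangent_space A x" "v \<in> tangent_space A x" "c \<in> A" "x \<in> chart_dom c"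
  shows "pairing A x \<xi> v = \<xi> c \<bullet> v c"
  unfolding pairing_def
proof (rule the_equality)
  show "\<forall>c'\<in>charts_at A x. \<xi> c \<bullet> v c = \<xi> c' \<bullet> v c'"
  proof
    fix c' assume "c' \<in> charts_at A x"
    then have "c' \<in> A" "x \<in> chart_dom c'" by (simp_all add: charts_at_iff)
    then show "\<xi> c \<bullet> v c = \<xi> c' \<bullet> v c'"
      using cotangent_spaceD[OF assms(1,3,4), of c' "v c"] tangent_spaceD[OF assms(2-4), of c'] by simp
  qed
  show "r = \<xi> c \<bullet> v c" if "\<forall>c'\<in>charts_at A x. r = \<xi> c' \<bullet> v c'" for r
    using bspec[OF that, of c] assms(3,4) by (simp add: charts_at_iff)
qed

lemma smooth_function_chart: "smooth_function A f \<Longrightarrow> c \<in> A \<Longrightarrow> smooth_on (chart_img c) (f \<circ> chart_inv c)"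
  by (simp add: smooth_function_def)

lemma differential_in_cotangent_space:
  assumes A: "smooth_atlas A" and f: "smooth_function A f"
  shows "differential A f x \<in> cotangent_space A x"
proof (rule cotangent_spaceI)
  show "differential A f x \<in> extensional (charts_at A x)" by (simp add: differential_def)
  fix c c' w assume c: "c \<in> A" "x \<in> chart_dom c" "c' \<in> A" "x \<in> chart_dom c'"
  have "(f \<circ> chart_inv k) differentiable at (coords k x)" if "k \<in> A" "x \<in> chart_dom k" for k
    using smooth_on_differentiable[OF smooth_function_chart[OF f that(1)] coords_in_img[OF that(2)]] .
  then show "differential A f x c \<bullet> w = differential A f x c' \<bullet> FD (transition c c') (coords c x) w"
    using c smooth_function_transition[OF A c(1,3) f c(2,4), of w]
    by (simp add: differential_def charts_at_iff inner_grad)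
qed

text \<open>A covector is determined by its components in a single chart, so membership can be
  tested there. The existential over \<open>b\<close> carries no domain condition because the
  coordinates of \<open>y\<close> force \<open>b = coords c x\<close> for its base point
  \<open>x\<close>.\<close>

lemma jet_image_iff:
  assumes A: "smooth_atlas A" and f: "smooth_function A f" and c: "c \<in> A"
    and y: "y \<in> chart_dom (ext_cotangent_chart A c)"
  shows "y \<in> jet_image A f \<longleftrightarrow>
    (\<exists>b. coords (ext_cotangent_chart A c) y = ((b, grad (f \<circ> chart_inv c) b), (f \<circ> chart_inv c) b))"
proof -
  obtain x \<xi> t where y_eq: "y = ((x, \<xi>), t)" by (metis surj_pair)
  have x: "x \<in> chart_dom c" and \<xi>: "\<xi> \<in> cotangent_space A x" using y by (simp_all add: y_eq)
  have inv: "chart_inv c (coords c x) = x" using chart_inv_coords[OF atlas_inj[OF A c] x] .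
  have "x \<in> points A" using c x unfolding points_def by blast
  then have "y \<in> jet_image A f \<longleftrightarrow> \<xi> = differential A f x \<and> t = f x"
    by (auto simp: jet_image_def y_eq)
  also have "\<xi> = differential A f x \<longleftrightarrow> \<xi> c = grad (f \<circ> chart_inv c) (coords c x)"
    using cotangent_space_eqI[OF A \<xi> differential_in_cotangent_space[OF A f] c x] c x
    by (auto simp: differential_def charts_at_iff)
  finally show ?thesis using inv by (simp add: y_eq)
qed


section \<open>Contact forms with the same expression in all charts\<close>

lemma ext_deriv_cong:
  assumes "open S" "y \<in> S" "\<And>z. z \<in> S \<Longrightarrow> \<omega> z = \<theta> z" "\<theta> differentiable at y"
  shows "ext_deriv \<omega> y v w = ext_deriv \<theta> y v w"
proof -
  have "FD \<theta> y = FD \<omega> y"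
    by (rule FD_cong_open[OF assms(1,2) _ assms(4)]) (simp add: assms(3))
  then show ?thesis by (simp add: ext_deriv_def)
qed

text \<open>Both contact forms of the theorem have one and the same coordinate expression in every
  induced chart. Recording it as a map \<open>\<theta>\<close> on the whole model space lets the
  contact condition be checked by linear algebra there.\<close>

definition uniform_form :: "('a, 'e::euclidean_space) chart set \<Rightarrow> ('e \<Rightarrow> 'e) \<Rightarrow> 'a \<Rightarrow> ('a, 'e) chart \<Rightarrow> 'e" where
  "uniform_form A \<theta> x = (\<lambda>k\<in>charts_at A x. \<theta> (coords k x))"

text \<open>On a chart image, which is open, the local representative coincides with
  \<open>\<theta>\<close> and therefore has the same exterior derivative. What remains global is the
  invariance of \<open>\<theta>\<close> under coordinate changes, which makes it a one-form.\<close>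

lemma contact_manifold_uniform_form:
  fixes A :: "('a, 'e::euclidean_space) chart set"
  assumes A: "smooth_manifold A" and "odd (DIM('e))" and smooth: "smooth_on UNIV \<theta>"
    and inv: "\<And>x k k' w. k \<in> A \<Longrightarrow> x \<in> chart_dom k \<Longrightarrow> k' \<in> A \<Longrightarrow> x \<in> chart_dom k' \<Longrightarrow>
      \<theta> (coords k x) \<bullet> w = \<theta> (coords k' x) \<bullet> FD (transition k k') (coords k x) w"
    and nz: "\<And>y. \<theta> y \<noteq> 0"
    and nondeg: "\<And>y v. \<theta> y \<bullet> v = 0 \<Longrightarrow> (\<And>w. \<theta> y \<bullet> w = 0 \<Longrightarrow> ext_deriv \<theta> y v w = 0) \<Longrightarrow> v = 0"
  shows "contact_manifold A (uniform_form A \<theta>)"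
proof -
  note atl = smooth_manifoldD(1)[OF A]
  have loc: "uniform_form A \<theta> (chart_inv c y) c = \<theta> y" if "c \<in> A" "y \<in> chart_img c" for c y
    using that chart_inv_in_dom[OF that(2)] coords_chart_inv[OF that(2)]
    by (simp add: uniform_form_def charts_at_iff)
  have 1: "uniform_form A \<theta> x \<in> cotangent_space A x" for x
  proof (rule cotangent_spaceI)
    show "uniform_form A \<theta> x \<in> extensional (charts_at A x)" by (simp add: uniform_form_def)
    fix k k' w assume k: "k \<in> A" "x \<in> chart_dom k" "k' \<in> A" "x \<in> chart_dom k'"
    then have "uniform_form A \<theta> x k = \<theta> (coords k x)" "uniform_form A \<theta> x k' = \<theta> (coords k' x)"
      by (simp_all add: uniform_form_def charts_at_iff)
    then show "uniform_form A \<theta> x k \<bullet> w = uniform_form A \<theta> x k' \<bullet> FD (transition k k') (coords k x) w"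
      using inv[OF k, of w] by simp
  qed
  have 2: "smooth_on (chart_img c) (\<lambda>y. uniform_form A \<theta> (chart_inv c y) c)" if c: "c \<in> A" for c
    by (rule smooth_on_cong[OF atlas_open_img[OF atl c] _ smooth_on_subset[OF smooth subset_UNIV]])
       (simp add: loc[OF c])
  have 3: "v = 0"
    if c: "c \<in> A" and y: "y \<in> chart_img c" and
      v: "uniform_form A \<theta> (chart_inv c y) c \<bullet> v = 0 \<and>
        (\<forall>w. uniform_form A \<theta> (chart_inv c y) c \<bullet> w = 0 \<longrightarrow>
          ext_deriv (\<lambda>y. uniform_form A \<theta> (chart_inv c y) c) y v w = 0)" for c y v
  proof -
    have "ext_deriv (\<lambda>y. uniform_form A \<theta> (chart_inv c y) c) y v w = ext_deriv \<theta> y v w" for w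
      by (rule ext_deriv_cong[OF atlas_open_img[OF atl c] y loc[OF c] smooth_on_differentiable[OF smooth UNIV_I]])
    then show ?thesis using v nondeg[of y v] by (simp add: loc[OF c y])
  qed
  have 4: "uniform_form A \<theta> (chart_inv c y) c \<noteq> 0" if "c \<in> A" "y \<in> chart_img c" for c y
    using nz loc[OF that] by simp
  show ?thesis
    unfolding contact_manifold_def smooth_one_form_def Let_def
    by (intro conjI ballI allI impI assms(1,2) 1) (erule 2, erule (1) 4, erule (2) 3)
qed


section \<open>Submanifolds that are graphs in charts\<close>

text \<open>The new chart is an old one followed by a diffeomorphism \<open>\<psi>\<close> of its
  image with inverse \<open>\<phi>\<close>. Its transitions to and from the atlas are those of
  \<open>k\<close> with \<open>\<phi>\<close> inserted before or \<open>\<psi>\<close>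
  after.\<close>

lemma smooth_atlas_insert_twisted_chart:
  assumes A: "smooth_atlas A" and k: "k \<in> A"
    and \<psi>: "smooth_on (chart_img k) \<psi>" "\<psi> ` chart_img k \<subseteq> chart_img k"
    and \<phi>: "smooth_on (chart_img k) \<phi>" "\<phi> ` chart_img k \<subseteq> chart_img k"
    and inverse: "\<And>y. y \<in> chart_img k \<Longrightarrow> \<phi> (\<psi> y) = y" "\<And>y. y \<in> chart_img k \<Longrightarrow> \<psi> (\<phi> y) = y"
  shows "smooth_atlas (insert (chart_dom k, \<psi> \<circ> coords k) A)"
proof -
  define c where "c = (chart_dom k, \<psi> \<circ> coords k)"
  have c [simp]: "chart_dom c = chart_dom k" "coords c x = \<psi> (coords k x)" for x
    by (simp_all add: c_def)
  have injk: "inj_on (coords k) (chart_dom k)" and op: "open (chart_img k)"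
    using atlas_inj[OF A k] atlas_open_img[OF A k] .
  have inj: "inj_on (coords c) (chart_dom c)"
  proof (rule inj_onI)
    fix x y assume "x \<in> chart_dom c" "y \<in> chart_dom c" "coords c x = coords c y"
    then have xy: "x \<in> chart_dom k" "y \<in> chart_dom k" "\<psi> (coords k x) = \<psi> (coords k y)"
      by (simp_all only: c)
    have "coords k x = coords k y"
      using inverse(1)[OF coords_in_img[OF xy(1)]] inverse(1)[OF coords_in_img[OF xy(2)]] xy(3) by argo
    then show "x = y" by (rule inj_onD[OF injk _ xy(1,2)])
  qed
  \<comment> \<open>Through this description openness of the new overlaps follows from continuity of
    \<open>\<phi>\<close>.\<close>
  have ov: "overlap c c' = chart_img k \<inter> \<phi> -` overlap k c'" for c'
  proof (intro subset_antisym subsetI)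
    fix y assume "y \<in> overlap c c'"
    then obtain x where x: "x \<in> chart_dom k" "x \<in> chart_dom c'" "y = \<psi> (coords k x)" by auto
    then have "y \<in> chart_img k" "\<phi> y = coords k x" using \<psi>(2) inverse(1) coords_in_img[OF x(1)] by auto
    then show "y \<in> chart_img k \<inter> \<phi> -` overlap k c'" using x by simp
  next
    fix y assume y: "y \<in> chart_img k \<inter> \<phi> -` overlap k c'"
    then obtain x where x: "x \<in> chart_dom k" "x \<in> chart_dom c'" "\<phi> y = coords k x" by auto
    then have "y = coords c x" using inverse(2)[of y] y by simp
    then show "y \<in> overlap c c'" using x by simp
  qed
  have img: "chart_img c = chart_img k"
  proof -
    have "overlap c k = chart_img c" by (simp add: chart_img_def)
    then have "chart_img c = chart_img k \<inter> \<phi> -` chart_img k" using ov[of k, unfolded overlap_self] by simp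
    then show ?thesis using \<phi>(2) by blast
  qed
  have op1: "open (overlap c c')" if "c' \<in> A" for c'
    unfolding ov by (rule continuous_open_preimage[OF smooth_on_continuous[OF \<phi>(1)] op atlas_open_overlap[OF A k that]])
  have op2: "open (overlap c' c)" if "c' \<in> A" for c'
    using atlas_open_overlap[OF A that k] by simp
  have s1: "smooth_on (overlap c c') (transition c c')" if c': "c' \<in> A" for c'
  proof (rule smooth_on_cong[OF op1[OF c']])
    show "transition k c' (\<phi> y) = transition c c' y" if "y \<in> overlap c c'" for y
    proof -
      obtain x where x: "x \<in> chart_dom c" "x \<in> chart_dom c'" "y = coords c x" using \<open>y \<in> overlap c c'\<close> by blast
      then have "\<phi> y = coords k x" using inverse(1) coords_in_img[of x k] by simp
      then show ?thesis using x transition_coords[OF inj x(1), of c'] transition_coords[OF injk, of x c'] by simp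
    qed
    have sub: "overlap c c' \<subseteq> chart_img k" "\<phi> ` overlap c c' \<subseteq> overlap k c'" unfolding ov by blast+
    show "smooth_on (overlap c c') (\<lambda>y. transition k c' (\<phi> y))"
      by (rule smooth_on_compose[OF op1[OF c'] atlas_open_overlap[OF A k c'] sub(2)
           smooth_on_subset[OF \<phi>(1) sub(1)] atlas_smooth_transition[OF A k c']])
  qed
  have s2: "smooth_on (overlap c' c) (transition c' c)" if c': "c' \<in> A" for c'
  proof (rule smooth_on_cong[OF op2[OF c']])
    note tr = transition_coords[OF atlas_inj[OF A c']]
    show "\<psi> (transition c' k y) = transition c' c y" if "y \<in> overlap c' c" for y
    proof -
      obtain x where x: "x \<in> chart_dom c'" "y = coords c' x" using \<open>y \<in> overlap c' c\<close> by blast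
      then show ?thesis using tr[OF x(1), of k] tr[OF x(1), of c] by simp
    qed
    have e: "overlap c' c = overlap c' k" by simp
    have sub: "transition c' k ` overlap c' k \<subseteq> chart_img k"
    proof (rule subsetI, elim imageE)
      fix z y x assume "z = transition c' k y" "y = coords c' x" "x \<in> chart_dom c' \<inter> chart_dom k"
      then show "z \<in> chart_img k" using tr[of x k] coords_in_img[of x k] by simp
    qed
    show "smooth_on (overlap c' c) (\<lambda>y. \<psi> (transition c' k y))"
      unfolding e by (rule smooth_on_compose[OF atlas_open_overlap[OF A c' k] op sub atlas_smooth_transition[OF A c' k] \<psi>(1)])
  qed
  have s3: "smooth_on (chart_img c) (transition c c)"
    unfolding img
  proof (rule smooth_on_cong[OF op _ smooth_on_ident])
    show "y = transition c c y" if "y \<in> chart_img k" for y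
      using that unfolding img[symmetric] by (simp add: transition_def coords_chart_inv del: c)
  qed
  show ?thesis
    unfolding smooth_atlas_def c_def[symmetric]
  proof (intro conjI ballI)
    fix c1 assume c1: "c1 \<in> insert c A"
    show "inj_on (coords c1) (chart_dom c1)" using c1 inj atlas_inj[OF A] by blast
    show "open (chart_img c1)" using c1 img op atlas_open_img[OF A] by (elim insertE) simp_all
    fix c2 assume c2: "c2 \<in> insert c A"
    show "open (overlap c1 c2)"
      using c1 c2 op1 op2 op img atlas_open_overlap[OF A]
      by (elim insertE; hypsubst?) (simp_all only: overlap_self)
    show "smooth_on (overlap c1 c2) (transition c1 c2)"
      using c1 c2 s1 s2 s3 atlas_smooth_transition[OF A]
      by (elim insertE; hypsubst?) (simp_all only: overlap_self)
  qed
qed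

text \<open>The shear \<open>\<psi>\<close> moves each point inside its fibre of
  \<open>\<rho>\<close>, taking the graph point \<open>j b\<close> to \<open>\<iota> b\<close>;
  reversing the two corrections gives its inverse \<open>\<phi>\<close>. Since the chart image is a
  full preimage under \<open>\<rho>\<close>, both maps preserve it, and the graph becomes the part
  of the subspace \<open>range \<iota>\<close> in the chart image.\<close>

lemma graph_slice_chart:
  fixes \<rho> :: "'e::euclidean_space \<Rightarrow> 'f::euclidean_space" and A :: "('a, 'e) chart set"
  assumes A: "smooth_atlas A" and k: "k \<in> A"
    and lin: "linear \<rho>" "linear \<iota>" "\<And>b. \<rho> (\<iota> b) = b"
    and U: "open U" "smooth_on U j" "\<And>b. b \<in> U \<Longrightarrow> \<rho> (j b) = b" "chart_img k = \<rho> -` U"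
    and S: "coords k ` (chart_dom k \<inter> S) = j ` U"
  obtains c where "slice_chart A (DIM('f)) S c (range \<iota>)" "chart_dom c = chart_dom k"
proof -
  define \<psi> where "\<psi> y = y - j (\<rho> y) + \<iota> (\<rho> y)" for y
  define \<phi> where "\<phi> y = y + j (\<rho> y) - \<iota> (\<rho> y)" for y
  have op: "open (chart_img k)" using atlas_open_img[OF A k] .
  have proj: "\<rho> (\<psi> y) = \<rho> y" "\<rho> (\<phi> y) = \<rho> y" if "y \<in> chart_img k" for y
    using that U(3)[of "\<rho> y"] U(4) lin by (simp_all add: \<psi>_def \<phi>_def linear_add linear_diff)
  have smooth: "smooth_on (chart_img k) (\<lambda>y. j (\<rho> y))" "smooth_on (chart_img k) (\<lambda>y. \<iota> (\<rho> y))"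
  proof -
    show "smooth_on (chart_img k) (\<lambda>y. j (\<rho> y))"
      by (rule smooth_on_compose[OF op U(1) _ smooth_on_linear[OF lin(1)] U(2)]) (auto simp: U(4))
    show "smooth_on (chart_img k) (\<lambda>y. \<iota> (\<rho> y))"
      by (rule smooth_on_compose_linear[OF lin(2) op smooth_on_linear[OF lin(1)]])
  qed
  let ?c = "(chart_dom k, \<psi> \<circ> coords k)"
  have into: "\<psi> ` chart_img k \<subseteq> chart_img k" "\<phi> ` chart_img k \<subseteq> chart_img k"
    by (rule image_subsetI, use proj U(4) in simp)+
  have inverse: "\<phi> (\<psi> y) = y" "\<psi> (\<phi> y) = y" if "y \<in> chart_img k" for y
    using proj[OF that] unfolding \<phi>_def[of "\<psi> y"] \<psi>_def[of "\<phi> y"]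
    by (simp_all add: \<phi>_def \<psi>_def)
  have smooth\<psi>: "smooth_on (chart_img k) \<psi>"
    unfolding \<psi>_def[abs_def] by (rule smooth_on_add[OF op smooth_on_diff[OF op smooth_on_ident smooth(1)] smooth(2)])
  have smooth\<phi>: "smooth_on (chart_img k) \<phi>"
    unfolding \<phi>_def[abs_def] by (rule smooth_on_diff[OF op smooth_on_add[OF op smooth_on_ident smooth(1)] smooth(2)])
  have atl: "smooth_atlas (insert ?c A)"
    by (rule smooth_atlas_insert_twisted_chart[OF A k smooth\<psi> into(1) smooth\<phi> into(2) inverse])
  have img: "chart_img ?c = chart_img k"
  proof -
    have "chart_img ?c = \<psi> ` chart_img k" by (simp add: chart_img_def image_comp)
    moreover have "chart_img k \<subseteq> \<psi> ` chart_img k"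
    proof
      fix y assume "y \<in> chart_img k"
      then show "y \<in> \<psi> ` chart_img k" using inverse(2) into(2) by (metis image_eqI image_subset_iff)
    qed
    ultimately show ?thesis using into(1) by blast
  qed
  have mem: "\<psi> y \<in> range \<iota> \<longleftrightarrow> y = j (\<rho> y)" if y: "y \<in> chart_img k" for y
  proof
    assume "\<psi> y \<in> range \<iota>"
    then obtain b where b: "\<psi> y = \<iota> b" by blast
    then have "\<rho> y = b" using proj(1)[OF y] lin(3) by metis
    then show "y = j (\<rho> y)" using b by (simp add: \<psi>_def)
  qed (auto simp: \<psi>_def)
  have "coords ?c ` (chart_dom ?c \<inter> S) = \<psi> ` (coords k ` (chart_dom k \<inter> S))"
    by (simp add: image_comp)
  also have "\<dots> = chart_img ?c \<inter> range \<iota>"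
    unfolding S img
  proof (intro subset_antisym subsetI)
    fix z assume "z \<in> \<psi> ` j ` U"
    then obtain b where b: "b \<in> U" "z = \<psi> (j b)" by blast
    then have "j b \<in> chart_img k" using U(3,4) by simp
    then show "z \<in> chart_img k \<inter> range \<iota>" using b into(1) mem[of "j b"] U(3)[OF b(1)] by auto
  next
    fix z assume z: "z \<in> chart_img k \<inter> range \<iota>"
    then have z': "\<phi> z \<in> chart_img k" "z = \<psi> (\<phi> z)" using inverse(2)[of z] into(2) by auto
    then have "\<phi> z = j (\<rho> (\<phi> z))" using mem[of "\<phi> z"] z by auto
    moreover have "\<rho> (\<phi> z) \<in> U" using z'(1) U(4) by simp
    ultimately show "z \<in> \<psi> ` j ` U" using z'(2) by (metis image_eqI)
  qed
  finally have "coords ?c ` (chart_dom ?c \<inter> S) = chart_img ?c \<inter> range \<iota>" .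
  moreover have "inj \<iota>" using lin(3) by (metis injI)
  then have "dim (range \<iota>) = DIM('f)" using dim_image_eq[OF lin(2), of UNIV] by (simp add: inj_on_def)
  moreover have "subspace (range \<iota>)" using linear_subspace_image[OF lin(2) subspace_UNIV] .
  moreover have "compatible_chart A ?c"
    using atl k unfolding compatible_chart_def points_def by auto
  ultimately have "slice_chart A (DIM('f)) S ?c (range \<iota>)" by (simp add: slice_chart_def)
  then show thesis by (rule that) simp
qed

text \<open>The tangent vector may come from any slice chart \<open>c\<close>. There it is the
  velocity of a straight line in the slice; seen in \<open>k\<close>, this line is a curve
  \<open>\<gamma>\<close> on the graph, hence
  \<open>\<gamma> = j \<circ> \<rho> \<circ> \<gamma>\<close> near 0, and differentiating at 0 gives
  the claim.\<close>

lemma submanifold_tangent_in_graph: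
  fixes \<rho> :: "'e::euclidean_space \<Rightarrow> 'f::euclidean_space" and A :: "('a, 'e) chart set"
  assumes k: "k \<in> A" and lin: "linear \<rho>"
    and U: "open U" "smooth_on U j" "\<And>b. b \<in> U \<Longrightarrow> \<rho> (j b) = b"
    and S: "coords k ` (chart_dom k \<inter> S) = j ` U"
    and x: "x \<in> S" "x \<in> chart_dom k" and v: "v \<in> submanifold_tangent_space A m S x"
  shows "v k = FD j (\<rho> (coords k x)) (\<rho> (v k))"
proof -
  obtain c W w where c: "slice_chart A m S c W" "x \<in> chart_dom c" "w \<in> W"
    and v': "\<forall>c'\<in>charts_at A x. v c' = FD (transition c c') (coords c x) w"
    using v unfolding submanifold_tangent_space_def by blast
  have vk: "v k = FD (transition c k) (coords c x) w" using v' k x(2) by (simp add: charts_at_iff)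
  have atl: "smooth_atlas (insert c A)" and W: "subspace W"
    and cS: "coords c ` (chart_dom c \<inter> S) = chart_img c \<inter> W"
    using c(1) unfolding slice_chart_def compatible_chart_def by blast+
  have ck: "c \<in> insert c A" "k \<in> insert c A" using k by simp_all
  note inj = atlas_inj[OF atl ck(1)]
  have tr0: "transition c k (coords c x) = coords k x" by (rule transition_coords[OF inj c(2)])
  define \<gamma> where "\<gamma> t = transition c k (coords c x + t *\<^sub>R w)" for t :: real
  \<comment> \<open>The times at which the line is still in the overlap. This set is open and
    contains 0, which is all that differentiation at 0 requires.\<close>
  define T where "T = (\<lambda>t. coords c x + t *\<^sub>R w) -` overlap c k"
  have "open T" unfolding T_def
    by (rule open_vimage[OF atlas_open_overlap[OF atl ck]]) (intro continuous_intros)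
  have "0 \<in> T" using coords_in_overlap[OF c(2) x(2)] by (simp add: T_def)
  have x_img: "coords c x \<in> W" using cS c(2) x(1) by blast
  have on_graph: "\<gamma> t \<in> j ` U" if "t \<in> T" for t
  proof -
    let ?y = "coords c x + t *\<^sub>R w"
    have y: "?y \<in> overlap c k" using that by (simp add: T_def)
    then have "?y \<in> chart_img c" by (rule subsetD[OF overlap_subset_img])
    moreover have "?y \<in> W" using W x_img c(3) by (simp add: subspace_add subspace_mul)
    ultimately have "?y \<in> coords c ` (chart_dom c \<inter> S)" using cS by simp
    then obtain z where "z \<in> chart_dom c \<inter> S" and z3: "?y = coords c z" by (elim imageE)
    then have z: "z \<in> chart_dom c" "z \<in> S" "?y = coords c z" by simp_all
    then have "z = chart_inv c ?y" using chart_inv_coords[OF inj z(1)] by simp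
    then have "z \<in> chart_dom k" using overlap_chart_inv(2)[OF atl ck(1) y] by simp
    then have "coords k z \<in> j ` U" using z(2) unfolding S[symmetric] by simp
    moreover have "\<gamma> t = coords k z" using transition_coords[OF inj z(1), of k] z(3) by (simp add: \<gamma>_def)
    ultimately show ?thesis by simp
  qed
  have b: "\<rho> (coords k x) \<in> U" "coords k x = j (\<rho> (coords k x))"
  proof -
    have "coords k x \<in> j ` U" unfolding S[symmetric] using x by simp
    then obtain b where "coords k x = j b" "b \<in> U" by (elim imageE)
    then show "\<rho> (coords k x) \<in> U" "coords k x = j (\<rho> (coords k x))" using U(3) by simp_all
  qed
  have "linear (FD (transition c k) (coords c x))"
    using linear_FD_transition[OF atl ck c(2) x(2)] .
  then have lc: "FD (transition c k) (coords c x) (t *\<^sub>R w) = t *\<^sub>R v k" for t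
    using linear_cmul vk by metis
  have dl: "((\<lambda>t. coords c x + t *\<^sub>R w) has_derivative (\<lambda>t. t *\<^sub>R w)) (at 0)"
    by (auto intro!: derivative_eq_intros)
  have dt: "(transition c k has_derivative FD (transition c k) (coords c x)) (at (coords c x + 0 *\<^sub>R w))"
    using FD_works[OF transition_differentiable[OF atl ck c(2) x(2)]] by simp
  have d\<gamma>: "(\<gamma> has_derivative (\<lambda>t. t *\<^sub>R v k)) (at 0)"
    using has_derivative_compose[OF dl dt] unfolding lc \<gamma>_def[abs_def] .
  have \<gamma>0: "\<gamma> 0 = coords k x" using tr0 by (simp add: \<gamma>_def)
  have "((\<lambda>t. \<rho> (\<gamma> t)) has_derivative (\<lambda>t. \<rho> (t *\<^sub>R v k))) (at 0)"
    using bounded_linear.has_derivative[OF linear_conv_bounded_linear[THEN iffD1, OF lin] d\<gamma>] .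
  moreover have "(j has_derivative FD j (\<rho> (coords k x))) (at (\<rho> (\<gamma> 0)))"
    using smooth_on_has_derivative[OF U(2) b(1)] \<gamma>0 by simp
  ultimately have dj: "((\<lambda>t. j (\<rho> (\<gamma> t))) has_derivative (\<lambda>t. FD j (\<rho> (coords k x)) (\<rho> (t *\<^sub>R v k)))) (at 0)"
    by (rule has_derivative_compose)
  \<comment> \<open>A point of the graph is recovered from its projection, because
    \<open>\<rho>\<close> inverts \<open>j\<close> on \<open>U\<close>.\<close>
  have "\<gamma> t = j (\<rho> (\<gamma> t))" if "t \<in> T" for t
    using on_graph[OF that] U(3) by auto
  from has_derivative_transform_within_open[OF d\<gamma> \<open>open T\<close> \<open>0 \<in> T\<close> this]
  have "(\<lambda>t. t *\<^sub>R v k) = (\<lambda>t. FD j (\<rho> (coords k x)) (\<rho> (t *\<^sub>R v k)))"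
    using has_derivative_unique[OF _ dj] by blast
  from fun_cong[OF this, of 1] show ?thesis by simp
qed

lemma coords_image_graph:
  assumes S: "\<And>x. x \<in> chart_dom k \<Longrightarrow> x \<in> S \<longleftrightarrow> (\<exists>b\<in>U. coords k x = j b)"
    and j: "\<And>b. b \<in> U \<Longrightarrow> j b \<in> chart_img k"
  shows "coords k ` (chart_dom k \<inter> S) = j ` U"
proof (intro subset_antisym subsetI)
  fix y assume "y \<in> coords k ` (chart_dom k \<inter> S)"
  then obtain x where "y = coords k x" "x \<in> chart_dom k \<inter> S" by (elim imageE)
  then have "\<exists>b\<in>U. y = j b" using S[of x] by simp
  then show "y \<in> j ` U" by (elim bexE) (rule image_eqI)
next
  fix y assume "y \<in> j ` U"
  then obtain b where b: "y = j b" "b \<in> U" by (elim imageE)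
  then have y: "y \<in> chart_img k" using j by simp
  have "chart_inv k y \<in> S"
    unfolding S[OF chart_inv_in_dom[OF y]] coords_chart_inv[OF y] using b by (intro bexI)
  then have "chart_inv k y \<in> chart_dom k \<inter> S" using chart_inv_in_dom[OF y] by (intro IntI)
  then show "y \<in> coords k ` (chart_dom k \<inter> S)"
    by (rule image_eqI[where x = "chart_inv k y", rotated]) (rule coords_chart_inv[OF y, symmetric])
qed

text \<open>By the preceding lemma every tangent vector of \<open>S\<close> reads
  \<open>FD (j i) b v\<close> in the chart \<open>K i\<close>, so the isotropy condition shrinks to
  \<open>kill\<close>, the vanishing of the pullback of \<open>\<theta>\<close> under the
  parametrisation. The projection and its section are common to all charts, while the domains and
  the graph maps vary.\<close>

lemma legendrian_graph:
  fixes \<rho> :: "'e::euclidean_space \<Rightarrow> 'f::euclidean_space" and A :: "('a, 'e) chart set"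
  assumes contact: "contact_manifold A (uniform_form A \<theta>)"
    and dim: "DIM('e) = 2 * DIM('f) + 1"
    and lin: "linear \<rho>" "linear \<iota>" "\<And>b. \<rho> (\<iota> b) = b"
    and S: "S \<subseteq> points A" "\<And>i. i \<in> I \<Longrightarrow> K i \<in> A" "\<And>x. x \<in> S \<Longrightarrow> \<exists>i\<in>I. x \<in> chart_dom (K i)"
    and U: "\<And>i. i \<in> I \<Longrightarrow> open (U i)" "\<And>i. i \<in> I \<Longrightarrow> smooth_on (U i) (j i)"
      "\<And>i b. i \<in> I \<Longrightarrow> b \<in> U i \<Longrightarrow> \<rho> (j i b) = b" "\<And>i. i \<in> I \<Longrightarrow> chart_img (K i) = \<rho> -` U i"
    and graph: "\<And>i. i \<in> I \<Longrightarrow> coords (K i) ` (chart_dom (K i) \<inter> S) = j i ` U i"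
    and kill: "\<And>i b v. i \<in> I \<Longrightarrow> b \<in> U i \<Longrightarrow> \<theta> (j i b) \<bullet> FD (j i) b v = 0"
  shows "legendrian_submanifold A (uniform_form A \<theta>) S"
proof -
  have A: "smooth_atlas A" and form: "\<And>x. x \<in> points A \<Longrightarrow> uniform_form A \<theta> x \<in> cotangent_space A x"
    using contact unfolding contact_manifold_def smooth_manifold_def smooth_one_form_def by blast+
  have "submanifold A (DIM('f)) S"
    unfolding submanifold_def
  proof (intro conjI ballI S(1))
    fix x assume "x \<in> S"
    then obtain i where k: "i \<in> I" "x \<in> chart_dom (K i)" using S(3) by blast
    obtain c where "slice_chart A (DIM('f)) S c (range \<iota>)" "chart_dom c = chart_dom (K i)"
      by (rule graph_slice_chart[OF A S(2)[OF k(1)] lin U(1)[OF k(1)] U(2)[OF k(1)] U(3)[OF k(1)] U(4)[OF k(1)] graph[OF k(1)]])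
    with k(2) have "slice_chart A (DIM('f)) S c (range \<iota>) \<and> x \<in> chart_dom c" by simp
    then show "\<exists>c W. slice_chart A (DIM('f)) S c W \<and> x \<in> chart_dom c" by (intro exI)
  qed
  moreover have "pairing A x (uniform_form A \<theta> x) v = 0"
    if x: "x \<in> S" and v: "v \<in> submanifold_tangent_space A (DIM('f)) S x" for x v
  proof -
    obtain i where k: "i \<in> I" "x \<in> chart_dom (K i)" using S(3)[OF x] by blast
    note kA = S(2)[OF k(1)]
    have "coords (K i) x \<in> j i ` U i" unfolding graph[OF k(1), symmetric] using x k(2) by simp
    then obtain b where b: "coords (K i) x = j i b" "b \<in> U i" by (elim imageE)
    have "v (K i) = FD (j i) b (\<rho> (v (K i)))"
      using submanifold_tangent_in_graph[OF kA lin(1) U(1)[OF k(1)] U(2)[OF k(1)] U(3)[OF k(1)] graph[OF k(1)] x k(2) v]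
        b U(3)[OF k(1) b(2)] by simp
    then have "\<theta> (coords (K i) x) \<bullet> v (K i) = 0" using kill[OF k(1) b(2), of "\<rho> (v (K i))"] b(1) by simp
    moreover have "v \<in> tangent_space A x" using v unfolding submanifold_tangent_space_def by blast
    from pairing_eq[OF form[OF subsetD[OF S(1) x]] this kA k(2)]
    have "pairing A x (uniform_form A \<theta> x) v = \<theta> (coords (K i) x) \<bullet> v (K i)"
      using kA k(2) by (simp add: uniform_form_def charts_at_iff)
    ultimately show ?thesis by simp
  qed
  ultimately show ?thesis
    unfolding legendrian_submanifold_def using contact dim by (intro conjI exI[of _ "DIM('f)"] ballI)
qed


section \<open>Derivatives of the induced coordinate changes\<close>

lemma FD_partials:
  fixes g :: "'a::euclidean_space \<times> 'b::euclidean_space \<Rightarrow> 'c::euclidean_space"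
  assumes "g differentiable at (x, y)"
  shows "FD g (x, y) (a, b) = FD (\<lambda>s. g (s, y)) x a + FD (\<lambda>t. g (x, t)) y b"
  unfolding has_derivative_partials[OF assms, THEN FD_eq]
  using linear_add[OF FD_linear[OF assms], of "(a, 0)" "(0, b)"] by simp

lemma FD_compose_linear:
  fixes h :: "'b::euclidean_space \<Rightarrow> 'c::real_normed_vector"
  assumes "linear h" "g differentiable at x"
  shows "FD (\<lambda>x. h (g x)) x v = h (FD g x v)"
  using FD_eq[OF bounded_linear.has_derivative[OF linear_conv_bounded_linear[THEN iffD1, OF assms(1)] FD_works[OF assms(2)]]]
  by simp

lemma FD_of_linear:
  fixes h :: "'b::euclidean_space \<Rightarrow> 'c::real_normed_vector"
  shows "linear h \<Longrightarrow> FD h x = h"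
  using FD_eq[OF linear_imp_has_derivative] .

text \<open>The second derivative of \<open>\<phi>\<close>, kept in asymmetric form:
  \<open>a\<close> moves the base point, \<open>w\<close> is the vector held fixed. The two slots
  arise from different sources, and exchanging them through \<open>hess_commute\<close> is where
  smoothness of the coordinate changes enters.\<close>

definition hess :: "('a::euclidean_space \<Rightarrow> 'b::euclidean_space) \<Rightarrow> 'a \<Rightarrow> 'a \<Rightarrow> 'a \<Rightarrow> 'b" where
  "hess \<phi> q a w = FD (\<lambda>y. FD \<phi> y w) q a"

lemma hess_commute: "open S \<Longrightarrow> smooth_on S \<phi> \<Longrightarrow> q \<in> S \<Longrightarrow> hess \<phi> q a w = hess \<phi> q w a"
  unfolding hess_def by (rule symmetric_second_derivative)

lemma smooth_on_tangent_map:
  fixes \<phi> :: "'a::euclidean_space \<Rightarrow> 'b::euclidean_space"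
  assumes "open S" "smooth_on S \<phi>"
  shows "smooth_on (S \<times> UNIV) (\<lambda>(q, v). FD \<phi> q v)"
proof -
  have op: "open (S \<times> (UNIV :: 'a set))" using assms(1) by (simp add: open_Times)
  have "smooth_on (S \<times> UNIV) (\<lambda>y. FD \<phi> (fst y) (snd y))"
    by (rule smooth_on_family_apply[OF op assms(1) _ smooth_on_fst[OF op smooth_on_ident]
          smooth_on_snd[OF op smooth_on_ident] smooth_on_FD[OF assms(2)]])
       (use FD_linear smooth_on_differentiable[OF assms(2)] in auto)
  then show ?thesis by (simp add: case_prod_beta')
qed

text \<open>The map is linear in the fibre, so varying \<open>v\<close> contributes
  \<open>FD \<phi> q b\<close> and varying \<open>q\<close> contributes the second
  derivative.\<close>

lemma FD_tangent_map:
  fixes \<phi> :: "'a::euclidean_space \<Rightarrow> 'b::euclidean_space"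
  assumes "open S" "smooth_on S \<phi>" "q \<in> S"
  shows "FD (\<lambda>(q, v). FD \<phi> q v) (q, v) (a, b) = hess \<phi> q a v + FD \<phi> q b"
proof -
  have "(\<lambda>(q, v). FD \<phi> q v) differentiable at (q, v)"
    using smooth_on_differentiable[OF smooth_on_tangent_map[OF assms(1,2)]] assms(3) by simp
  from FD_partials[OF this, of a b] show ?thesis
    using FD_of_linear[OF FD_linear[OF smooth_on_differentiable[OF assms(2,3)]]] by (simp add: hess_def)
qed

lemma overlap_ext_tangent_chart:
  "smooth_atlas A \<Longrightarrow> c \<in> A \<Longrightarrow>
    overlap (ext_tangent_chart A c) (ext_tangent_chart A c') = (overlap c c' \<times> UNIV) \<times> UNIV"
  by (simp only: overlap_line_chart overlap_tangent_chart)

lemma overlap_ext_cotangent_chart: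
  "smooth_atlas A \<Longrightarrow> c \<in> A \<Longrightarrow>
    overlap (ext_cotangent_chart A c) (ext_cotangent_chart A c') = (overlap c c' \<times> UNIV) \<times> UNIV"
  by (simp only: overlap_line_chart overlap_cotangent_chart)

lemma ext_chart_in_bundle:
  "c \<in> A \<Longrightarrow> ext_tangent_chart A c \<in> ext_tangent_bundle A"
  "c \<in> A \<Longrightarrow> ext_cotangent_chart A c \<in> ext_cotangent_bundle A"
  by (simp_all add: times_line_def tangent_bundle_def cotangent_bundle_def)

lemma smooth_manifold_ext_bundle:
  "smooth_manifold A \<Longrightarrow> smooth_manifold (ext_tangent_bundle A)"
  "smooth_manifold A \<Longrightarrow> smooth_manifold (ext_cotangent_bundle A)"
  by (simp_all add: smooth_manifold_times_line smooth_manifold_tangent_bundle smooth_manifold_cotangent_bundle)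

lemma smooth_atlas_ext_bundle:
  assumes "smooth_atlas A"
  shows "smooth_atlas (ext_tangent_bundle A)" "smooth_atlas (ext_cotangent_bundle A)"
  using bundle_cocycle.smooth_atlas_total[OF bundle_cocycle_tangent[OF assms]]
    bundle_cocycle.smooth_atlas_total[OF bundle_cocycle_cotangent[OF assms]]
  by (simp_all add: smooth_atlas_times_line tangent_bundle_def cotangent_bundle_def
      tangent_chart_eq[OF assms] cotangent_chart_eq[OF assms])

lemma ext_tangent_transition:
  assumes A: "smooth_atlas A" "c \<in> A" "c' \<in> A" and q: "q \<in> overlap c c'"
  shows "transition (ext_tangent_chart A c) (ext_tangent_chart A c') ((q, v), z)
    = ((transition c c' q, FD (transition c c') q v), z)"
proof -
  let ?k = "ext_tangent_chart A c" and ?k' = "ext_tangent_chart A c'"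
  have "((q, v), z) \<in> overlap ?k ?k'" using q unfolding overlap_ext_tangent_chart[OF A(1,2)] by simp
  then obtain y where y: "y \<in> chart_dom ?k \<inter> chart_dom ?k'" "((q, v), z) = coords ?k y" by (elim imageE)
  obtain x V t where y_eq: "y = ((x, V), t)" by (metis surj_pair)
  have x: "x \<in> chart_dom c" "x \<in> chart_dom c'" "V \<in> tangent_space A x" "q = coords c x" "v = V c" "z = t"
    using y unfolding y_eq by simp_all
  have "transition ?k ?k' (coords ?k y) = coords ?k' y"
    using y(1) by (intro transition_coords[OF atlas_inj[OF smooth_atlas_ext_bundle(1)[OF A(1)] ext_chart_in_bundle(1)[OF A(2)]]]) simp
  then have "transition ?k ?k' ((q, v), z) = coords ?k' y" using y(2) by simp
  also have "\<dots> = ((coords c' x, V c'), t)" by (simp add: y_eq)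
  finally show ?thesis
    using tangent_spaceD[OF x(3) A(2) x(1) A(3) x(2)] transition_coords[OF atlas_inj[OF A(1,2)] x(1), of c'] x
    by simp
qed

lemma FD_ext_tangent_transition:
  assumes A: "smooth_atlas A" "c \<in> A" "c' \<in> A" and q: "q \<in> overlap c c'"
  shows "FD (transition (ext_tangent_chart A c) (ext_tangent_chart A c')) ((q, v), z) ((a, b), t)
    = ((FD (transition c c') q a, hess (transition c c') q a v + FD (transition c c') q b), t)"
proof -
  let ?k = "ext_tangent_chart A c" and ?k' = "ext_tangent_chart A c'" and ?\<phi> = "transition c c'"
  let ?S = "(overlap c c' \<times> UNIV) \<times> UNIV :: (('b \<times> 'b) \<times> real) set"
  note o = atlas_open_overlap[OF A] and s = atlas_smooth_transition[OF A]
  have d1: "((\<lambda>y. ?\<phi> (fst (fst y))) has_derivative (\<lambda>\<delta>. FD ?\<phi> q (fst (fst \<delta>)))) (at ((q, v), z))"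
    by (rule has_derivative_compose[where g' = "FD ?\<phi> q" and f' = "\<lambda>\<delta>. fst (fst \<delta>)"])
       (use smooth_on_has_derivative[OF s q] in \<open>auto intro!: derivative_eq_intros\<close>)
  have "(\<lambda>(q, v). FD ?\<phi> q v) differentiable at (q, v)"
    using smooth_on_differentiable[OF smooth_on_tangent_map[OF o s], of "(q, v)"] q by simp
  from FD_works[OF this]
  have d2: "((\<lambda>y. (\<lambda>(q, v). FD ?\<phi> q v) (fst y)) has_derivative (\<lambda>\<delta>. FD (\<lambda>(q, v). FD ?\<phi> q v) (q, v) (fst \<delta>))) (at ((q, v), z))"
    by (intro has_derivative_compose[where g' = "FD (\<lambda>(q, v). FD ?\<phi> q v) (q, v)" and f' = fst])
       (auto intro!: derivative_eq_intros)
  have d: "((\<lambda>y. ((?\<phi> (fst (fst y)), (\<lambda>(q, v). FD ?\<phi> q v) (fst y)), snd y)) has_derivative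
      (\<lambda>\<delta>. ((FD ?\<phi> q (fst (fst \<delta>)), FD (\<lambda>(q, v). FD ?\<phi> q v) (q, v) (fst \<delta>)), snd \<delta>))) (at ((q, v), z))"
    by (intro has_derivative_Pair d1 d2 has_derivative_snd has_derivative_ident)
  have e: "((?\<phi> (fst (fst y)), (\<lambda>(q, v). FD ?\<phi> q v) (fst y)), snd y) = transition ?k ?k' y" if "y \<in> ?S" for y
  proof -
    obtain q v z where y: "y = ((q, v), z)" by (metis surj_pair)
    have "q \<in> overlap c c'" using that unfolding y by simp
    from ext_tangent_transition[OF A this, of v z] show ?thesis by (simp add: y)
  qed
  have S: "open ?S" "((q, v), z) \<in> ?S" using o q by (simp_all add: open_Times)
  have "(transition ?k ?k' has_derivative
      (\<lambda>\<delta>. ((FD ?\<phi> q (fst (fst \<delta>)), FD (\<lambda>(q, v). FD ?\<phi> q v) (q, v) (fst \<delta>)), snd \<delta>))) (at ((q, v), z))"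
    by (rule has_derivative_transform_within_open[OF d S e])
  from FD_eq[OF this] show ?thesis by (simp add: FD_tangent_map[OF o s q])
qed

text \<open>The new momentum \<open>P\<close> is characterised only by its pairing with transported
  vectors. That is enough for all later uses and avoids an inverse transpose.\<close>

lemma ext_cotangent_transition:
  assumes A: "smooth_atlas A" "c \<in> A" "c' \<in> A" and q: "q \<in> overlap c c'"
  defines "\<kappa> \<equiv> transition (ext_cotangent_chart A c) (ext_cotangent_chart A c')"
  shows "fst (fst (\<kappa> ((q, p), z))) = transition c c' q"
    and "snd (\<kappa> ((q, p), z)) = z"
    and "p \<bullet> w = snd (fst (\<kappa> ((q, p), z))) \<bullet> FD (transition c c') q w"
proof -
  let ?k = "ext_cotangent_chart A c" and ?k' = "ext_cotangent_chart A c'"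
  have "((q, p), z) \<in> overlap ?k ?k'" using q unfolding overlap_ext_cotangent_chart[OF A(1,2)] by simp
  then obtain y where y: "y \<in> chart_dom ?k \<inter> chart_dom ?k'" "((q, p), z) = coords ?k y" by (elim imageE)
  obtain x \<xi> t where y_eq: "y = ((x, \<xi>), t)" by (metis surj_pair)
  have x: "x \<in> chart_dom c" "x \<in> chart_dom c'" "\<xi> \<in> cotangent_space A x" "q = coords c x" "p = \<xi> c" "z = t"
    using y unfolding y_eq by simp_all
  have "transition ?k ?k' (coords ?k y) = coords ?k' y"
    using y(1) by (intro transition_coords[OF atlas_inj[OF smooth_atlas_ext_bundle(2)[OF A(1)] ext_chart_in_bundle(2)[OF A(2)]]]) simp
  then have "\<kappa> ((q, p), z) = coords ?k' y" using y(2) by (simp add: \<kappa>_def)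
  also have "\<dots> = ((coords c' x, \<xi> c'), t)" by (simp add: y_eq)
  finally have *: "\<kappa> ((q, p), z) = ((coords c' x, \<xi> c'), t)" .
  show "fst (fst (\<kappa> ((q, p), z))) = transition c c' q" "snd (\<kappa> ((q, p), z)) = z"
    using * transition_coords[OF atlas_inj[OF A(1,2)] x(1), of c'] x by simp_all
  show "p \<bullet> w = snd (fst (\<kappa> ((q, p), z))) \<bullet> FD (transition c c') q w"
    using * cotangent_spaceD[OF x(3) A(2) x(1) A(3) x(2), of w] x by simp
qed

text \<open>Implicit differentiation of the law
  \<open>p \<bullet> w = P \<bullet> FD \<phi> q w\<close> with \<open>w\<close> fixed: the product
  rule on the right gives one term with the varied momentum and one with the second derivative of
  \<open>\<phi>\<close>.\<close>

lemma FD_ext_cotangent_transition: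
  assumes A: "smooth_atlas A" "c \<in> A" "c' \<in> A" and q: "q \<in> overlap c c'"
  defines "\<kappa> \<equiv> transition (ext_cotangent_chart A c) (ext_cotangent_chart A c')"
  shows "fst (fst (FD \<kappa> ((q, p), z) ((a, b), t))) = FD (transition c c') q a"
    and "snd (FD \<kappa> ((q, p), z) ((a, b), t)) = t"
    and "b \<bullet> w = snd (fst (FD \<kappa> ((q, p), z) ((a, b), t))) \<bullet> FD (transition c c') q w
      + snd (fst (\<kappa> ((q, p), z))) \<bullet> hess (transition c c') q a w"
proof -
  let ?\<phi> = "transition c c'" and ?y = "((q, p), z)"
  let ?S = "(overlap c c' \<times> UNIV) \<times> UNIV :: (('b \<times> 'b) \<times> real) set"
  note o = atlas_open_overlap[OF A] and s = atlas_smooth_transition[OF A]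
  have S: "open ?S" "?y \<in> ?S" using o q by (simp_all add: open_Times)
  \<comment> \<open>Differentiability of the momentum component is inherited from the cotangent
    atlas; no formula for it is at hand.\<close>
  have "smooth_on ?S \<kappa>"
    using atlas_smooth_transition[OF smooth_atlas_ext_bundle(2)[OF A(1)] ext_chart_in_bundle(2)[OF A(2)] ext_chart_in_bundle(2)[OF A(3)]]
    unfolding \<kappa>_def overlap_ext_cotangent_chart[OF A(1,2)] .
  from smooth_on_has_derivative[OF this S(2)] have d\<kappa>: "(\<kappa> has_derivative FD \<kappa> ?y) (at ?y)" .
  have \<kappa>: "fst (fst (\<kappa> y)) = ?\<phi> (fst (fst y))" "snd (\<kappa> y) = snd y"
    "snd (fst y) \<bullet> w = snd (fst (\<kappa> y)) \<bullet> FD ?\<phi> (fst (fst y)) w" if "y \<in> ?S" for y w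
  proof -
    obtain q p z where y: "y = ((q, p), z)" by (metis surj_pair)
    have "q \<in> overlap c c'" using that unfolding y by simp
    from ext_cotangent_transition[OF A this, where p = p and z = z]
    show "fst (fst (\<kappa> y)) = ?\<phi> (fst (fst y))" "snd (\<kappa> y) = snd y"
      "snd (fst y) \<bullet> w = snd (fst (\<kappa> y)) \<bullet> FD ?\<phi> (fst (fst y)) w"
      by (simp_all add: y \<kappa>_def)
  qed
  have d\<phi>: "((\<lambda>y. g (fst (fst y))) has_derivative (\<lambda>\<delta>. FD g q (fst (fst \<delta>)))) (at ?y)"
    if "smooth_on (overlap c c') g" for g :: "'b \<Rightarrow> 'b"
    by (rule has_derivative_compose[where g' = "FD g q" and f' = "\<lambda>\<delta>. fst (fst \<delta>)"])
       (use smooth_on_has_derivative[OF that q] in \<open>auto intro!: derivative_eq_intros\<close>)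
  have "((\<lambda>y. fst (fst (\<kappa> y))) has_derivative (\<lambda>\<delta>. FD ?\<phi> q (fst (fst \<delta>)))) (at ?y)"
    by (rule has_derivative_transform_within_open[OF d\<phi>[OF s] S]) (simp add: \<kappa>(1))
  from has_derivative_unique[OF has_derivative_fst[OF has_derivative_fst[OF d\<kappa>]] this]
  show "fst (fst (FD \<kappa> ?y ((a, b), t))) = FD ?\<phi> q a" by (metis fst_conv)
  have "((\<lambda>y. snd (\<kappa> y)) has_derivative (\<lambda>\<delta>. snd \<delta>)) (at ?y)"
    by (rule has_derivative_transform_within_open[OF has_derivative_snd[OF has_derivative_ident] S]) (simp add: \<kappa>(2))
  from has_derivative_unique[OF has_derivative_snd[OF d\<kappa>] this]
  show "snd (FD \<kappa> ?y ((a, b), t)) = t" by (metis snd_conv)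
  have dR: "((\<lambda>y. snd (fst (\<kappa> y)) \<bullet> FD ?\<phi> (fst (fst y)) w) has_derivative
      (\<lambda>\<delta>. snd (fst (\<kappa> ?y)) \<bullet> FD (\<lambda>q. FD ?\<phi> q w) q (fst (fst \<delta>)) + snd (fst (FD \<kappa> ?y \<delta>)) \<bullet> FD ?\<phi> (fst (fst ?y)) w)) (at ?y)"
    by (intro has_derivative_inner has_derivative_snd has_derivative_fst d\<kappa> d\<phi> smooth_on_FD s)
  have dL: "((\<lambda>y. snd (fst y) \<bullet> w) has_derivative (\<lambda>\<delta>. snd (fst \<delta>) \<bullet> w)) (at ?y)"
    by (auto intro!: derivative_eq_intros)
  \<comment> \<open>Both sides of the implicit law agree on an open set, so their derivatives
    agree.\<close>
  from fun_cong[OF has_derivative_unique[OF dL has_derivative_transform_within_open[OF dR S \<kappa>(3)[symmetric]]], of "((a, b), t)"]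
  show "b \<bullet> w = snd (fst (FD \<kappa> ?y ((a, b), t))) \<bullet> FD ?\<phi> q w + snd (fst (\<kappa> ?y)) \<bullet> hess ?\<phi> q a w"
    by (simp add: hess_def)
qed


text \<open>The base coordinates change as on T*Q x R, and the velocities by the derivative of that
  change. The law of \<open>p'\<close> thereby picks up the inhomogeneous term
  \<open>P \<bullet> hess \<phi> q q' w\<close>, the one that has to cancel in every later
  invariance proof.\<close>

lemma tulczyjew_change:
  assumes A: "smooth_atlas A" "c \<in> A" "c' \<in> A"
    and x: "x \<in> chart_dom (tulczyjew_chart A c)" "x \<in> chart_dom (tulczyjew_chart A c')"
    and X: "coords (tulczyjew_chart A c) x = ((((q, p), z), ((q', p'), z')), u)"
      "coords (tulczyjew_chart A c') x = ((((Q, P), Z), ((Q', P'), Z')), U)"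
  defines "\<phi> \<equiv> transition c c'"
  shows "q \<in> overlap c c'" "Q = \<phi> q" "p \<bullet> w = P \<bullet> FD \<phi> q w" "Z = z" "Q' = FD \<phi> q q'"
    "p' \<bullet> w = P' \<bullet> FD \<phi> q w + P \<bullet> hess \<phi> q q' w" "Z' = z'" "U = u"
proof -
  let ?l = "ext_cotangent_chart A c" and ?l' = "ext_cotangent_chart A c'"
  note atlB = smooth_atlas_ext_bundle(2)[OF A(1)] and lA = ext_chart_in_bundle(2)[OF A(2)] and lA' = ext_chart_in_bundle(2)[OF A(3)]
  obtain m \<xi> t V u0 where x_eq: "x = ((((m, \<xi>), t), V), u0)" by (metis surj_pair)
  let ?y = "((m, \<xi>), t)"
  have y: "?y \<in> chart_dom ?l" "?y \<in> chart_dom ?l'" and V: "V \<in> tangent_space (ext_cotangent_bundle A) ?y"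
    using x unfolding x_eq by simp_all
  have m: "m \<in> chart_dom c" "m \<in> chart_dom c'" "\<xi> \<in> cotangent_space A m"
    using y by simp_all
  have X1: "q = coords c m" "p = \<xi> c" "z = t" "V ?l = ((q', p'), z')" "u = u0"
    and X2: "Q = coords c' m" "P = \<xi> c'" "Z = t" "V ?l' = ((Q', P'), Z')" "U = u0"
    using X unfolding x_eq by simp_all
  show q: "q \<in> overlap c c'" unfolding X1 by (rule coords_in_overlap[OF m(1,2)])
  show "Q = \<phi> q" unfolding X1 X2 \<phi>_def by (rule transition_coords[OF atlas_inj[OF A(1,2)] m(1), symmetric])
  show "p \<bullet> w = P \<bullet> FD \<phi> q w"
    unfolding X1 X2 \<phi>_def by (rule cotangent_spaceD[OF m(3) A(2) m(1) A(3) m(2)])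
  show "Z = z" "U = u" by (simp_all add: X1 X2)
  have ly: "coords ?l ?y = ((q, p), z)" "coords ?l' ?y = ((Q, P), Z)" by (simp_all add: X1 X2)
  have tr: "transition ?l ?l' ((q, p), z) = ((Q, P), Z)"
    using transition_coords[OF atlas_inj[OF atlB lA] y(1), of ?l'] unfolding ly .
  have FV: "FD (transition ?l ?l') ((q, p), z) ((q', p'), z') = ((Q', P'), Z')"
    using tangent_spaceD[OF V lA y(1) lA' y(2)] by (simp only: ly X1(4) X2(4))
  note d = FD_ext_cotangent_transition[OF A q, where p = p and z = z and a = q' and b = p' and t = z']
  show "Q' = FD \<phi> q q'" "Z' = z'" using d(1,2) by (simp_all add: FV \<phi>_def)
  show "p' \<bullet> w = P' \<bullet> FD \<phi> q w + P \<bullet> hess \<phi> q q' w"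
    using d(3)[of w] by (simp add: FV tr \<phi>_def)
qed


section \<open>The two contact manifolds\<close>

definition canonical_coeffs :: "('e::euclidean_space \<times> 'e) \<times> real \<Rightarrow> ('e \<times> 'e) \<times> real" where
  "canonical_coeffs = (\<lambda>((y, \<xi>), w). ((- \<xi>, 0), 1))"

definition tulczyjew_coeffs :: "'e::euclidean_space tulczyjew_model \<Rightarrow> 'e tulczyjew_model" where
  "tulczyjew_coeffs = (\<lambda>((((q, p), z), ((q', p'), z')), u). ((((- (p' + u *\<^sub>R p), 0), u), ((- p, 0), 1)), 0))"

lemma canonical_coeffs_apply: "canonical_coeffs ((y, \<xi>), w) = ((- \<xi>, 0), 1)"
  and tulczyjew_coeffs_apply: "tulczyjew_coeffs ((((q, p), z), ((q', p'), z')), u) =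
    ((((- (p' + u *\<^sub>R p), 0), u), ((- p, 0), 1)), 0)"
  by (simp_all add: canonical_coeffs_def tulczyjew_coeffs_def)

lemma canonical_contact_form_eq:
  "canonical_contact_form B = uniform_form (ext_cotangent_bundle B) canonical_coeffs"
  by (rule ext) (simp only: canonical_contact_form_def uniform_form_def canonical_coeffs_def case_prod_beta)

lemma tulczyjew_contact_form_eq:
  "tulczyjew_contact_form A = uniform_form (tulczyjew_bundle A) tulczyjew_coeffs"
  by (rule ext) (simp only: tulczyjew_contact_form_def uniform_form_def tulczyjew_coeffs_def case_prod_beta)

lemma ext_cotangent_bundleE:
  assumes "k \<in> ext_cotangent_bundle A"
  obtains c where "c \<in> A" "k = ext_cotangent_chart A c"
  using assms unfolding times_line_def cotangent_bundle_def by blast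

lemma ext_tangent_bundleE:
  assumes "k \<in> ext_tangent_bundle A"
  obtains c where "c \<in> A" "k = ext_tangent_chart A c"
  using assms unfolding times_line_def tangent_bundle_def by blast

text \<open>The form has no component in the momentum direction, so its invariance uses only the
  covector law and no second derivative. The theorem is stated for an arbitrary base because the
  canonical form is needed over T*Q x R.\<close>

theorem contact_manifold_ext_cotangent_bundle:
  fixes B :: "('a, 'e::euclidean_space) chart set"
  assumes B: "smooth_manifold B"
  shows "contact_manifold (ext_cotangent_bundle B) (canonical_contact_form B)"
  unfolding canonical_contact_form_eq
proof (rule contact_manifold_uniform_form)
  note atl = smooth_manifoldD(1)[OF B]
  show "smooth_manifold (ext_cotangent_bundle B)" by (rule smooth_manifold_ext_bundle(2)[OF B])
  show "odd (DIM(('e \<times> 'e) \<times> real))" by simp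
  have form: "canonical_coeffs = (\<lambda>y. ((- snd (fst y), 0), 1 :: real))"
    by (auto simp: canonical_coeffs_def case_prod_beta')
  show "smooth_on UNIV (canonical_coeffs :: ('e \<times> 'e) \<times> real \<Rightarrow> _)"
    unfolding form by (intro smooth_on_Pair smooth_on_minus smooth_on_snd smooth_on_fst smooth_on_ident smooth_on_const open_UNIV)
  show "canonical_coeffs y \<noteq> 0" for y :: "('e \<times> 'e) \<times> real"
    by (simp add: form prod_eq_iff)
  show "canonical_coeffs (coords k x) \<bullet> w = canonical_coeffs (coords k' x) \<bullet> FD (transition k k') (coords k x) w"
    if k: "k \<in> ext_cotangent_bundle B" "x \<in> chart_dom k" and k': "k' \<in> ext_cotangent_bundle B" "x \<in> chart_dom k'" for x k k' w
  proof -
    obtain c where c: "c \<in> B" "k = ext_cotangent_chart B c" using k(1) by (rule ext_cotangent_bundleE)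
    obtain c' where c': "c' \<in> B" "k' = ext_cotangent_chart B c'" using k'(1) by (rule ext_cotangent_bundleE)
    obtain m \<xi> t where x: "x = ((m, \<xi>), t)" by (metis surj_pair)
    obtain a b s where w: "w = ((a, b), s)" by (metis surj_pair)
    have m: "m \<in> chart_dom c" "m \<in> chart_dom c'" "\<xi> \<in> cotangent_space B m"
      using k(2) k'(2) unfolding c(2) c'(2) x by simp_all
    note FD_ext_cotangent_transition(1,2)[OF atl c(1) c'(1) coords_in_overlap[OF m(1,2)], where p = "\<xi> c" and z = t and a = a and b = b and t = s]
    then show ?thesis
      using cotangent_spaceD[OF m(3) c(1) m(1) c'(1) m(2), of a]
      by (simp add: x w c(2) c'(2) canonical_coeffs_apply inner_prod_def)
  qed
  have ed: "ext_deriv canonical_coeffs y v w = snd (fst w) \<bullet> fst (fst v) - snd (fst v) \<bullet> fst (fst w)"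
    for y v w :: "('e \<times> 'e) \<times> real"
  proof -
    have "(canonical_coeffs has_derivative (\<lambda>v. ((- snd (fst v), 0), 0 :: real))) (at y)"
      unfolding form by (auto intro!: derivative_eq_intros)
    from FD_eq[OF this] show ?thesis by (simp add: ext_deriv_def inner_prod_def)
  qed
  show "v = 0" if v: "canonical_coeffs y \<bullet> v = 0" and
    *: "\<And>w. canonical_coeffs y \<bullet> w = 0 \<Longrightarrow> ext_deriv canonical_coeffs y v w = 0"
    for y v :: "('e \<times> 'e) \<times> real"
  proof -
    obtain q p z where y: "y = ((q, p), z)" by (metis surj_pair)
    obtain a b s where v': "v = ((a, b), s)" by (metis surj_pair)
    \<comment> \<open>The test vectors must lie in the kernel of the form: a momentum variation does
      so by itself, whereas a position variation \<open>a'\<close> below needs the compensating last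
      entry \<open>p \<bullet> a'\<close>.\<close>
    have "b' \<bullet> a = 0" for b' using *[of "((0, b'), 0)"] by (simp add: ed canonical_coeffs_apply y v')
    then have a: "a = 0" by (metis inner_eq_zero_iff)
    have "b \<bullet> a' = 0" for a' using *[of "((a', 0), p \<bullet> a')"] by (simp add: ed canonical_coeffs_apply y v' a)
    then have "b = 0" by (metis inner_eq_zero_iff)
    then show ?thesis using v a by (simp add: canonical_coeffs_apply y v' zero_prod_def)
  qed
qed

lemma tulczyjew_coeffs_eq:
  "tulczyjew_coeffs = (\<lambda>X. ((((- (snd (fst (snd (fst X))) + snd X *\<^sub>R snd (fst (fst (fst X)))), 0), snd X),
     ((- snd (fst (fst (fst X))), 0), 1)), 0))"
  by (auto simp: tulczyjew_coeffs_def case_prod_beta')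

lemma smooth_on_tulczyjew_coeffs: "smooth_on UNIV tulczyjew_coeffs"
  unfolding tulczyjew_coeffs_eq
  by (intro smooth_on_Pair smooth_on_minus smooth_on_add smooth_on_scaleR smooth_on_snd smooth_on_fst
      smooth_on_ident smooth_on_const open_UNIV)

lemma FD_tulczyjew_coeffs:
  "FD tulczyjew_coeffs ((((q, p), z), ((q', p'), z')), u) ((((a, b), c), ((d, e), f)), g) =
     ((((- (e + (u *\<^sub>R b + g *\<^sub>R p)), 0), g), ((- b, 0), 0)), 0)"
proof -
  have "(tulczyjew_coeffs has_derivative (\<lambda>X. ((((- (snd (fst (snd (fst X))) + (u *\<^sub>R snd (fst (fst (fst X))) + snd X *\<^sub>R p)), 0), snd X),
     ((- snd (fst (fst (fst X))), 0), 0)), 0))) (at ((((q, p), z), ((q', p'), z')), u))"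
    unfolding tulczyjew_coeffs_eq by (auto intro!: derivative_eq_intros)
  from FD_eq[OF this] show ?thesis by simp
qed

text \<open>Under a coordinate change the summand \<open>- p' dq\<close> produces
  \<open>- P \<bullet> hess \<phi> q q' \<delta>q\<close>, and \<open>- p dq'\<close> must supply
  the same amount as \<open>- P \<bullet> hess \<phi> q \<delta>q q'\<close>. Symmetry of the second
  derivative makes them match.\<close>

theorem contact_manifold_tulczyjew:
  fixes A :: "('a, 'e::euclidean_space) chart set"
  assumes A: "smooth_manifold A"
  shows "contact_manifold (tulczyjew_bundle A) (tulczyjew_contact_form A)"
  unfolding tulczyjew_contact_form_eq
proof (rule contact_manifold_uniform_form)
  note atl = smooth_manifoldD(1)[OF A]
  note atlB = smooth_atlas_ext_bundle(2)[OF atl]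
  show "smooth_manifold (tulczyjew_bundle A)"
    by (intro smooth_manifold_ext_bundle A)
  show "odd (DIM('e tulczyjew_model))" by simp
  show "smooth_on UNIV (tulczyjew_coeffs :: 'e tulczyjew_model \<Rightarrow> _)"
    by (rule smooth_on_tulczyjew_coeffs)
  show "tulczyjew_coeffs y \<noteq> 0" for y :: "'e tulczyjew_model"
    by (simp add: tulczyjew_coeffs_eq prod_eq_iff)
  show "tulczyjew_coeffs (coords k x) \<bullet> w = tulczyjew_coeffs (coords k' x) \<bullet> FD (transition k k') (coords k x) w"
    if k: "k \<in> tulczyjew_bundle A" "x \<in> chart_dom k" and k': "k' \<in> tulczyjew_bundle A" "x \<in> chart_dom k'" for x k k' w
  proof -
    obtain l where l: "l \<in> ext_cotangent_bundle A" "k = ext_tangent_chart (ext_cotangent_bundle A) l" using k(1) by (rule ext_tangent_bundleE)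
    obtain l' where l': "l' \<in> ext_cotangent_bundle A" "k' = ext_tangent_chart (ext_cotangent_bundle A) l'" using k'(1) by (rule ext_tangent_bundleE)
    obtain c where c: "c \<in> A" "l = ext_cotangent_chart A c" using l(1) by (rule ext_cotangent_bundleE)
    obtain c' where c': "c' \<in> A" "l' = ext_cotangent_chart A c'" using l'(1) by (rule ext_cotangent_bundleE)
    obtain m \<xi> z V u where x: "x = ((((m, \<xi>), z), V), u)" by (metis surj_pair)
    obtain \<delta>q \<delta>p \<delta>z \<delta>q' \<delta>p' \<delta>z' \<delta>u where w: "w = ((((\<delta>q, \<delta>p), \<delta>z), ((\<delta>q', \<delta>p'), \<delta>z')), \<delta>u)" by (metis surj_pair)
    let ?y = "((m, \<xi>), z)" and ?a = "((\<delta>q, \<delta>p), \<delta>z)" and ?b = "((\<delta>q', \<delta>p'), \<delta>z')"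
    have y: "?y \<in> chart_dom l" "?y \<in> chart_dom l'"
      using k(2) k'(2) unfolding l(2) l'(2) x by simp_all
    have m: "m \<in> chart_dom c" "m \<in> chart_dom c'" "\<xi> \<in> cotangent_space A m"
      using y unfolding c(2) c'(2) by simp_all
    define \<phi> where "\<phi> = transition c c'"
    define \<kappa> where "\<kappa> = transition l l'"
    define q where "q = coords c m"
    obtain q' p' z' where Vl: "V l = ((q', p'), z')" by (metis surj_pair)
    obtain Q' P' Z' where Vl': "V l' = ((Q', P'), Z')" by (metis surj_pair)
    have q: "q \<in> overlap c c'" unfolding q_def by (rule coords_in_overlap[OF m(1,2)])
    note dct = FD_ext_cotangent_transition[OF atl c(1) c'(1) q, folded c(2) c'(2) \<kappa>_def \<phi>_def]
    have ly: "coords l ?y = ((q, \<xi> c), z)" "coords l' ?y = ((coords c' m, \<xi> c'), z)"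
      by (simp_all add: c(2) c'(2) q_def)
    have X: "coords k x = ((((q, \<xi> c), z), ((q', p'), z')), u)" "coords k' x = ((((coords c' m, \<xi> c'), z), ((Q', P'), Z')), u)"
      unfolding l(2) l'(2) x by (simp_all add: ly Vl Vl')
    note change = tulczyjew_change[OF atl c(1) c'(1), folded c(2) c'(2), folded l(2) l'(2) \<phi>_def, OF k(2) k'(2) X]
    let ?S = "(overlap c c' \<times> UNIV) \<times> UNIV :: (('e \<times> 'e) \<times> real) set"
    have ov: "overlap l l' = ?S" unfolding c(2) c'(2) by (rule overlap_ext_cotangent_chart[OF atl c(1)])
    have S: "open ?S" "((q, \<xi> c), z) \<in> ?S"
      using atlas_open_overlap[OF atl c(1) c'(1)] q by (simp_all add: open_Times)
    have s\<kappa>: "smooth_on ?S \<kappa>"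
      using atlas_smooth_transition[OF atlB l(1) l'(1)] unfolding ov \<kappa>_def .
    let ?G = "\<lambda>y. FD \<kappa> y (V l)"
    note dG = smooth_on_differentiable[OF smooth_on_FD[OF s\<kappa>] S(2)]
    \<comment> \<open>The form has no dp' component, so of the second derivative of the cotangent
      transition only the position and \<open>z\<close> components are needed. They come from
      differentiating the corresponding components of the first derivative, whose formulas are
      explicit.\<close>
    have h: "hess \<kappa> ((q, \<xi> c), z) ?a (V l) = FD ?G ((q, \<xi> c), z) ?a" by (simp add: hess_def)
    have fG: "FD (\<lambda>y. fst (fst (?G y))) ((q, \<xi> c), z) = FD (\<lambda>y. FD \<phi> (fst (fst y)) q') ((q, \<xi> c), z)"
    proof (rule FD_cong_open[OF S])
      show "fst (fst (?G y)) = FD \<phi> (fst (fst y)) q'" if "y \<in> ?S" for y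
      proof -
        obtain q1 p1 z1 where y1: "y = ((q1, p1), z1)" by (metis surj_pair)
        have "q1 \<in> overlap c c'" using that unfolding y1 by simp
        from FD_ext_cotangent_transition(1)[OF atl c(1) c'(1) this, folded c(2) c'(2) \<kappa>_def \<phi>_def]
        show ?thesis by (simp add: y1 Vl)
      qed
      show "(\<lambda>y. fst (fst (?G y))) differentiable at ((q, \<xi> c), z)"
        using differentiableI[OF has_derivative_fst[OF has_derivative_fst[OF FD_works[OF dG]]]] .
    qed
    have dG': "((\<lambda>y. FD \<phi> (fst (fst y)) q') has_derivative (\<lambda>\<delta>. FD (\<lambda>q. FD \<phi> q q') q (fst (fst \<delta>)))) (at ((q, \<xi> c), z))"
      by (rule has_derivative_compose[where g' = "FD (\<lambda>q. FD \<phi> q q') q" and f' = "\<lambda>\<delta>. fst (fst \<delta>)"])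
         (use smooth_on_has_derivative[OF smooth_on_FD[OF atlas_smooth_transition[OF atl c(1) c'(1)]] q]
           in \<open>auto simp: \<phi>_def intro!: derivative_eq_intros\<close>)
    have h1: "fst (fst (hess \<kappa> ((q, \<xi> c), z) ?a (V l))) = hess \<phi> q \<delta>q q'"
      using fun_cong[OF fG, of ?a]
      unfolding h FD_eq[OF has_derivative_fst[OF has_derivative_fst[OF FD_works[OF dG]]]] FD_eq[OF dG']
      by (simp add: hess_def)
    have sG: "FD (\<lambda>y. snd (?G y)) ((q, \<xi> c), z) = FD (\<lambda>y. z') ((q, \<xi> c), z)"
    proof (rule FD_cong_open[OF S])
      show "snd (?G y) = z'" if "y \<in> ?S" for y
      proof -
        obtain q1 p1 z1 where y1: "y = ((q1, p1), z1)" by (metis surj_pair)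
        have "q1 \<in> overlap c c'" using that unfolding y1 by simp
        from FD_ext_cotangent_transition(2)[OF atl c(1) c'(1) this, folded c(2) c'(2) \<kappa>_def \<phi>_def]
        show ?thesis by (simp add: y1 Vl)
      qed
      show "(\<lambda>y. snd (?G y)) differentiable at ((q, \<xi> c), z)"
        using differentiableI[OF has_derivative_snd[OF FD_works[OF dG]]] .
    qed
    have h2: "snd (hess \<kappa> ((q, \<xi> c), z) ?a (V l)) = 0"
      using fun_cong[OF sG, of ?a] unfolding h FD_eq[OF has_derivative_snd[OF FD_works[OF dG]]] by simp
    have "FD (transition k k') (coords k x) w =
        ((FD \<kappa> ((q, \<xi> c), z) ?a, hess \<kappa> ((q, \<xi> c), z) ?a (V l) + FD \<kappa> ((q, \<xi> c), z) ?b), \<delta>u)"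
      using FD_ext_tangent_transition[OF atlB l(1) l'(1) coords_in_overlap[OF y], of "V l" u ?a ?b \<delta>u]
      unfolding l(2) l'(2) x w ly \<kappa>_def by (simp add: ly)
    moreover have "hess \<phi> q \<delta>q q' = hess \<phi> q q' \<delta>q"
      unfolding \<phi>_def by (rule hess_commute[OF atlas_open_overlap[OF atl c(1) c'(1)] atlas_smooth_transition[OF atl c(1) c'(1)] q])
    ultimately show ?thesis
      using X change(3)[of \<delta>q] change(3)[of \<delta>q'] change(6)[of \<delta>q] dct(1,2)[where p = "\<xi> c" and z = z] h1 h2
      by (simp add: w tulczyjew_coeffs_apply inner_prod_def inner_add_left inner_add_right inner_diff_left)
  qed
  show "v = 0" if v: "tulczyjew_coeffs y \<bullet> v = 0" and
    *: "\<And>w. tulczyjew_coeffs y \<bullet> w = 0 \<Longrightarrow> ext_deriv tulczyjew_coeffs y v w = 0"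
    for y v :: "'e tulczyjew_model"
  proof -
    obtain q p z q' p' z' u where y: "y = ((((q, p), z), ((q', p'), z')), u)" by (metis surj_pair)
    obtain a b c d e f g where v': "v = ((((a, b), c), ((d, e), f)), g)" by (metis surj_pair)
    note s = ext_deriv_def FD_tulczyjew_coeffs tulczyjew_coeffs_apply y v' inner_add_left inner_diff_left
    \<comment> \<open>Each test vector lies in the kernel of the form, with the \<open>z'\<close>
      entry compensating where necessary, and isolates one component of \<open>v\<close>. The order
      matters, since later tests use the components already shown to vanish; \<open>f\<close> comes
      from \<open>v\<close> itself being in the kernel.\<close>
    have "e' \<bullet> a = 0" for e' using *[of "((((0, 0), 0), ((0, e'), 0)), 0)"] by (simp add: s)
    then have a: "a = 0" by (metis inner_eq_zero_iff)
    have "b' \<bullet> d = 0" for b' using *[of "((((0, b'), 0), ((0, 0), 0)), 0)"] by (simp add: s a)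
    then have d: "d = 0" by (metis inner_eq_zero_iff)
    have c: "c = 0" using *[of "((((0, 0), 0), ((0, 0), 0)), 1)"] by (simp add: s a d)
    have f: "f = 0" using v by (simp add: s a c d)
    \<comment> \<open>The entry \<open>- u\<close> for \<open>z'\<close> offsets the term
      \<open>u dz\<close> of the form.\<close>
    have g: "g = 0" using *[of "((((0, 0), 1), ((0, 0), - u)), 0)"] by (simp add: s a c d)
    have "b \<bullet> d' = 0" for d' using *[of "((((0, 0), 0), ((d', 0), p \<bullet> d')), 0)"] by (simp add: s a c d)
    then have b: "b = 0" by (metis inner_eq_zero_iff)
    have "e \<bullet> a' = 0" for a' using *[of "((((a', 0), 0), ((0, 0), (p' + u *\<^sub>R p) \<bullet> a')), 0)"]
      by (simp add: s a b c d g)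
    then have "e = 0" by (metis inner_eq_zero_iff)
    then show ?thesis by (simp add: v' a b c d f g zero_prod_def)
  qed
qed


section \<open>Coordinate changes on the three bundles of the triple\<close>

abbreviation base_point :: "((('a \<times> 'b) \<times> 'c) \<times> 'd) \<times> 'f \<Rightarrow> 'a" where
  "base_point x \<equiv> fst (fst (fst (fst x)))"

text \<open>Once a point has valid fibre components, which any single chart \<open>c0\<close>
  guarantees, its position relative to other induced charts depends on the base point in Q
  alone.\<close>

lemma triple_chart_dom_change:
  "x \<in> chart_dom (tulczyjew_chart A c0) \<Longrightarrow> x \<in> chart_dom (tulczyjew_chart A c) \<longleftrightarrow> base_point x \<in> chart_dom c"
  "x \<in> chart_dom (left_chart A c0) \<Longrightarrow> x \<in> chart_dom (left_chart A c) \<longleftrightarrow> base_point x \<in> chart_dom c"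
  "x \<in> chart_dom (right_chart A c0) \<Longrightarrow> x \<in> chart_dom (right_chart A c) \<longleftrightarrow> base_point x \<in> chart_dom c"
  by (simp_all only: tangent_chart_def cotangent_chart_def line_chart_def case_prod_beta fst_conv snd_conv
      mem_Times_iff mem_Collect_eq UNIV_I simp_thms)

lemma base_point_in_dom:
  "x \<in> chart_dom (tulczyjew_chart A c) \<Longrightarrow> base_point x \<in> chart_dom c"
  "y \<in> chart_dom (left_chart A c) \<Longrightarrow> base_point y \<in> chart_dom c"
  "y \<in> chart_dom (right_chart A c) \<Longrightarrow> base_point y \<in> chart_dom c"
  by (simp_all only: triple_chart_dom_change[symmetric])

lemma base_point_coords:
  "base_point (coords (tulczyjew_chart A c) x) = coords c (base_point x)"
  "base_point (coords (left_chart A c) x) = coords c (base_point x)"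
  "base_point (coords (right_chart A c) x) = coords c (base_point x)"
  by (simp_all only: tangent_chart_def cotangent_chart_def line_chart_def case_prod_beta fst_conv snd_conv)

lemma chart_img_triple:
  assumes "smooth_atlas A" "c \<in> A"
  shows "chart_img (ext_tangent_chart A c) = (chart_img c \<times> UNIV) \<times> UNIV"
    and "chart_img (tulczyjew_chart A c) = (((chart_img c \<times> UNIV) \<times> UNIV) \<times> UNIV) \<times> UNIV"
    and "chart_img (left_chart A c) = (((chart_img c \<times> UNIV) \<times> UNIV) \<times> UNIV) \<times> UNIV"
    and "chart_img (right_chart A c) = (((chart_img c \<times> UNIV) \<times> UNIV) \<times> UNIV) \<times> UNIV"
  by (simp_all only: chart_img_line_chart
      chart_img_tangent_chart[OF assms] chart_img_cotangent_chart[OF assms]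
      chart_img_tangent_chart[OF smooth_atlas_ext_bundle(2)[OF assms(1)] ext_chart_in_bundle(2)[OF assms(2)]]
      chart_img_cotangent_chart[OF smooth_atlas_ext_bundle(1)[OF assms(1)] ext_chart_in_bundle(1)[OF assms(2)]]
      chart_img_cotangent_chart[OF smooth_atlas_ext_bundle(2)[OF assms(1)] ext_chart_in_bundle(2)[OF assms(2)]])

text \<open>The last identity is the covector law on TQ x R tested on an arbitrary vector
  \<open>((a, b), t)\<close>. The second derivative enters through the transport of the velocity
  component \<open>b\<close>.\<close>

lemma left_change:
  assumes A: "smooth_atlas A" "c \<in> A" "c' \<in> A"
    and y: "y \<in> chart_dom (left_chart A c)" "y \<in> chart_dom (left_chart A c')"
    and Y: "coords (left_chart A c) y = ((((q, v), z), ((a0, b0), s0)), w0)"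
      "coords (left_chart A c') y = ((((Q, V), Z), ((A0, B0), S0)), W0)"
  defines "\<phi> \<equiv> transition c c'"
  shows "q \<in> overlap c c'" "Q = \<phi> q" "V = FD \<phi> q v" "Z = z" "W0 = w0"
    "a0 \<bullet> a + b0 \<bullet> b + s0 * t = A0 \<bullet> FD \<phi> q a + B0 \<bullet> (hess \<phi> q a v + FD \<phi> q b) + S0 * t"
proof -
  let ?l = "ext_tangent_chart A c" and ?l' = "ext_tangent_chart A c'"
  note atlB = smooth_atlas_ext_bundle(1)[OF A(1)] and lA = ext_chart_in_bundle(1)[OF A(2)] and lA' = ext_chart_in_bundle(1)[OF A(3)]
  obtain m V0 t0 \<Xi> u0 where y_eq: "y = ((((m, V0), t0), \<Xi>), u0)" by (metis surj_pair)
  let ?x = "((m, V0), t0)"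
  have x: "?x \<in> chart_dom ?l" "?x \<in> chart_dom ?l'" and \<Xi>: "\<Xi> \<in> cotangent_space (ext_tangent_bundle A) ?x"
    using y unfolding y_eq by simp_all
  have m: "m \<in> chart_dom c" "m \<in> chart_dom c'" "V0 \<in> tangent_space A m"
    using x by simp_all
  have Y1: "q = coords c m" "v = V0 c" "z = t0" "\<Xi> ?l = ((a0, b0), s0)" "w0 = u0"
    and Y2: "Q = coords c' m" "V = V0 c'" "Z = t0" "\<Xi> ?l' = ((A0, B0), S0)" "W0 = u0"
    using Y unfolding y_eq by simp_all
  show q: "q \<in> overlap c c'" unfolding Y1 by (rule coords_in_overlap[OF m(1,2)])
  show "Q = \<phi> q" unfolding Y1 Y2 \<phi>_def by (rule transition_coords[OF atlas_inj[OF A(1,2)] m(1), symmetric])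
  show "V = FD \<phi> q v" unfolding Y1 Y2 \<phi>_def by (rule tangent_spaceD[OF m(3) A(2) m(1) A(3) m(2)])
  show "Z = z" "W0 = w0" by (simp_all add: Y1 Y2)
  have lx: "coords ?l ?x = ((q, v), z)" by (simp add: Y1)
  show "a0 \<bullet> a + b0 \<bullet> b + s0 * t = A0 \<bullet> FD \<phi> q a + B0 \<bullet> (hess \<phi> q a v + FD \<phi> q b) + S0 * t"
    using cotangent_spaceD[OF \<Xi> lA x(1) lA' x(2), of "((a, b), t)"]
    unfolding lx FD_ext_tangent_transition[OF A q] Y1(4) Y2(4) by (simp add: \<phi>_def)
qed

text \<open>Here the tested vector has a momentum component, whose image \<open>\<beta>\<close>
  under the coordinate change is known only through pairings; hence the existential
  statement.\<close>

lemma right_change: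
  assumes A: "smooth_atlas A" "c \<in> A" "c' \<in> A"
    and y: "y \<in> chart_dom (right_chart A c)" "y \<in> chart_dom (right_chart A c')"
    and Y: "coords (right_chart A c) y = ((((q, p), z), ((a0, b0), s0)), w0)"
      "coords (right_chart A c') y = ((((Q, P), Z), ((A0, B0), S0)), W0)"
  defines "\<phi> \<equiv> transition c c'"
  shows "q \<in> overlap c c'" "Q = \<phi> q" "p \<bullet> w = P \<bullet> FD \<phi> q w" "Z = z" "W0 = w0"
    "\<exists>\<beta>. (\<forall>w. b \<bullet> w = \<beta> \<bullet> FD \<phi> q w + P \<bullet> hess \<phi> q a w) \<and>
      a0 \<bullet> a + b0 \<bullet> b + s0 * t = A0 \<bullet> FD \<phi> q a + B0 \<bullet> \<beta> + S0 * t"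
proof -
  let ?l = "ext_cotangent_chart A c" and ?l' = "ext_cotangent_chart A c'"
  note atlB = smooth_atlas_ext_bundle(2)[OF A(1)] and lA = ext_chart_in_bundle(2)[OF A(2)] and lA' = ext_chart_in_bundle(2)[OF A(3)]
  obtain m \<xi> t0 \<Xi> u0 where y_eq: "y = ((((m, \<xi>), t0), \<Xi>), u0)" by (metis surj_pair)
  let ?x = "((m, \<xi>), t0)"
  have x: "?x \<in> chart_dom ?l" "?x \<in> chart_dom ?l'" and \<Xi>: "\<Xi> \<in> cotangent_space (ext_cotangent_bundle A) ?x"
    using y unfolding y_eq by simp_all
  have m: "m \<in> chart_dom c" "m \<in> chart_dom c'" "\<xi> \<in> cotangent_space A m"
    using x by simp_all
  have Y1: "q = coords c m" "p = \<xi> c" "z = t0" "\<Xi> ?l = ((a0, b0), s0)" "w0 = u0"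
    and Y2: "Q = coords c' m" "P = \<xi> c'" "Z = t0" "\<Xi> ?l' = ((A0, B0), S0)" "W0 = u0"
    using Y unfolding y_eq by simp_all
  show q: "q \<in> overlap c c'" unfolding Y1 by (rule coords_in_overlap[OF m(1,2)])
  show "Q = \<phi> q" unfolding Y1 Y2 \<phi>_def by (rule transition_coords[OF atlas_inj[OF A(1,2)] m(1), symmetric])
  show "p \<bullet> w = P \<bullet> FD \<phi> q w"
    unfolding Y1 Y2 \<phi>_def by (rule cotangent_spaceD[OF m(3) A(2) m(1) A(3) m(2)])
  show "Z = z" "W0 = w0" by (simp_all add: Y1 Y2)
  have lx: "coords ?l ?x = ((q, p), z)" "coords ?l' ?x = ((Q, P), Z)" by (simp_all add: Y1 Y2)
  have tr: "transition ?l ?l' ((q, p), z) = ((Q, P), Z)"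
    using transition_coords[OF atlas_inj[OF atlB lA] x(1), of ?l'] unfolding lx .
  obtain \<alpha> \<beta> \<tau> where F: "FD (transition ?l ?l') ((q, p), z) ((a, b), t) = ((\<alpha>, \<beta>), \<tau>)" by (metis surj_pair)
  note d = FD_ext_cotangent_transition[OF A q, where p = p and z = z and a = a and b = b and t = t]
  have "\<alpha> = FD \<phi> q a" "\<tau> = t" using d(1,2) by (simp_all add: F \<phi>_def)
  moreover have "b \<bullet> w = \<beta> \<bullet> FD \<phi> q w + P \<bullet> hess \<phi> q a w" for w
    using d(3)[of w] by (simp add: F tr \<phi>_def)
  moreover have "a0 \<bullet> a + b0 \<bullet> b + s0 * t = A0 \<bullet> \<alpha> + B0 \<bullet> \<beta> + S0 * \<tau>"
    using cotangent_spaceD[OF \<Xi> lA x(1) lA' x(2), of "((a, b), t)"]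
    unfolding lx F Y1(4) Y2(4) by simp
  ultimately show "\<exists>\<beta>. (\<forall>w. b \<bullet> w = \<beta> \<bullet> FD \<phi> q w + P \<bullet> hess \<phi> q a w) \<and>
      a0 \<bullet> a + b0 \<bullet> b + s0 * t = A0 \<bullet> FD \<phi> q a + B0 \<bullet> \<beta> + S0 * t" by (intro exI[of _ \<beta>]) simp
qed


section \<open>The maps of the triple in charts\<close>

lemma triple_eqI:
  fixes a0 b0 :: "'e::real_inner" and s0 :: real
  assumes "\<And>a b t. a0 \<bullet> a + b0 \<bullet> b + s0 * t = a1 \<bullet> a + b1 \<bullet> b + s1 * t"
  shows "a0 = a1" "b0 = b1" "s0 = s1"
proof -
  show "a0 = a1" by (rule inner_eqI) (use assms[of _ 0 0] in simp)
  show "b0 = b1" by (rule inner_eqI) (use assms[of 0 _ 0] in simp)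
  show "s0 = s1" using assms[of 0 0 1] by simp
qed

text \<open>The momentum conjugate to \<open>q\<close> acquires
  \<open>P \<bullet> hess \<phi> q a q'\<close> because the momentum conjugate to \<open>q'\<close>
  is \<open>P\<close>, and \<open>p'\<close> acquires \<open>P \<bullet> hess \<phi> q q' a\<close>.
  By symmetry these are the same correction.\<close>

lemma alpha_coords_compatible:
  assumes A: "smooth_atlas A" "c \<in> A" "c' \<in> A"
    and x: "x \<in> chart_dom (tulczyjew_chart A c)" "x \<in> chart_dom (tulczyjew_chart A c')"
    and y: "y \<in> chart_dom (left_chart A c)" "y \<in> chart_dom (left_chart A c')"
    and eq: "coords (left_chart A c') y = alpha_coords (coords (tulczyjew_chart A c') x)"
  shows "coords (left_chart A c) y = alpha_coords (coords (tulczyjew_chart A c) x)"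
proof -
  obtain q p z q' p' z' u where X: "coords (tulczyjew_chart A c) x = ((((q, p), z), ((q', p'), z')), u)"
    by (metis surj_pair)
  obtain Q P Z Q' P' Z' U where X': "coords (tulczyjew_chart A c') x = ((((Q, P), Z), ((Q', P'), Z')), U)"
    by (metis surj_pair)
  obtain r v s a0 b0 s0 w0 where Y: "coords (left_chart A c) y = ((((r, v), s), ((a0, b0), s0)), w0)"
    by (metis surj_pair)
  have Y': "coords (left_chart A c') y = ((((Q, Q'), Z), ((U *\<^sub>R P + P', P), - U)), Z')"
    using eq X' by (simp add: alpha_coords_def)
  note t = tulczyjew_change[OF A x X X'] and t' = tulczyjew_change[OF A(1,3,2) x(2,1) X' X]
  note l = left_change[OF A y Y Y'] and l' = left_change[OF A(1,3,2) y(2,1) Y' Y]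
  \<comment> \<open>The coordinates in \<open>c'\<close> are the given ones, so the reversed change
    of charts is used to return to \<open>c\<close>.\<close>
  have base: "r = q" "v = q'" "s = z" "w0 = z'" using t' l' by simp_all
  have "a0 \<bullet> a + b0 \<bullet> b + s0 * \<tau> = (u *\<^sub>R p + p') \<bullet> a + p \<bullet> b + (- u) * \<tau>" for a b \<tau>
  proof -
    have "hess (transition c c') q a q' = hess (transition c c') q q' a"
      by (rule hess_commute[OF atlas_open_overlap[OF A] atlas_smooth_transition[OF A] t(1)])
    then show ?thesis
      using l(6)[of a b \<tau>] t(3)[of a] t(3)[of b] t(6)[of a] t(8)
      by (simp add: base inner_add_left inner_add_right)
  qed
  from triple_eqI[OF this] show ?thesis by (simp add: X Y base alpha_coords_def)
qed

text \<open>The correction in the law of \<open>p'\<close> is now balanced by the pairing of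
  \<open>- q'\<close> with a varied momentum. The last coordinate is consistent because
  \<open>p \<bullet> q'\<close> is the invariant pairing of a covector with a vector.\<close>

lemma beta_coords_compatible:
  assumes A: "smooth_atlas A" "c \<in> A" "c' \<in> A"
    and x: "x \<in> chart_dom (tulczyjew_chart A c)" "x \<in> chart_dom (tulczyjew_chart A c')"
    and y: "y \<in> chart_dom (right_chart A c)" "y \<in> chart_dom (right_chart A c')"
    and eq: "coords (right_chart A c') y = beta_coords (coords (tulczyjew_chart A c') x)"
  shows "coords (right_chart A c) y = beta_coords (coords (tulczyjew_chart A c) x)"
proof -
  obtain q p z q' p' z' u where X: "coords (tulczyjew_chart A c) x = ((((q, p), z), ((q', p'), z')), u)"
    by (metis surj_pair)
  obtain Q P Z Q' P' Z' U where X': "coords (tulczyjew_chart A c') x = ((((Q, P), Z), ((Q', P'), Z')), U)"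
    by (metis surj_pair)
  obtain r v s a0 b0 s0 w0 where Y: "coords (right_chart A c) y = ((((r, v), s), ((a0, b0), s0)), w0)"
    by (metis surj_pair)
  have Y': "coords (right_chart A c') y = ((((Q, P), Z), ((U *\<^sub>R P + P', - Q'), - U)), Z' - P \<bullet> Q')"
    using eq X' by (simp add: beta_coords_def)
  note t = tulczyjew_change[OF A x X X'] and t' = tulczyjew_change[OF A(1,3,2) x(2,1) X' X]
  note l = right_change[OF A y Y Y'] and l' = right_change[OF A(1,3,2) y(2,1) Y' Y]
  have base: "r = q" "s = z" using t'(2,4) l'(2,4) by simp_all
  have "v = p" by (rule inner_eqI) (use l(3) t(3) base in simp)
  have w0: "w0 = z' - p \<bullet> q'" using l(5) t(7) t(3)[of q'] t(5) by simp
  have "a0 \<bullet> a + b0 \<bullet> b + s0 * \<tau> = (u *\<^sub>R p + p') \<bullet> a + (- q') \<bullet> b + (- u) * \<tau>" for a b \<tau>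
  proof -
    have h: "hess (transition c c') q a q' = hess (transition c c') q q' a"
      by (rule hess_commute[OF atlas_open_overlap[OF A] atlas_smooth_transition[OF A] t(1)])
    obtain \<beta> where \<beta>: "\<forall>w. b \<bullet> w = \<beta> \<bullet> FD (transition c c') q w + P \<bullet> hess (transition c c') q a w"
      "a0 \<bullet> a + b0 \<bullet> b + s0 * \<tau> = (U *\<^sub>R P + P') \<bullet> FD (transition c c') q a + (- Q') \<bullet> \<beta> + (- U) * \<tau>"
      using l(6)[of b a \<tau>] unfolding base by (elim exE conjE)
    \<comment> \<open>The implicit law of \<open>\<beta>\<close> is evaluated at
      \<open>w = q'\<close>, the one vector whose transport \<open>Q'\<close> occurs in the
      momenta.\<close>
    have "q' \<bullet> b = Q' \<bullet> \<beta> + P \<bullet> hess (transition c c') q q' a"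
      using \<beta>(1)[rule_format, of q'] t(5) h by (simp add: inner_commute)
    then show ?thesis
      using \<beta>(2) t(3)[of a] t(6)[of a] t(8) by (simp add: inner_add_left)
  qed
  from triple_eqI[OF this] show ?thesis by (simp add: X Y base \<open>v = p\<close> w0 beta_coords_def)
qed

lemma inj_on_triple_chart:
  assumes "smooth_atlas A" "c \<in> A"
  shows "inj_on (coords (tulczyjew_chart A c)) (chart_dom (tulczyjew_chart A c))"
    "inj_on (coords (left_chart A c)) (chart_dom (left_chart A c))"
    "inj_on (coords (right_chart A c)) (chart_dom (right_chart A c))"
proof -
  note atl = smooth_atlas_ext_bundle[OF assms(1)] and ch = ext_chart_in_bundle[OF assms(2)]
  show "inj_on (coords (tulczyjew_chart A c)) (chart_dom (tulczyjew_chart A c))"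
    by (rule atlas_inj[OF smooth_atlas_ext_bundle(1)[OF atl(2)] ext_chart_in_bundle(1)[OF ch(2)]])
  show "inj_on (coords (left_chart A c)) (chart_dom (left_chart A c))"
    by (rule atlas_inj[OF smooth_atlas_ext_bundle(2)[OF atl(1)] ext_chart_in_bundle(2)[OF ch(1)]])
  show "inj_on (coords (right_chart A c)) (chart_dom (right_chart A c))"
    by (rule atlas_inj[OF smooth_atlas_ext_bundle(2)[OF atl(2)] ext_chart_in_bundle(2)[OF ch(2)]])
qed

text \<open>The point prescribed by one chart lies over the same point of the configuration manifold, hence
  in the domains of all other charts around it.\<close>

lemma The_in_charts:
  fixes T K :: "('a, 'e::euclidean_space) chart \<Rightarrow> (('a, 'e) tulczyjew, 'e tulczyjew_model) chart"
  assumes A: "smooth_atlas A" and c: "c \<in> A" and x: "x \<in> chart_dom (T c)"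
    and inj: "inj_on (coords (K c)) (chart_dom (K c))"
    and base: "\<And>c x. base_point (coords (T c) x) = coords c (base_point x)"
      "\<And>c y. base_point (coords (K c) y) = coords c (base_point y)"
      "\<And>X. base_point (\<alpha> X) = base_point X"
    and dom: "\<And>c x. x \<in> chart_dom (T c) \<Longrightarrow> base_point x \<in> chart_dom c"
      "\<And>c y. y \<in> chart_dom (K c) \<Longrightarrow> base_point y \<in> chart_dom c"
      "\<And>c c' y. y \<in> chart_dom (K c) \<Longrightarrow> y \<in> chart_dom (K c') \<longleftrightarrow> base_point y \<in> chart_dom c'"
    and img: "\<alpha> (coords (T c) x) \<in> chart_img (K c)"
    and compatible: "\<And>c' y. c' \<in> A \<Longrightarrow> x \<in> chart_dom (T c') \<Longrightarrow> y \<in> chart_dom (K c') \<Longrightarrow> y \<in> chart_dom (K c) \<Longrightarrow>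
      coords (K c) y = \<alpha> (coords (T c) x) \<Longrightarrow> coords (K c') y = \<alpha> (coords (T c') x)"
  defines "y \<equiv> THE y. \<forall>c\<in>A. x \<in> chart_dom (T c) \<longrightarrow> y \<in> chart_dom (K c) \<and> coords (K c) y = \<alpha> (coords (T c) x)"
  shows "y \<in> chart_dom (K c) \<and> coords (K c) y = \<alpha> (coords (T c) x)"
proof -
  let ?P = "\<lambda>y. \<forall>c\<in>A. x \<in> chart_dom (T c) \<longrightarrow> y \<in> chart_dom (K c) \<and> coords (K c) y = \<alpha> (coords (T c) x)"
  define y0 where "y0 = chart_inv (K c) (\<alpha> (coords (T c) x))"
  have y0: "y0 \<in> chart_dom (K c)" "coords (K c) y0 = \<alpha> (coords (T c) x)"
    unfolding y0_def by (rule chart_inv_in_dom[OF img], rule coords_chart_inv[OF img])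
  have "coords c (base_point y0) = coords c (base_point x)"
    unfolding base(2)[of c y0, symmetric] base(1)[of c x, symmetric] y0(2) by (rule base(3))
  from inj_onD[OF atlas_inj[OF A c] this dom(2)[OF y0(1)] dom(1)[OF x]]
  have b: "base_point y0 = base_point x" .
  have "?P y0"
  proof (intro ballI impI)
    fix c' assume c': "c' \<in> A" "x \<in> chart_dom (T c')"
    then have "y0 \<in> chart_dom (K c')" using dom(3)[OF y0(1), of c'] dom(1)[OF c'(2)] b by simp
    then show "y0 \<in> chart_dom (K c') \<and> coords (K c') y0 = \<alpha> (coords (T c') x)"
      using compatible[OF c' _ y0] by simp
  qed
  moreover have "y' = y0" if "?P y'" for y'
    using bspec[OF that c] x y0 inj_onD[OF inj, of y' y0] by simp
  ultimately have "y = y0" unfolding y_def by (rule the_equality)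
  then show ?thesis using y0 by simp
qed

text \<open>\<open>alpha_coords\<close> preserves the base point, so its values stay in the image of
  the left chart, and compatibility lets one chart decide for all. From here on the description by
  \<open>THE\<close> is no longer unfolded.\<close>

lemma alpha_c_in_charts:
  assumes A: "smooth_atlas A" and c: "c \<in> A" and x: "x \<in> chart_dom (tulczyjew_chart A c)"
  shows "alpha_c A x \<in> chart_dom (left_chart A c) \<and>
    coords (left_chart A c) (alpha_c A x) = alpha_coords (coords (tulczyjew_chart A c) x)"
  unfolding alpha_c_def
proof (rule The_in_charts[where T = "tulczyjew_chart A" and K = "left_chart A" and \<alpha> = alpha_coords,
      OF A c x inj_on_triple_chart(2)[OF A c] base_point_coords(1,2) _ base_point_in_dom(1,2) triple_chart_dom_change(2)])
    show base: "base_point (alpha_coords X) = base_point X" for X :: "'b tulczyjew_model"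
      by (simp add: alpha_coords_def case_prod_beta)
    show "alpha_coords (coords (tulczyjew_chart A c) x) \<in> chart_img (left_chart A c)"
      using coords_in_img[OF x] base unfolding chart_img_triple[OF A c] by (simp add: mem_Times_iff)
qed (assumption | rule alpha_coords_compatible[OF A _ c _ x])+

lemmas alpha_c_chart = alpha_c_in_charts[THEN conjunct1] alpha_c_in_charts[THEN conjunct2]

lemma base_point_beta_coords: "base_point (beta_coords X) = base_point X"
  by (simp add: beta_coords_def case_prod_beta)

lemma beta_c_in_charts:
  assumes A: "smooth_atlas A" and c: "c \<in> A" and x: "x \<in> chart_dom (tulczyjew_chart A c)"
  shows "beta_c A x \<in> chart_dom (right_chart A c) \<and>
    coords (right_chart A c) (beta_c A x) = beta_coords (coords (tulczyjew_chart A c) x)"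
  unfolding beta_c_def
proof (rule The_in_charts[where T = "tulczyjew_chart A" and K = "right_chart A" and \<alpha> = beta_coords,
      OF A c x inj_on_triple_chart(3)[OF A c] base_point_coords(1,3) base_point_beta_coords base_point_in_dom(1,3)
        triple_chart_dom_change(3)])
    show "beta_coords (coords (tulczyjew_chart A c) x) \<in> chart_img (right_chart A c)"
      using coords_in_img[OF x] base_point_beta_coords[of "coords (tulczyjew_chart A c) x"]
      unfolding chart_img_triple[OF A c] by (simp add: mem_Times_iff)
qed (assumption | rule beta_coords_compatible[OF A _ c _ x])+

lemmas beta_c_chart = beta_c_in_charts[THEN conjunct1] beta_c_in_charts[THEN conjunct2]


section \<open>The Lagrangian submanifold\<close>

text \<open>The coordinate expression of the inverse of \<alpha>^c applied to (dl, l). Reading off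
  \<open>p = Lq'\<close> and \<open>u = - Lz\<close>, the equation
  \<open>u *\<^sub>R p + p' = Lq\<close> is solved by
  \<open>p' = Lz *\<^sub>R Lq' + Lq\<close>.\<close>

definition lagrangian_point ::
  "(('e::euclidean_space \<times> 'e) \<times> real \<Rightarrow> real) \<Rightarrow> ('e \<times> 'e) \<times> real \<Rightarrow> 'e tulczyjew_model" where
  "lagrangian_point l b =
     (case (b, grad l b) of (((q, q'), z), ((Lq, Lq'), Lz)) \<Rightarrow>
        ((((q, Lq'), z), ((q', Lz *\<^sub>R Lq' + Lq), l b)), - Lz))"

lemma lagrangian_point_eq:
  "lagrangian_point l = (\<lambda>b. ((((fst (fst b), snd (fst (grad l b))), snd b),
     ((snd (fst b), snd (grad l b) *\<^sub>R snd (fst (grad l b)) + fst (fst (grad l b))), l b)), - snd (grad l b)))"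
  by (rule ext) (simp add: lagrangian_point_def case_prod_beta)

lemma beta_lagrangian_point_eq:
  "beta_coords (lagrangian_point l b) = ((((fst (fst b), snd (fst (grad l b))), snd b),
     ((fst (fst (grad l b)), - snd (fst b)), snd (grad l b))), l b - snd (fst (grad l b)) \<bullet> snd (fst b))"
  by (simp add: lagrangian_point_eq beta_coords_def)

lemma alpha_coords_lagrangian_point:
  "alpha_coords X = ((b, grad l b), l b) \<longleftrightarrow> X = lagrangian_point l b"
proof -
  obtain q p z q' p' z' u where X: "X = ((((q, p), z), ((q', p'), z')), u)" by (metis surj_pair)
  obtain r v s where b: "b = ((r, v), s)" by (metis surj_pair)
  obtain Lq Lq' Lz where g: "grad l b = ((Lq, Lq'), Lz)" by (metis surj_pair)
  have "u *\<^sub>R p + p' = Lq \<and> p = Lq' \<and> - u = Lz \<longleftrightarrow> p = Lq' \<and> p' = Lz *\<^sub>R Lq' + Lq \<and> u = - Lz"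
    by (auto simp: algebra_simps)
  then show ?thesis
    unfolding X lagrangian_point_def g unfolding b by (auto simp: alpha_coords_def)
qed

lemma smooth_on_lagrangian_point:
  assumes "open S" "smooth_on S l"
  shows "smooth_on S (lagrangian_point l)" "smooth_on S (\<lambda>b. beta_coords (lagrangian_point l b))"
proof -
  note g = smooth_on_grad[OF assms] and o = assms(1)
  note g1 = smooth_on_fst[OF o smooth_on_fst[OF o g]] and g2 = smooth_on_snd[OF o smooth_on_fst[OF o g]]
    and g3 = smooth_on_snd[OF o g]
    and b1 = smooth_on_fst[OF o smooth_on_fst[OF o smooth_on_ident]]
    and b2 = smooth_on_snd[OF o smooth_on_fst[OF o smooth_on_ident]]
    and b3 = smooth_on_snd[OF o smooth_on_ident]
  show "smooth_on S (lagrangian_point l)"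
    unfolding lagrangian_point_eq
    by (intro smooth_on_Pair o b1 b2 b3 g2 smooth_on_add smooth_on_scaleR g1 g3 smooth_on_minus assms(2))
  show "smooth_on S (\<lambda>b. beta_coords (lagrangian_point l b))"
    unfolding beta_lagrangian_point_eq
    by (intro smooth_on_Pair o b1 b2 b3 g2 g1 g3 smooth_on_diff smooth_on_minus smooth_on_inner assms(2))
qed

text \<open>Along the image of \<open>lagrangian_point\<close> the contact form restricts to \<open>dl - dl\<close>.\<close>

lemma tulczyjew_coeffs_lagrangian_point:
  assumes "open S" "smooth_on S l" "b \<in> S"
  shows "tulczyjew_coeffs (lagrangian_point l b) \<bullet> FD (lagrangian_point l) b v = 0"
proof -
  note d = smooth_on_differentiable[OF smooth_on_lagrangian_point(1)[OF assms(1,2)] assms(3)]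
  note dl = smooth_on_differentiable[OF assms(2,3)]
  let ?D = "FD (lagrangian_point l) b v"
  have comp: "h ?D = FD (\<lambda>b. h (lagrangian_point l b)) b v" if "linear h" for h :: "_ \<Rightarrow> 'd::real_normed_vector"
    by (rule FD_compose_linear[OF that d, symmetric])
  have lin: "linear (\<lambda>X. fst (fst (fst (fst X))) :: 'a)" "linear (\<lambda>X. snd (fst (fst X)) :: real)"
     "linear (\<lambda>X. fst (fst (snd (fst X))) :: 'a)" "linear (\<lambda>X. snd (snd (fst X)) :: real)"
    by (auto intro!: linearI)
  have "fst (fst (fst (fst ?D))) = fst (fst v)" "snd (fst (fst ?D)) = snd v"
    "fst (fst (snd (fst ?D))) = snd (fst v)" "snd (snd (fst ?D)) = FD l b v"
    using comp[OF lin(1)] comp[OF lin(2)] comp[OF lin(3)] comp[OF lin(4)]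
    by (auto simp: lagrangian_point_eq FD_of_linear linearI)
  moreover obtain Lq Lq' Lz where g: "grad l b = ((Lq, Lq'), Lz)" by (metis surj_pair)
  moreover have "FD l b v = Lq \<bullet> fst (fst v) + Lq' \<bullet> snd (fst v) + Lz * snd v"
    using inner_grad[OF dl, of v] by (simp add: g inner_prod_def)
  ultimately show ?thesis
    by (simp add: tulczyjew_coeffs_eq lagrangian_point_eq inner_prod_def)
qed

text \<open>With \<open>w = l - Lq' \<bullet> q'\<close> and \<open>p = Lq'\<close>, the term
  \<open>- q' \<bullet> dLq'\<close> of dw cancels against the one from the momentum
  \<open>- q'\<close> conjugate to \<open>p\<close>. What is left is
  \<open>dl - Lq dq - Lq' dq' - Lz dz = 0\<close>.\<close>

lemma canonical_coeffs_beta_lagrangian_point: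
  assumes "open S" "smooth_on S l" "b \<in> S"
  shows "canonical_coeffs (beta_coords (lagrangian_point l b)) \<bullet>
    FD (\<lambda>b. beta_coords (lagrangian_point l b)) b v = 0"
proof -
  note d = smooth_on_differentiable[OF smooth_on_lagrangian_point(2)[OF assms(1,2)] assms(3)]
  note dl = smooth_on_has_derivative[OF assms(2,3)]
  \<comment> \<open>The variation of the gradient, that is, the second derivatives of
    \<open>l\<close>. They enter through \<open>p = Lq'\<close> and must drop out of the
    result.\<close>
  define G where "G = FD (grad l) b v"
  note dg = smooth_on_has_derivative[OF smooth_on_grad[OF assms(1,2)] assms(3)]
  have "((\<lambda>b. beta_coords (lagrangian_point l b)) has_derivative
    (\<lambda>v. ((((fst (fst v), snd (fst (FD (grad l) b v))), snd v),
     ((fst (fst (FD (grad l) b v)), - snd (fst v)), snd (FD (grad l) b v))),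
      FD l b v - (snd (fst (grad l b)) \<bullet> snd (fst v) + snd (fst (FD (grad l) b v)) \<bullet> snd (fst b))))) (at b)"
    unfolding beta_lagrangian_point_eq
    by (intro has_derivative_Pair has_derivative_diff has_derivative_minus has_derivative_inner
        has_derivative_fst has_derivative_snd has_derivative_ident dl dg)
  from FD_eq[OF this]
  have D: "FD (\<lambda>b. beta_coords (lagrangian_point l b)) b v = ((((fst (fst v), snd (fst G)), snd v),
     ((fst (fst G), - snd (fst v)), snd G)), FD l b v - (snd (fst (grad l b)) \<bullet> snd (fst v) + snd (fst G) \<bullet> snd (fst b)))"
    by (simp add: G_def)
  obtain Lq Lq' Lz where g: "grad l b = ((Lq, Lq'), Lz)" by (metis surj_pair)
  have "FD l b v = Lq \<bullet> fst (fst v) + Lq' \<bullet> snd (fst v) + Lz * snd v"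
    using inner_grad[OF smooth_on_differentiable[OF assms(2,3)], of v] by (simp add: g inner_prod_def)
  then show ?thesis
    unfolding D unfolding beta_lagrangian_point_eq g
    by (simp add: canonical_coeffs_apply inner_prod_def inner_commute)
qed

locale lagrangian_system =
  fixes A :: "('a, 'e::euclidean_space) chart set"
    and L :: "('a, 'e) based \<times> real \<Rightarrow> real"
  assumes manifold: "smooth_manifold A"
    and smooth_L: "smooth_function (ext_tangent_bundle A) L"
begin

lemmas atl = smooth_manifoldD(1)[OF manifold]

abbreviation loc :: "('a, 'e) chart \<Rightarrow> ('e \<times> 'e) \<times> real \<Rightarrow> real" where
  "loc c \<equiv> L \<circ> chart_inv (ext_tangent_chart A c)"

abbreviation velocities :: "('a, 'e) chart \<Rightarrow> (('e \<times> 'e) \<times> real) set" where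
  "velocities c \<equiv> chart_img (ext_tangent_chart A c)"

lemma open_velocities: "c \<in> A \<Longrightarrow> open (velocities c)"
  by (rule atlas_open_img[OF smooth_atlas_ext_bundle(1)[OF atl] ext_chart_in_bundle(1)])

lemma smooth_loc: "c \<in> A \<Longrightarrow> smooth_on (velocities c) (loc c)"
  by (rule smooth_function_chart[OF smooth_L ext_chart_in_bundle(1)])

lemma velocities_iff: "c \<in> A \<Longrightarrow> ((q, v), z) \<in> velocities c \<longleftrightarrow> q \<in> chart_img c"
  by (simp only: chart_img_triple(1)[OF atl]) simp

lemma lagrangian_point_in_img:
  assumes "c \<in> A"
  shows "lagrangian_point l b \<in> chart_img (tulczyjew_chart A c) \<longleftrightarrow> b \<in> velocities c"
    "beta_coords (lagrangian_point l b) \<in> chart_img (right_chart A c) \<longleftrightarrow> b \<in> velocities c"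
  unfolding beta_lagrangian_point_eq unfolding lagrangian_point_eq chart_img_triple[OF atl assms]
  by (auto simp: mem_Times_iff)

lemma in_N_L_iff:
  assumes c: "c \<in> A" and x: "x \<in> chart_dom (tulczyjew_chart A c)"
  shows "x \<in> N_L A L \<longleftrightarrow> (\<exists>b\<in>velocities c. coords (tulczyjew_chart A c) x = lagrangian_point (loc c) b)"
proof -
  have "x \<in> points (tulczyjew_bundle A)"
    using x ext_chart_in_bundle(1)[OF ext_chart_in_bundle(2)[OF c]] unfolding points_def by blast
  then have "x \<in> N_L A L \<longleftrightarrow> alpha_c A x \<in> jet_image (ext_tangent_bundle A) L" by (simp add: N_L_def)
  also have "\<dots> \<longleftrightarrow> (\<exists>b. coords (left_chart A c) (alpha_c A x) = ((b, grad (loc c) b), loc c b))"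
    by (rule jet_image_iff[OF smooth_atlas_ext_bundle(1)[OF atl] smooth_L ext_chart_in_bundle(1)[OF c] alpha_c_chart(1)[OF atl c x]])
  also have "\<dots> \<longleftrightarrow> (\<exists>b. coords (tulczyjew_chart A c) x = lagrangian_point (loc c) b)"
    unfolding alpha_c_chart(2)[OF atl c x] alpha_coords_lagrangian_point ..
  also have "\<dots> \<longleftrightarrow> (\<exists>b\<in>velocities c. coords (tulczyjew_chart A c) x = lagrangian_point (loc c) b)"
  proof -
    have "b \<in> velocities c" if "coords (tulczyjew_chart A c) x = lagrangian_point (loc c) b" for b
      using coords_in_img[OF x] lagrangian_point_in_img(1)[OF c, of "loc c" b] that by simp
    then show ?thesis by (auto simp only: Bex_def)
  qed
  finally show ?thesis .
qed

lemma points_tulczyjewE: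
  assumes "x \<in> points (tulczyjew_bundle A)"
  obtains c where "c \<in> A" "x \<in> chart_dom (tulczyjew_chart A c)"
proof -
  obtain k where k: "k \<in> tulczyjew_bundle A" "x \<in> chart_dom k" using assms unfolding points_def by blast
  obtain l where l: "l \<in> ext_cotangent_bundle A" "k = ext_tangent_chart (ext_cotangent_bundle A) l"
    using k(1) by (rule ext_tangent_bundleE)
  obtain c where c: "c \<in> A" "l = ext_cotangent_chart A c" using l(1) by (rule ext_cotangent_bundleE)
  show thesis by (rule that[of c]) (use k l c in simp_all)
qed

lemma N_L_eq:
  "N_L A L = {x. \<exists>c\<in>A. \<exists>b\<in>velocities c. x \<in> chart_dom (tulczyjew_chart A c) \<and>
     coords (tulczyjew_chart A c) x = lagrangian_point (loc c) b}" (is "_ = ?R")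
proof (intro subset_antisym subsetI)
  fix x assume x: "x \<in> N_L A L"
  then have "x \<in> points (tulczyjew_bundle A)" by (simp add: N_L_def)
  then obtain c where c: "c \<in> A" "x \<in> chart_dom (tulczyjew_chart A c)" by (rule points_tulczyjewE)
  obtain b where "b \<in> velocities c" "coords (tulczyjew_chart A c) x = lagrangian_point (loc c) b"
    using x unfolding in_N_L_iff[OF c] by (elim bexE)
  then show "x \<in> ?R" unfolding mem_Collect_eq by (intro bexI[of _ c] bexI[of _ b] conjI c)
next
  fix x assume "x \<in> ?R"
  then show "x \<in> N_L A L" unfolding mem_Collect_eq
    by (elim bexE conjE) (subst in_N_L_iff, assumption+, rule bexI)
qed

text \<open>The projection reads off the velocity coordinates (q, q', z); its section fills the
  remaining entries \<open>p\<close>, \<open>p'\<close>, \<open>z'\<close> and \<open>u\<close> with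
  zeros.\<close>

theorem legendrian_N_L: "legendrian_submanifold (tulczyjew_bundle A) (tulczyjew_contact_form A) (N_L A L)"
  unfolding tulczyjew_contact_form_eq
proof (rule legendrian_graph[where I = A and K = "tulczyjew_chart A" and U = velocities
      and j = "\<lambda>c. lagrangian_point (loc c)"
      and \<rho> = "\<lambda>X. ((fst (fst (fst (fst X))), fst (fst (snd (fst X)))), snd (fst (fst X)))"
      and \<iota> = "\<lambda>b. ((((fst (fst b), 0), snd b), ((snd (fst b), 0), 0)), 0)"])
  show "contact_manifold (tulczyjew_bundle A) (uniform_form (tulczyjew_bundle A) tulczyjew_coeffs)"
    using contact_manifold_tulczyjew[OF manifold] unfolding tulczyjew_contact_form_eq .
  show "DIM('e tulczyjew_model) = 2 * DIM(('e \<times> 'e) \<times> real) + 1" by simp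
  show "linear (\<lambda>X::'e tulczyjew_model. ((fst (fst (fst (fst X))), fst (fst (snd (fst X)))), snd (fst (fst X))))"
    "linear (\<lambda>b::('e \<times> 'e) \<times> real. ((((fst (fst b), 0), snd b), ((snd (fst b), 0), 0)), 0) :: 'e tulczyjew_model)"
    by (auto intro!: linearI)
  show "N_L A L \<subseteq> points (tulczyjew_bundle A)" by (auto simp: N_L_def)
  show "tulczyjew_chart A c \<in> tulczyjew_bundle A" if "c \<in> A" for c
    by (rule ext_chart_in_bundle(1)[OF ext_chart_in_bundle(2)[OF that]])
  show "\<exists>c\<in>A. x \<in> chart_dom (tulczyjew_chart A c)" if "x \<in> N_L A L" for x
    using that unfolding N_L_eq mem_Collect_eq by (elim bexE conjE) (rule bexI)
  fix c assume c: "c \<in> A"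
  show "open (velocities c)" by (rule open_velocities[OF c])
  show "smooth_on (velocities c) (lagrangian_point (loc c))"
    by (rule smooth_on_lagrangian_point[OF open_velocities[OF c] smooth_loc[OF c]])
  show "chart_img (tulczyjew_chart A c) =
     (\<lambda>X. ((fst (fst (fst (fst X))), fst (fst (snd (fst X)))), snd (fst (fst X)))) -` velocities c"
    unfolding chart_img_triple[OF atl c] by (auto simp: mem_Times_iff)
  show "coords (tulczyjew_chart A c) ` (chart_dom (tulczyjew_chart A c) \<inter> N_L A L) = lagrangian_point (loc c) ` velocities c"
    by (rule coords_image_graph[OF in_N_L_iff[OF c]]) (simp_all add: lagrangian_point_in_img(1)[OF c])
  show "tulczyjew_coeffs (lagrangian_point (loc c) b) \<bullet> FD (lagrangian_point (loc c)) b v = 0"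
    if "b \<in> velocities c" for b v
    by (rule tulczyjew_coeffs_lagrangian_point[OF open_velocities[OF c] smooth_loc[OF c] that])
qed (simp_all add: lagrangian_point_eq)


section \<open>The energy as a Morse family\<close>

abbreviation E_loc :: "('a, 'e) chart \<Rightarrow> 'e \<times> 'e \<times> 'e \<times> real \<Rightarrow> real" where
  "E_loc c \<equiv> energy A L \<circ> chart_inv (whitney_chart A c)"

lemma chart_img_whitney:
  assumes c: "c \<in> A"
  shows "chart_img (whitney_chart A c) = chart_img c \<times> UNIV"
proof (intro subset_antisym subsetI)
  fix y assume "y \<in> chart_img (whitney_chart A c)"
  then obtain w where w: "w \<in> chart_dom (whitney_chart A c)" "y = coords (whitney_chart A c) w"
    unfolding chart_img_def by (elim imageE)
  obtain x v x' \<xi> z where "w = ((x, v), (x', \<xi>), z)" by (metis surj_pair)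
  then show "y \<in> chart_img c \<times> UNIV" using w by (simp add: whitney_chart_def coords_in_img)
next
  fix y assume y: "y \<in> chart_img c \<times> (UNIV :: ('e \<times> 'e \<times> real) set)"
  obtain q v p z where y_eq: "y = (q, v, p, z)" by (metis surj_pair)
  have "(q, v) \<in> chart_img (tangent_chart A c)" "(q, p) \<in> chart_img (cotangent_chart A c)"
    using y unfolding chart_img_tangent_chart[OF atl c] chart_img_cotangent_chart[OF atl c] y_eq by simp_all
  then obtain a b where a: "(q, v) = coords (tangent_chart A c) a" "a \<in> chart_dom (tangent_chart A c)"
    and b: "(q, p) = coords (cotangent_chart A c) b" "b \<in> chart_dom (cotangent_chart A c)"
    unfolding chart_img_def by (elim imageE)
  obtain x V x' \<xi> where ab: "a = (x, V)" "b = (x', \<xi>)" by (cases a, cases b)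
  have x: "coords c x = q" "V c = v" "x \<in> chart_dom c" "V \<in> tangent_space A x"
    and x': "coords c x' = q" "\<xi> c = p" "x' \<in> chart_dom c" "\<xi> \<in> cotangent_space A x'"
    using a b unfolding ab by simp_all
  have "x' = x"
    by (rule inj_onD[OF atlas_inj[OF atl c] _ x'(3) x(3)]) (simp only: x(1) x'(1))
  then have "((x, V), (x, \<xi>), z) \<in> chart_dom (whitney_chart A c)" "y = coords (whitney_chart A c) ((x, V), (x, \<xi>), z)"
    using x x' unfolding y_eq by (simp_all add: whitney_chart_def)
  then show "y \<in> chart_img (whitney_chart A c)" unfolding chart_img_def by (intro image_eqI)
qed

lemma E_loc_eq:
  assumes c: "c \<in> A" and q: "q \<in> chart_img c"
  shows "E_loc c (q, v, p, z) = p \<bullet> v - loc c ((q, v), z)"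
proof -
  have y: "(q, v, p, z) \<in> chart_img (whitney_chart A c)" using q by (simp add: chart_img_whitney[OF c])
  let ?w = "chart_inv (whitney_chart A c) (q, v, p, z)"
  obtain x V x' \<xi> t where w: "?w = ((x, V), (x', \<xi>), t)" by (metis surj_pair)
  have "((x, V), (x', \<xi>), t) \<in> chart_dom (whitney_chart A c)" "coords (whitney_chart A c) ((x, V), (x', \<xi>), t) = (q, v, p, z)"
    using chart_inv_in_dom[OF y] coords_chart_inv[OF y] unfolding w .
  then have x: "x' = x" "x \<in> chart_dom c" "V \<in> tangent_space A x" "\<xi> \<in> cotangent_space A x"
    and e: "coords c x = q" "V c = v" "\<xi> c = p" "t = z"
    by (simp_all add: whitney_chart_def)
  have "chart_inv (ext_tangent_chart A c) ((q, v), z) = ((x, V), t)"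
    by (rule chart_inv_eqI[OF atlas_inj[OF smooth_atlas_ext_bundle(1)[OF atl] ext_chart_in_bundle(1)[OF c]]])
       (use x e in simp_all)
  moreover have "pairing A x \<xi> V = p \<bullet> v" using pairing_eq[OF x(4,3) c x(2)] e by simp
  ultimately show ?thesis using x(1) w by (simp add: energy_def)
qed

lemma grad_E_loc:
  assumes c: "c \<in> A" and q: "q \<in> chart_img c" and g: "grad (loc c) ((q, v), z) = ((Lq, Lq'), Lz)"
  shows "E_loc c differentiable at (q, v, p, z)" "grad (E_loc c) (q, v, p, z) = (- Lq, p - Lq', v, - Lz)"
proof -
  have "((q, v), z) \<in> velocities c" using velocities_iff[OF c] q by simp
  note dl = smooth_on_differentiable[OF smooth_loc[OF c] this]
  have d: "((\<lambda>y. fst (snd (snd y)) \<bullet> fst (snd y) - loc c ((fst y, fst (snd y)), snd (snd (snd y)))) has_derivative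
    (\<lambda>\<delta>. (p \<bullet> fst (snd \<delta>) + fst (snd (snd \<delta>)) \<bullet> v) - FD (loc c) ((q, v), z) ((fst \<delta>, fst (snd \<delta>)), snd (snd (snd \<delta>))))) (at (q, v, p, z))"
  proof (rule has_derivative_diff)
    show "((\<lambda>y. fst (snd (snd y)) \<bullet> fst (snd y)) has_derivative (\<lambda>\<delta>. p \<bullet> fst (snd \<delta>) + fst (snd (snd \<delta>)) \<bullet> v)) (at (q, v, p, z))"
      by (auto intro!: derivative_eq_intros)
    have a: "((\<lambda>y :: 'e \<times> 'e \<times> 'e \<times> real. ((fst y, fst (snd y)), snd (snd (snd y)))) has_derivative
        (\<lambda>\<delta>. ((fst \<delta>, fst (snd \<delta>)), snd (snd (snd \<delta>))))) (at (q, v, p, z))"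
      by (auto intro!: derivative_eq_intros)
    have b: "(loc c has_derivative FD (loc c) ((q, v), z))
        (at ((fst (q, v, p, z), fst (snd (q, v, p, z))), snd (snd (snd (q, v, p, z)))))"
      unfolding fst_conv snd_conv by (rule FD_works[OF dl])
    show "((\<lambda>y. loc c ((fst y, fst (snd y)), snd (snd (snd y)))) has_derivative
      (\<lambda>\<delta>. FD (loc c) ((q, v), z) ((fst \<delta>, fst (snd \<delta>)), snd (snd (snd \<delta>))))) (at (q, v, p, z))"
      by (rule has_derivative_compose[OF a b])
  qed
  have S: "open (chart_img c \<times> (UNIV :: ('e \<times> 'e \<times> real) set))" "(q, v, p, z) \<in> chart_img c \<times> UNIV"
    using atlas_open_img[OF atl c] q by (simp_all add: open_Times)
  have e: "fst (snd (snd y)) \<bullet> fst (snd y) - loc c ((fst y, fst (snd y)), snd (snd (snd y))) = E_loc c y"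
    if "y \<in> chart_img c \<times> UNIV" for y
  proof -
    obtain q v p z where y: "y = (q, v, p, z)" by (metis surj_pair)
    then show ?thesis using E_loc_eq[OF c, of q v p z] that by simp
  qed
  have "(p \<bullet> fst (snd \<delta>) + fst (snd (snd \<delta>)) \<bullet> v)
      - FD (loc c) ((q, v), z) ((fst \<delta>, fst (snd \<delta>)), snd (snd (snd \<delta>))) = (- Lq, p - Lq', v, - Lz) \<bullet> \<delta>" for \<delta>
    unfolding inner_grad[OF dl, symmetric] g
    by (simp add: inner_prod_def inner_diff_left inner_commute)
  with has_derivative_transform_within_open[OF d S e]
  have dE: "(E_loc c has_derivative (\<lambda>\<delta>. (- Lq, p - Lq', v, - Lz) \<bullet> \<delta>)) (at (q, v, p, z))" by (simp only:)
  show "E_loc c differentiable at (q, v, p, z)" by (rule differentiableI[OF dE])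
  show "grad (E_loc c) (q, v, p, z) = (- Lq, p - Lq', v, - Lz)" by (rule grad_eqI[OF dE])
qed

end

lemma grad_triple:
  fixes f :: "('a::euclidean_space \<times> 'b::euclidean_space) \<times> 'c::euclidean_space \<Rightarrow> real"
  assumes "f differentiable at ((x, y), z)"
  shows "grad f ((x, y), z) =
    ((grad (\<lambda>a. f ((a, y), z)) x, grad (\<lambda>a. f ((x, a), z)) y), grad (\<lambda>a. f ((x, y), a)) z)"
  using grad_Pair[OF assms] grad_Pair[OF differentiable_partials(1)[OF assms]] by simp

lemma grad_quadruple:
  fixes f :: "'a::euclidean_space \<times> 'b::euclidean_space \<times> 'c::euclidean_space \<times> 'd::euclidean_space \<Rightarrow> real"
  assumes "f differentiable at (x, y, z, w)"
  shows "grad f (x, y, z, w) = (grad (\<lambda>a. f (a, y, z, w)) x, grad (\<lambda>a. f (x, a, z, w)) y,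
    grad (\<lambda>a. f (x, y, a, w)) z, grad (\<lambda>a. f (x, y, z, a)) w)"
  using grad_Pair[OF assms] grad_Pair[OF differentiable_partials(2)[OF assms]]
    grad_Pair[OF differentiable_partials(2)[OF differentiable_partials(2)[OF assms]]] by simp

lemma grad_minus:
  assumes "f differentiable at x"
  shows "grad (\<lambda>y. - f y) x = - grad f x"
proof (rule grad_eqI)
  show "((\<lambda>y. - f y) has_derivative (\<bullet>) (- grad f x)) (at x)"
    using has_derivative_minus[OF FD_works[OF assms]] by (simp add: inner_grad[OF assms, symmetric] inner_minus_left[abs_def])
qed

context lagrangian_system
begin

lemma E_loc_partials:
  assumes "c \<in> A" "q \<in> chart_img c" "grad (loc c) ((q, v), z) = ((Lq, Lq'), Lz)"
  shows "grad (\<lambda>a. E_loc c (a, v, p, z)) q = - Lq" "grad (\<lambda>a. E_loc c (q, a, p, z)) v = p - Lq'"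
    "grad (\<lambda>a. E_loc c (q, v, a, z)) p = v" "grad (\<lambda>a. E_loc c (q, v, p, a)) z = - Lz"
  using grad_quadruple[OF grad_E_loc(1)[OF assms]] grad_E_loc(2)[OF assms] by (metis prod.inject)+

lemma minus_E_loc_partials:
  assumes "c \<in> A" "q \<in> chart_img c" "grad (loc c) ((q, v), z) = ((Lq, Lq'), Lz)"
  shows "grad (\<lambda>a. - E_loc c (a, v, p, z)) q = Lq" "grad (\<lambda>a. - E_loc c (q, a, p, z)) v = Lq' - p"
    "grad (\<lambda>a. - E_loc c (q, v, a, z)) p = - v" "grad (\<lambda>a. - E_loc c (q, v, p, a)) z = Lz"
  using grad_quadruple[OF differentiable_minus[OF grad_E_loc(1)[OF assms, of p]]]
  unfolding grad_minus[OF grad_E_loc(1)[OF assms, of p]] grad_E_loc(2)[OF assms] by simp_all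

lemma minus_energy_chart:
  "(\<lambda>b. - energy A L b) \<circ> chart_inv (whitney_chart A c) = (\<lambda>y. - E_loc c y)"
  by (simp add: o_def)

text \<open>The fibre derivative of -E is \<open>Lq' - p\<close>. Its derivative in the direction of
  \<open>p\<close> is minus the identity, which is surjective however degenerate the second
  derivative of L in the velocities may be.\<close>

theorem morse_family_minus_energy: "morse_family A (\<lambda>b. - energy A L b)"
  unfolding morse_family_def smooth_function_def whitney_sum_def Let_def
proof (intro conjI ballI impI)
  fix k assume "k \<in> whitney_chart A ` A"
  then obtain c where k: "k = whitney_chart A c" and c: "c \<in> A" by (elim imageE)
  let ?S = "chart_img c \<times> (UNIV :: ('e \<times> 'e \<times> real) set)"
  let ?b = "\<lambda>y :: 'e \<times> 'e \<times> 'e \<times> real. ((fst y, fst (snd y)), snd (snd (snd y)))"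
  have op: "open ?S" using atlas_open_img[OF atl c] by (simp add: open_Times)
  have sb: "smooth_on ?S ?b"
    by (intro smooth_on_Pair op smooth_on_fst smooth_on_snd smooth_on_ident)
  have bS: "?b ` ?S \<subseteq> velocities c"
    unfolding chart_img_triple[OF atl c] by auto
  have "smooth_on ?S (\<lambda>y. loc c (?b y) - fst (snd (snd y)) \<bullet> fst (snd y))"
    by (rule smooth_on_diff[OF op smooth_on_compose[OF op open_velocities[OF c] bS sb smooth_loc[OF c]]])
       (intro smooth_on_inner op smooth_on_fst smooth_on_snd smooth_on_ident)
  then show "smooth_on (chart_img k) ((\<lambda>b. - energy A L b) \<circ> chart_inv k)"
    unfolding k chart_img_whitney[OF c] minus_energy_chart
  proof (rule smooth_on_cong[OF op, rotated])
    fix y assume y: "y \<in> ?S"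
    obtain q v p z where "y = (q, v, p, z)" by (metis surj_pair)
    then show "loc c (?b y) - fst (snd (snd y)) \<bullet> fst (snd y) = - E_loc c y"
      using E_loc_eq[OF c, of q v p z] y by simp
  qed
  fix y assume "y \<in> chart_img k"
  then have y: "y \<in> ?S" unfolding k chart_img_whitney[OF c] .
  let ?F = "\<lambda>(q, q', p, z). grad (\<lambda>v. ((\<lambda>b. - energy A L b) \<circ> chart_inv k) (q, v, p, z)) q'"
  let ?P = "\<lambda>b. snd (fst (grad (loc c) b))"
  have F: "?P (?b y) - fst (snd (snd y)) = ?F y" if y: "y \<in> ?S" for y
  proof -
    obtain q v p z where y_eq: "y = (q, v, p, z)" by (metis surj_pair)
    obtain Lq Lq' Lz where "grad (loc c) ((q, v), z) = ((Lq, Lq'), Lz)" by (metis surj_pair)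
    with minus_E_loc_partials(2)[OF c _ this, of p] y show ?thesis
      unfolding k minus_energy_chart y_eq by simp
  qed
  have "?b y \<in> velocities c" using bS y by blast
  have "smooth_on (velocities c) ?P"
    by (intro smooth_on_snd smooth_on_fst smooth_on_grad open_velocities c smooth_loc)
  from smooth_on_has_derivative[OF this \<open>?b y \<in> velocities c\<close>]
  have dP: "(?P has_derivative FD ?P (?b y)) (at (?b y))" .
  have "(?b has_derivative ?b) (at y)" by (auto intro!: derivative_eq_intros)
  from has_derivative_compose[OF this dP]
  have "((\<lambda>y. ?P (?b y) - fst (snd (snd y))) has_derivative (\<lambda>\<delta>. FD ?P (?b y) (?b \<delta>) - fst (snd (snd \<delta>)))) (at y)"
    by (intro has_derivative_diff) (auto intro!: derivative_eq_intros)
  from has_derivative_transform_within_open[OF this op y F]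
  have "FD ?F y = (\<lambda>\<delta>. FD ?P (?b y) (?b \<delta>) - fst (snd (snd \<delta>)))"
    by (rule FD_eq)
  moreover have "FD ?P (?b y) 0 = 0"
    using linear_0[OF FD_linear[OF differentiableI[OF dP]]] .
  \<comment> \<open>Varying the momentum alone leaves the Lagrangian part fixed; the sign of the
    witness undoes the minus sign of \<open>p\<close>.\<close>
  ultimately have "FD ?F y (0, 0, - w, 0) = w" for w
    by (simp add: zero_prod_def)
  then show "surj (FD ?F y)" by (rule surjI[where f = "\<lambda>w. (0, 0, - w, 0)"])
qed


section \<open>The Legendrian submanifold generated by the energy\<close>

abbreviation generated_point :: "('a, 'e) chart \<Rightarrow> 'e \<Rightarrow> 'e \<Rightarrow> 'e \<Rightarrow> real \<Rightarrow> 'e tulczyjew_model" where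
  "generated_point c q q' p z \<equiv>
    ((((q, p), z), ((grad (\<lambda>a. - E_loc c (a, q', p, z)) q, grad (\<lambda>a. - E_loc c (q, q', a, z)) p),
          grad (\<lambda>a. - E_loc c (q, q', p, a)) z)), - E_loc c (q, q', p, z))"

text \<open>On the critical set \<open>p = Lq'\<close>, the value -E is
  \<open>l - Lq' \<bullet> q'\<close> and the derivative of -E in \<open>p\<close> is
  \<open>- q'\<close>. These are exactly the last coordinate and the second momentum produced by
  \<open>beta_coords\<close>.\<close>

lemma N_minus_E_condition:
  assumes c: "c \<in> A" and q: "q \<in> chart_img c"
  shows "grad (\<lambda>v. - E_loc c (q, v, p, z)) q' = 0 \<and>
      Y = generated_point c q q' p z
    \<longleftrightarrow> p = snd (fst (grad (loc c) ((q, q'), z))) \<and> Y = beta_coords (lagrangian_point (loc c) ((q, q'), z))"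
proof -
  obtain Lq Lq' Lz where g: "grad (loc c) ((q, q'), z) = ((Lq, Lq'), Lz)" by (metis surj_pair)
  note m = minus_E_loc_partials[OF c q g, of p]
  show ?thesis
    unfolding m unfolding beta_lagrangian_point_eq g E_loc_eq[OF c q] by auto
qed

text \<open>The fibre condition eliminates \<open>p\<close>, so the parameters (q, q', p, z) shrink
  to the velocity coordinates and the set becomes a union of graphs over them.\<close>

lemma N_minus_E_eq:
  "N_minus_E A L = {x. \<exists>c\<in>A. \<exists>b\<in>velocities c. x \<in> chart_dom (right_chart A c) \<and>
     coords (right_chart A c) x = beta_coords (lagrangian_point (loc c) b)}" (is "_ = ?R")
proof (intro subset_antisym subsetI)
  fix x assume "x \<in> N_minus_E A L"
  then obtain c q q' p z where c: "c \<in> A" and y: "(q, q', p, z) \<in> chart_img (whitney_chart A c)"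
    and x: "x \<in> chart_dom (right_chart A c)"
    and e: "grad (\<lambda>v. - E_loc c (q, v, p, z)) q' = 0 \<and> coords (right_chart A c) x
      = generated_point c q q' p z"
    unfolding N_minus_E_def generated_by_def minus_energy_chart Let_def mem_Collect_eq
    by (elim bexE exE conjE) (intro that conjI)
  have q: "q \<in> chart_img c" using y by (simp add: chart_img_whitney[OF c])
  have "coords (right_chart A c) x = beta_coords (lagrangian_point (loc c) ((q, q'), z))"
    using e unfolding N_minus_E_condition[OF c q] by (rule conjunct2)
  moreover have "((q, q'), z) \<in> velocities c" using velocities_iff[OF c] q by simp
  ultimately show "x \<in> ?R" unfolding mem_Collect_eq using c x by (intro bexI conjI)
next
  fix x assume "x \<in> ?R"
  then obtain c b where c: "c \<in> A" and b: "b \<in> velocities c" and x: "x \<in> chart_dom (right_chart A c)"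
    and e: "coords (right_chart A c) x = beta_coords (lagrangian_point (loc c) b)"
    unfolding mem_Collect_eq by (elim bexE conjE)
  obtain q q' z where b_eq: "b = ((q, q'), z)" by (metis surj_pair)
  have q: "q \<in> chart_img c" using b velocities_iff[OF c] unfolding b_eq by simp
  \<comment> \<open>The only momentum that satisfies the fibre condition at the given
    velocity.\<close>
  define p where "p = snd (fst (grad (loc c) ((q, q'), z)))"
  have "(q, q', p, z) \<in> chart_img (whitney_chart A c)" using q by (simp add: chart_img_whitney[OF c])
  moreover have "p = snd (fst (grad (loc c) ((q, q'), z))) \<and> coords (right_chart A c) x = beta_coords (lagrangian_point (loc c) ((q, q'), z))"
    using e by (simp add: p_def b_eq)
  then have "grad (\<lambda>v. - E_loc c (q, v, p, z)) q' = 0 \<and> coords (right_chart A c) x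
      = generated_point c q q' p z"
    unfolding N_minus_E_condition[OF c q] .
  ultimately show "x \<in> N_minus_E A L"
    unfolding N_minus_E_def generated_by_def minus_energy_chart Let_def mem_Collect_eq
    using x by (elim conjE) (intro bexI[OF _ c] exI conjI)
qed

lemma beta_coords_inj: "beta_coords X = beta_coords X' \<Longrightarrow> X = X'"
proof -
  assume e: "beta_coords X = beta_coords X'"
  obtain q p z q' p' z' u where X: "X = ((((q, p), z), ((q', p'), z')), u)" by (metis surj_pair)
  obtain Q P Z Q' P' Z' U where X': "X' = ((((Q, P), Z), ((Q', P'), Z')), U)" by (metis surj_pair)
  show "X = X'" using e unfolding X X' by (auto simp: beta_coords_def)
qed

text \<open>The description in some chart \<open>c'\<close> is carried to the given chart by a
  detour through N_L: \<open>x\<close> is the image under \<open>beta_c\<close> of a point of N_L,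
  and N_L has its description in every chart because it is defined by the global map
  \<open>alpha_c\<close>.\<close>

lemma in_N_minus_E_iff:
  assumes c: "c \<in> A" and x: "x \<in> chart_dom (right_chart A c)"
  shows "x \<in> N_minus_E A L \<longleftrightarrow> (\<exists>b\<in>velocities c. coords (right_chart A c) x = beta_coords (lagrangian_point (loc c) b))"
proof
  assume "\<exists>b\<in>velocities c. coords (right_chart A c) x = beta_coords (lagrangian_point (loc c) b)"
  then show "x \<in> N_minus_E A L" unfolding N_minus_E_eq mem_Collect_eq using c x
    by (elim bexE) (intro bexI[OF _ c] bexI conjI)
next
  assume "x \<in> N_minus_E A L"
  then obtain c' b where c': "c' \<in> A" and b: "b \<in> velocities c'" and x': "x \<in> chart_dom (right_chart A c')"
    and e: "coords (right_chart A c') x = beta_coords (lagrangian_point (loc c') b)"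
    unfolding N_minus_E_eq mem_Collect_eq by (elim bexE conjE)
  let ?X = "lagrangian_point (loc c') b"
  have X: "?X \<in> chart_img (tulczyjew_chart A c')" using lagrangian_point_in_img(1)[OF c'] b by simp
  \<comment> \<open>The point of N_L over which \<open>x\<close> lies. It has the same base point as
    \<open>x\<close>, so it also belongs to the chart over \<open>c\<close>, where membership in N_L
    supplies new velocity coordinates.\<close>
  define y where "y = chart_inv (tulczyjew_chart A c') ?X"
  have y: "y \<in> chart_dom (tulczyjew_chart A c')" "coords (tulczyjew_chart A c') y = ?X"
    unfolding y_def by (rule chart_inv_in_dom[OF X], rule coords_chart_inv[OF X])
  have yN: "y \<in> N_L A L" unfolding in_N_L_iff[OF c' y(1)] y(2) by (rule bexI[OF refl b])
  have xy: "x = beta_c A y"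
    by (rule inj_onD[OF inj_on_triple_chart(3)[OF atl c'] _ x' beta_c_chart(1)[OF atl c' y(1)]])
       (simp only: e beta_c_chart(2)[OF atl c' y(1)] y(2))
  have "coords c' (base_point y) = coords c' (base_point x)"
    unfolding base_point_coords(3)[of A c' x, symmetric] base_point_coords(1)[of A c' y, symmetric] y(2) e
    by (rule base_point_beta_coords[symmetric])
  from inj_onD[OF atlas_inj[OF atl c'] this base_point_in_dom(1)[OF y(1)] base_point_in_dom(3)[OF x']]
  have "base_point y = base_point x" .
  then have yc: "y \<in> chart_dom (tulczyjew_chart A c)"
    using triple_chart_dom_change(1)[OF y(1), of c] base_point_in_dom(3)[OF x] by simp
  obtain b' where "b' \<in> velocities c" "coords (tulczyjew_chart A c) y = lagrangian_point (loc c) b'"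
    using yN unfolding in_N_L_iff[OF c yc] by (elim bexE)
  then show "\<exists>b\<in>velocities c. coords (right_chart A c) x = beta_coords (lagrangian_point (loc c) b)"
    unfolding xy beta_c_chart(2)[OF atl c yc] by (intro bexI[of _ b']) simp_all
qed

text \<open>Read in one chart, both memberships become the same equation, since
  \<open>beta_coords\<close> is injective.\<close>

theorem beta_c_preimage_N_minus_E:
  "{x \<in> points (tulczyjew_bundle A). beta_c A x \<in> N_minus_E A L} = N_L A L"
proof -
  have "beta_c A x \<in> N_minus_E A L \<longleftrightarrow> x \<in> N_L A L" if x: "x \<in> points (tulczyjew_bundle A)" for x
  proof -
    obtain c where c: "c \<in> A" "x \<in> chart_dom (tulczyjew_chart A c)" using x by (rule points_tulczyjewE)
    have "beta_coords (coords (tulczyjew_chart A c) x) = beta_coords (lagrangian_point (loc c) b)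
      \<longleftrightarrow> coords (tulczyjew_chart A c) x = lagrangian_point (loc c) b" for b
      using beta_coords_inj by metis
    then show ?thesis
      unfolding in_N_minus_E_iff[OF c(1) beta_c_chart(1)[OF atl c]] beta_c_chart(2)[OF atl c] in_N_L_iff[OF c] by simp
  qed
  moreover have "N_L A L \<subseteq> points (tulczyjew_bundle A)" by (auto simp: N_L_def)
  ultimately show ?thesis by blast
qed

text \<open>On this side the velocity is minus the momentum conjugate to \<open>p\<close>, hence the sign in the
  projection.\<close>

theorem legendrian_N_minus_E:
  "legendrian_submanifold (right_bundle A) (canonical_contact_form (ext_cotangent_bundle A)) (N_minus_E A L)"
  unfolding canonical_contact_form_eq
proof (rule legendrian_graph[where I = A and K = "right_chart A" and U = velocities
      and j = "\<lambda>c b. beta_coords (lagrangian_point (loc c) b)"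
      and \<rho> = "\<lambda>Y. ((fst (fst (fst (fst Y))), - snd (fst (snd (fst Y)))), snd (fst (fst Y)))"
      and \<iota> = "\<lambda>b. ((((fst (fst b), 0), snd b), ((0, - snd (fst b)), 0)), 0)"])
  show "contact_manifold (right_bundle A) (uniform_form (right_bundle A) canonical_coeffs)"
    using contact_manifold_ext_cotangent_bundle[OF smooth_manifold_ext_bundle(2)[OF manifold]]
    unfolding canonical_contact_form_eq .
  show "DIM('e tulczyjew_model) = 2 * DIM(('e \<times> 'e) \<times> real) + 1" by simp
  show "linear (\<lambda>Y::'e tulczyjew_model. ((fst (fst (fst (fst Y))), - snd (fst (snd (fst Y)))), snd (fst (fst Y))))"
    "linear (\<lambda>b::('e \<times> 'e) \<times> real. ((((fst (fst b), 0), snd b), ((0, - snd (fst b)), 0)), 0) :: 'e tulczyjew_model)"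
    by (auto intro!: linearI)
  show mem: "right_chart A c \<in> right_bundle A" if "c \<in> A" for c
    by (rule ext_chart_in_bundle(2)[OF ext_chart_in_bundle(2)[OF that]])
  show ex: "\<exists>c\<in>A. x \<in> chart_dom (right_chart A c)" if "x \<in> N_minus_E A L" for x
    using that unfolding N_minus_E_eq mem_Collect_eq by (elim bexE conjE) (rule bexI)
  show "N_minus_E A L \<subseteq> points (right_bundle A)"
  proof
    fix x assume "x \<in> N_minus_E A L"
    then obtain c where "c \<in> A" "x \<in> chart_dom (right_chart A c)" using ex by (elim bexE[OF ex])
    then show "x \<in> points (right_bundle A)" using mem[of c] unfolding points_def by (intro UN_I)
  qed
  fix c assume c: "c \<in> A"
  show "open (velocities c)" by (rule open_velocities[OF c])
  show "smooth_on (velocities c) (\<lambda>b. beta_coords (lagrangian_point (loc c) b))"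
    by (rule smooth_on_lagrangian_point[OF open_velocities[OF c] smooth_loc[OF c]])
  show "chart_img (right_chart A c) =
     (\<lambda>Y. ((fst (fst (fst (fst Y))), - snd (fst (snd (fst Y)))), snd (fst (fst Y)))) -` velocities c"
    unfolding chart_img_triple[OF atl c] by (auto simp: mem_Times_iff)
  show "coords (right_chart A c) ` (chart_dom (right_chart A c) \<inter> N_minus_E A L)
    = (\<lambda>b. beta_coords (lagrangian_point (loc c) b)) ` velocities c"
    by (rule coords_image_graph[OF in_N_minus_E_iff[OF c]]) (simp_all add: lagrangian_point_in_img(2)[OF c])
  show "canonical_coeffs (beta_coords (lagrangian_point (loc c) b)) \<bullet> FD (\<lambda>b. beta_coords (lagrangian_point (loc c) b)) b v = 0"
    if "b \<in> velocities c" for b v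
    by (rule canonical_coeffs_beta_lagrangian_point[OF open_velocities[OF c] smooth_loc[OF c] that])
qed (simp_all add: beta_lagrangian_point_eq)

section \<open>The coordinate formulas of the statement\<close>

lemma N_L_explicit:
  "N_L A L =
      {x. \<exists>c\<in>A. \<exists>q q' z. let l = loc c;
           Lq = grad (\<lambda>a. l ((a, q'), z)) q;
           Lq' = grad (\<lambda>a. l ((q, a), z)) q';
           Lz = grad (\<lambda>a. l ((q, q'), a)) z in
         ((q, q'), z) \<in> velocities c \<and>
         x \<in> chart_dom (tulczyjew_chart A c) \<and>
         coords (tulczyjew_chart A c) x =
           ((((q, Lq'), z), ((q', Lz *\<^sub>R Lq' + Lq), l ((q, q'), z))), - Lz)}"
proof -
  have e: "lagrangian_point (loc c) ((q, q'), z) =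
      ((((q, grad (\<lambda>a. loc c ((q, a), z)) q'), z),
        ((q', grad (\<lambda>a. loc c ((q, q'), a)) z *\<^sub>R grad (\<lambda>a. loc c ((q, a), z)) q' + grad (\<lambda>a. loc c ((a, q'), z)) q),
         loc c ((q, q'), z))), - grad (\<lambda>a. loc c ((q, q'), a)) z)"
    if "c \<in> A" "((q, q'), z) \<in> velocities c" for c q q' z
    unfolding lagrangian_point_eq grad_triple[OF smooth_on_differentiable[OF smooth_loc[OF that(1)] that(2)]]
    by simp
  have triples: "(\<exists>b\<in>velocities c. P b) \<longleftrightarrow> (\<exists>q q' z. ((q, q'), z) \<in> velocities c \<and> P ((q, q'), z))" for c P
    by (simp only: Bex_def split_paired_Ex)
  show ?thesis
    unfolding N_L_eq Let_def triples
    \<comment> \<open>Splitting the gradient into partial gradients needs differentiability at the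
      point. The congruence rules provide it by keeping the membership in
      \<open>velocities c\<close> as an assumption.\<close>
    by (intro Collect_cong bex_cong refl ex_cong1 conj_cong) (simp only: e)
qed

lemma N_minus_E_explicit:
  "N_minus_E A L =
      {x. \<exists>c\<in>A. \<exists>q q' p z. let E = E_loc c in
         (q, q', p, z) \<in> chart_img (whitney_chart A c) \<and>
         grad (\<lambda>v. E (q, v, p, z)) q' = 0 \<and>
         x \<in> chart_dom (right_chart A c) \<and>
         coords (right_chart A c) x =
           ((((q, p), z),
             ((- grad (\<lambda>a. E (a, q', p, z)) q, - grad (\<lambda>a. E (q, q', a, z)) p),
              - grad (\<lambda>a. E (q, q', p, a)) z)),
            - E (q, q', p, z))}"
proof -
  have m: "grad (\<lambda>a. - E_loc c (a, v, p, z)) q = - grad (\<lambda>a. E_loc c (a, v, p, z)) q \<and>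
      grad (\<lambda>a. - E_loc c (q, a, p, z)) v = - grad (\<lambda>a. E_loc c (q, a, p, z)) v \<and>
      grad (\<lambda>a. - E_loc c (q, v, a, z)) p = - grad (\<lambda>a. E_loc c (q, v, a, z)) p \<and>
      grad (\<lambda>a. - E_loc c (q, v, p, a)) z = - grad (\<lambda>a. E_loc c (q, v, p, a)) z"
    if "c \<in> A" "(q, v, p, z) \<in> chart_img (whitney_chart A c)" for c q v p z
  proof -
    have q: "q \<in> chart_img c" using that by (simp add: chart_img_whitney)
    obtain Lq Lq' Lz where g: "grad (loc c) ((q, v), z) = ((Lq, Lq'), Lz)" by (metis surj_pair)
    show ?thesis
      unfolding minus_E_loc_partials[OF that(1) q g] E_loc_partials[OF that(1) q g] by simp
  qed
  show ?thesis
    unfolding N_minus_E_def generated_by_def minus_energy_chart Let_def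
    by (intro Collect_cong bex_cong refl ex_cong1 conj_cong) (simp_all only: m neg_equal_0_iff_equal)
qed

end

theorem mainTheorem3:
  fixes A :: "('a, 'e::euclidean_space) chart set"
    and L :: "('a, 'e) based \<times> real \<Rightarrow> real"
  assumes Q: "smooth_manifold A"
    and L: "smooth_function (ext_tangent_bundle A) L"
  shows "(N_L A L =
      {x. \<exists>c\<in>A. \<exists>q q' z. let l = L \<circ> chart_inv (ext_tangent_chart A c);
           Lq = grad (\<lambda>a. l ((a, q'), z)) q;
           Lq' = grad (\<lambda>a. l ((q, a), z)) q';
           Lz = grad (\<lambda>a. l ((q, q'), a)) z in
         ((q, q'), z) \<in> chart_img (ext_tangent_chart A c) \<and>
         x \<in> chart_dom (tulczyjew_chart A c) \<and>
         coords (tulczyjew_chart A c) x =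
           ((((q, Lq'), z), ((q', Lz *\<^sub>R Lq' + Lq), l ((q, q'), z))), - Lz)}) \<and>
     (legendrian_submanifold (tulczyjew_bundle A) (tulczyjew_contact_form A) (N_L A L)) \<and>
     (morse_family A (\<lambda>b. - energy A L b)) \<and>
     (legendrian_submanifold (right_bundle A)
           (canonical_contact_form (ext_cotangent_bundle A)) (N_minus_E A L)) \<and>
     (N_minus_E A L =
      {x. \<exists>c\<in>A. \<exists>q q' p z. let E = energy A L \<circ> chart_inv (whitney_chart A c) in
         (q, q', p, z) \<in> chart_img (whitney_chart A c) \<and>
         grad (\<lambda>v. E (q, v, p, z)) q' = 0 \<and>
         x \<in> chart_dom (right_chart A c) \<and>
         coords (right_chart A c) x =
           ((((q, p), z),
             ((- grad (\<lambda>a. E (a, q', p, z)) q, - grad (\<lambda>a. E (q, q', a, z)) p),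
              - grad (\<lambda>a. E (q, q', p, a)) z)),
            - E (q, q', p, z))}) \<and>
     ({x \<in> points (tulczyjew_bundle A). beta_c A x \<in> N_minus_E A L} = N_L A L)"
proof -
  interpret lagrangian_system A L by (rule lagrangian_system.intro[OF Q L])
  show ?thesis
    by (intro conjI N_L_explicit legendrian_N_L morse_family_minus_energy legendrian_N_minus_E
        N_minus_E_explicit beta_c_preimage_N_minus_E)
qed

end
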